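(* Let $(\mathcal{X}, p(y,z|x), \mathcal{Y}\times\mathcal{Z})$ be a two-receiver discrete memoryless broadcast channel. If a rate triple $(R_0,R_1,R_2)$ lies in its capacity region, then there exist discrete random variables $U,V,W,X,Y,Z$ with joint distribution of the form $$p(u,v,w,x,y,z)=p(u)\,p(v)\,p(w|u,v)\,p(x|u,v,w)\,p(y,z|x)$$ (where $p(y,z|x)$ is the channel transition function) such that \begin{align*} R_0 &\le \min\{I(W;Y),\, I(W;Z)\},\\ R_0+R_1 &\le I(U,W;Y),\\ R_0+R_2 &\le I(V,W;Z),\\ R_0+R_1+R_2 &\le I(U,W;Y)+I(V;Z|U,W),\\ R_0+R_1+R_2 &\le I(V,W;Z)+I(U;Y|V,W). \end{align*} That is, the set of all rate triples satisfying these inequalities for some such distribution contains the capacity region.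
   Context: A two-receiver discrete memoryless (DM) broadcast channel consists of a finite input alphabet $\mathcal{X}$, finite output alphabets $\mathcal{Y},\mathcal{Z}$, and a transition probability $p(y,z|x)$, used memorylessly over $n$ channel uses. A $((2^{nR_0},2^{nR_1},2^{nR_2}),n)$ code consists of three independent messages $(M_0,M_1,M_2)$ uniformly distributed over $[1,2^{nR_0}]\times[1,2^{nR_1}]\times[1,2^{nR_2}]$, an encoder assigning a codeword $x^n(m_0,m_1,m_2)$ to each message triple, a decoder mapping $y^n$ to an estimate $(\hat m_0,\hat m_1)$ and a decoder mapping $z^n$ to an estimate $(\hat{\hat m}_0,\hat m_2)$. The error probability is $P_e^{(n)}=P(\hat M_0\ne M_0 \text{ or } \hat{\hat M}_0\ne M_0 \text{ or } \hat M_1\ne M_1 \text{ or }\hat M_2\ne M_2)$. A triple $(R_0,R_1,R_2)$ is achievable if there is a sequence of such codes with $P_e^{(n)}\to 0$; the capacity region is the closure of the set of achievable triples. ($M_0$ is the common message, $M_1,M_2$ the private messages.) *)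

theory Defs
  imports "HOL-Analysis.Analysis"
begin

definition dm_bc :: "('x::finite \<Rightarrow> 'y::finite \<Rightarrow> 'z::finite \<Rightarrow> real) \<Rightarrow> bool" where
  "dm_bc Ch \<longleftrightarrow> (\<forall>x y z. 0 \<le> Ch x y z) \<and> (\<forall>x. (\<Sum>y\<in>UNIV. \<Sum>z\<in>UNIV. Ch x y z) = 1)"

definition chan_prob :: "('x \<Rightarrow> 'y \<Rightarrow> 'z \<Rightarrow> real) \<Rightarrow> 'x list \<Rightarrow> 'y list \<Rightarrow> 'z list \<Rightarrow> real" where
  "chan_prob Ch xs ys zs = (\<Prod>i<length xs. Ch (xs ! i) (ys ! i) (zs ! i))"

text \<open>Size of the message set [1 : 2^(nR)], taken as ceiling(2^(nR)); messages are
  indexed 0 .. size-1.\<close>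
definition msg_size :: "nat \<Rightarrow> real \<Rightarrow> nat" where
  "msg_size n R = nat \<lceil>2 powr (real n * R)\<rceil>"

definition err_prob ::
  "('x::finite \<Rightarrow> 'y::finite \<Rightarrow> 'z::finite \<Rightarrow> real) \<Rightarrow> nat \<Rightarrow> real \<Rightarrow> real \<Rightarrow> real \<Rightarrow>
   (nat \<Rightarrow> nat \<Rightarrow> nat \<Rightarrow> 'x list) \<Rightarrow> ('y list \<Rightarrow> nat \<times> nat) \<Rightarrow> ('z list \<Rightarrow> nat \<times> nat) \<Rightarrow> real" where
  "err_prob Ch n R0 R1 R2 enc d1 d2 =
     (\<Sum>m0<msg_size n R0. \<Sum>m1<msg_size n R1. \<Sum>m2<msg_size n R2.
        \<Sum>ys\<in>{ys. length ys = n}. \<Sum>zs\<in>{zs. length zs = n}.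
          chan_prob Ch (enc m0 m1 m2) ys zs *
          (if d1 ys = (m0, m1) \<and> d2 zs = (m0, m2) then 0 else 1))
     / (real (msg_size n R0) * real (msg_size n R1) * real (msg_size n R2))"

definition achievable :: "('x::finite \<Rightarrow> 'y::finite \<Rightarrow> 'z::finite \<Rightarrow> real) \<Rightarrow> real \<times> real \<times> real \<Rightarrow> bool" where
  "achievable Ch R \<longleftrightarrow> (case R of (R0, R1, R2) \<Rightarrow>
     0 \<le> R0 \<and> 0 \<le> R1 \<and> 0 \<le> R2 \<and>
     (\<exists>enc :: nat \<Rightarrow> nat \<Rightarrow> nat \<Rightarrow> nat \<Rightarrow> 'x list.
      \<exists>d1 :: nat \<Rightarrow> 'y list \<Rightarrow> nat \<times> nat.
      \<exists>d2 :: nat \<Rightarrow> 'z list \<Rightarrow> nat \<times> nat.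
        (\<forall>n m0 m1 m2. m0 < msg_size n R0 \<longrightarrow> m1 < msg_size n R1 \<longrightarrow> m2 < msg_size n R2
             \<longrightarrow> length (enc n m0 m1 m2) = n) \<and>
        (\<lambda>n. err_prob Ch n R0 R1 R2 (enc n) (d1 n) (d2 n)) \<longlonglongrightarrow> 0))"

definition capacity_region :: "('x::finite \<Rightarrow> 'y::finite \<Rightarrow> 'z::finite \<Rightarrow> real) \<Rightarrow> (real \<times> real \<times> real) set" where
  "capacity_region Ch = closure {R. achievable Ch R}"

text \<open>P is a joint pmf on the finite sample set \<Omega>; random variables are functions on \<Omega>.
  The probability that f takes the value f \<omega>:\<close>
definition marg :: "'o set \<Rightarrow> ('o \<Rightarrow> real) \<Rightarrow> ('o \<Rightarrow> 'a) \<Rightarrow> 'o \<Rightarrow> real" where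
  "marg \<Omega> P f \<omega> = (\<Sum>\<omega>'\<in>{\<omega>'\<in>\<Omega>. f \<omega>' = f \<omega>}. P \<omega>')"

definition cond_mutual_info :: "'o set \<Rightarrow> ('o \<Rightarrow> real) \<Rightarrow> ('o \<Rightarrow> 'a) \<Rightarrow> ('o \<Rightarrow> 'b) \<Rightarrow> ('o \<Rightarrow> 'c) \<Rightarrow> real" where
  "cond_mutual_info \<Omega> P A B C =
     (\<Sum>\<omega>\<in>\<Omega>. P \<omega> * log 2
        ((marg \<Omega> P (\<lambda>t. (A t, B t, C t)) \<omega> * marg \<Omega> P C \<omega>) /
         (marg \<Omega> P (\<lambda>t. (A t, C t)) \<omega> * marg \<Omega> P (\<lambda>t. (B t, C t)) \<omega>)))"

definition mutual_info :: "'o set \<Rightarrow> ('o \<Rightarrow> real) \<Rightarrow> ('o \<Rightarrow> 'a) \<Rightarrow> ('o \<Rightarrow> 'b) \<Rightarrow> real" where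
  "mutual_info \<Omega> P A B = cond_mutual_info \<Omega> P A B (\<lambda>_. ())"

definition is_pmf_on :: "'a set \<Rightarrow> ('a \<Rightarrow> real) \<Rightarrow> bool" where
  "is_pmf_on A p \<longleftrightarrow> (\<forall>a\<in>A. 0 \<le> p a) \<and> sum p A = 1"

definition outer_bound :: "('x::finite \<Rightarrow> 'y::finite \<Rightarrow> 'z::finite \<Rightarrow> real) \<Rightarrow> (real \<times> real \<times> real) set" where
  "outer_bound Ch = {(R0, R1, R2).
     \<exists>(AU :: nat set) (AV :: nat set) (AW :: nat set) pU pV pW (pX :: nat \<Rightarrow> nat \<Rightarrow> nat \<Rightarrow> 'x \<Rightarrow> real).
       finite AU \<and> finite AV \<and> finite AW \<and>
       is_pmf_on AU pU \<and> is_pmf_on AV pV \<and>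
       (\<forall>u\<in>AU. \<forall>v\<in>AV. is_pmf_on AW (pW u v)) \<and>
       (\<forall>u\<in>AU. \<forall>v\<in>AV. \<forall>w\<in>AW. is_pmf_on UNIV (pX u v w)) \<and>
       (let \<Omega> = AU \<times> AV \<times> AW \<times> (UNIV :: 'x set) \<times> (UNIV :: 'y set) \<times> (UNIV :: 'z set);
            P = (\<lambda>(u, v, w, x, y, z). pU u * pV v * pW u v w * pX u v w x * Ch x y z);
            U = (\<lambda>(u, v, w, x, y, z). u);
            V = (\<lambda>(u, v, w, x, y, z). v);
            W = (\<lambda>(u, v, w, x, y, z). w);
            Y = (\<lambda>(u, v, w, x, y, z). y);
            Z = (\<lambda>(u, v, w, x, y, z). z)
        in R0 \<le> min (mutual_info \<Omega> P W Y) (mutual_info \<Omega> P W Z) \<and>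
           R0 + R1 \<le> mutual_info \<Omega> P (\<lambda>t. (U t, W t)) Y \<and>
           R0 + R2 \<le> mutual_info \<Omega> P (\<lambda>t. (V t, W t)) Z \<and>
           R0 + R1 + R2 \<le> mutual_info \<Omega> P (\<lambda>t. (U t, W t)) Y
                            + cond_mutual_info \<Omega> P V Z (\<lambda>t. (U t, W t)) \<and>
           R0 + R1 + R2 \<le> mutual_info \<Omega> P (\<lambda>t. (V t, W t)) Z
                            + cond_mutual_info \<Omega> P U Y (\<lambda>t. (V t, W t)))}"

end

theory Submission
  imports Defs "HOL-Real_Asymp.Real_Asymp" "HOL-Number_Theory.Cong"
begin

text \<open>
  Write \<open>h\<^sub>Y(q)\<close>, \<open>h\<^sub>Z(q)\<close> for the output entropies under the input law \<open>q\<close>. Replacing \<open>I(V;Z|U,W)\<close>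
  and \<open>I(U;Y|V,W)\<close> by the larger \<open>I(X;Z|U,W)\<close> and \<open>I(X;Y|V,W)\<close>, and dropping the independence of
  \<open>U\<close> and \<open>V\<close>, gives constraints that involve \<open>(U,W,X)\<close> and \<open>(V,W,X)\<close> only separately. They are therefore
  described by a point in the convex hull of a compact set built from the graph of \<open>(h\<^sub>Y, h\<^sub>Z)\<close>, so the
  relaxed region is closed, without any cardinality bound.

  The relaxation costs nothing. With independent uniform keys \<open>U' = (K\<^sub>1, L\<^sub>1)\<close>, \<open>V' = (K\<^sub>2, L\<^sub>2)\<close> and
  \<open>W' = (W, U - K\<^sub>1, V - K\<^sub>2, X - L\<^sub>1 - L\<^sub>2)\<close>, the pair \<open>(U', W')\<close> carries exactly the information
  of \<open>(U, W)\<close>, the pair \<open>(V', W')\<close> that of \<open>(V, W)\<close>, whereas all three together determine \<open>X\<close>.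

  An achievable triple satisfies the relaxed constraints by Fano's inequality with
  \<open>W\<^sub>i = (M\<^sub>0, Y\<^sup>i\<^sup>-\<^sup>1, Z\<^sub>i\<^sub>+\<^sub>1\<^sup>n)\<close>, \<open>U = M\<^sub>1\<close>, \<open>V = M\<^sub>2\<close>; the Csiszar sum identity is the telescoping of
  \<open>H(M\<^sub>0, M\<^sub>1, Y\<^sup>i, Z\<^sub>i\<^sub>+\<^sub>1\<^sup>n)\<close> in \<open>i\<close>.
\<close>

section \<open>Entropy on finite probability spaces\<close>

text \<open>The obstacle is the closure in \<open>capacity_region\<close>:
  \<open>outer_bound\<close> admits auxiliary alphabets of every finite size, so limits of its
  points do not visibly stay inside, and the usual support reduction, which perturbs the law of an
  auxiliary variable, does not respect a product law of U and V. Expanded into entropies, the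
  relaxed constraints are affine in the averaged conditional entropies and in the law of X, apart
  from the two output entropies, which are continuous in that law. A distribution thus enters only
  through one point of a fixed finite-dimensional space, where closedness is compactness. Time
  sharing over the letters of a block is absorbed by the same convex hull.

  Padding can restore independence because W may depend arbitrarily on (U, V): all dependence moves
  into W, and its masked entries reveal nothing to whoever lacks the keys. The key of X is split
  between both sides, so that neither side alone can unmask X.

  The Fano losses of both receivers are charged to R0, the one rate that occurs in every
  bound.\<close>

definition eta :: "real \<Rightarrow> real" where
  "eta t = - (t * log 2 t)"

lemma eta_0 [simp]: "eta 0 = 0"
  by (simp add: eta_def)

text \<open>The pointwise form of the chain rule for entropy.\<close>

lemma eta_mult:
  assumes "0 \<le> s" "0 \<le> t"
  shows "eta (s * t) = s * eta t + t * eta s"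
proof (cases "s = 0 \<or> t = 0")
  case False
  then have "0 < s" "0 < t" using assms by auto
  then show ?thesis by (simp add: eta_def log_mult algebra_simps)
qed auto

definition hout :: "('x::finite \<Rightarrow> 'y::finite \<Rightarrow> real) \<Rightarrow> real^'x \<Rightarrow> real" where
  "hout K q = (\<Sum>y\<in>UNIV. eta (\<Sum>x\<in>UNIV. q $ x * K x y))"

text \<open>This is H(Y | X = x); its mean under a law of X is H(Y | X).\<close>

definition hrow :: "('x::finite \<Rightarrow> 'y::finite \<Rightarrow> real) \<Rightarrow> 'x \<Rightarrow> real" where
  "hrow K x = (\<Sum>y\<in>UNIV. eta (K x y))"

definition prob_simplex :: "(real^'x::finite) set" where
  "prob_simplex = {q. (\<forall>x. 0 \<le> q $ x) \<and> (\<Sum>x\<in>UNIV. q $ x) = 1}"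

lemma hout_axis: "hout K (axis x 1) = hrow K x"
proof -
  have "(\<Sum>x'\<in>UNIV. axis x 1 $ x' * K x' y) = K x y" for y
    by (simp add: axis_def if_distrib[of "\<lambda>t. t * _"] sum.delta cong: if_cong)
  then show ?thesis by (simp add: hout_def hrow_def)
qed

lemma axis_in_prob_simplex: "axis x 1 \<in> prob_simplex"
  by (simp add: prob_simplex_def axis_def)

lemma convex_prob_simplex: "convex prob_simplex"
  unfolding convex_def prob_simplex_def
  by (auto simp: sum.distrib sum_distrib_left[symmetric])

text \<open>Membership is demanded only at positive weights, because conditional laws at values of
  probability zero are not probability vectors.\<close>

lemma convex_sum_pos:
  fixes C :: "'v::real_vector set"
  assumes "finite I" "convex C" "(\<Sum>i\<in>I. u i) = 1" "\<And>i. i \<in> I \<Longrightarrow> 0 \<le> u i"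
    "\<And>i. i \<in> I \<Longrightarrow> 0 < u i \<Longrightarrow> x i \<in> C"
  shows "(\<Sum>i\<in>I. u i *\<^sub>R x i) \<in> C"
proof -
  have z: "u i = 0" if "i \<in> I - {i\<in>I. 0 < u i}" for i using assms(4)[of i] that by auto
  have "(\<Sum>i\<in>I. u i) = (\<Sum>i\<in>{i\<in>I. 0 < u i}. u i)"
    using assms(1) z by (intro sum.mono_neutral_right) auto
  moreover have "(\<Sum>i\<in>I. u i *\<^sub>R x i) = (\<Sum>i\<in>{i\<in>I. 0 < u i}. u i *\<^sub>R x i)"
    using assms(1) z by (intro sum.mono_neutral_right) auto
  moreover have "(\<Sum>i\<in>{i\<in>I. 0 < u i}. u i *\<^sub>R x i) \<in> C"
    using assms(1-3,5) calculation(1) by (intro convex_sum) auto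
  ultimately show ?thesis by simp
qed

section \<open>Probabilities, entropies and Shannon inequalities\<close>

locale fin_pmf =
  fixes \<Omega> :: "'o set" and P :: "'o \<Rightarrow> real"
  assumes fin: "finite \<Omega>" and nonneg: "\<And>\<omega>. \<omega> \<in> \<Omega> \<Longrightarrow> 0 \<le> P \<omega>" and total: "sum P \<Omega> = 1"
begin

definition pr :: "('o \<Rightarrow> 'a) \<Rightarrow> 'a \<Rightarrow> real" where
  "pr f a = (\<Sum>\<omega>\<in>{\<omega>\<in>\<Omega>. f \<omega> = a}. P \<omega>)"

definition ent :: "('o \<Rightarrow> 'a) \<Rightarrow> real" where
  "ent f = - (\<Sum>\<omega>\<in>\<Omega>. P \<omega> * log 2 (pr f (f \<omega>)))"

lemma marg_eq_pr: "marg \<Omega> P f \<omega> = pr f (f \<omega>)"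
  by (simp add: marg_def pr_def)

lemma pr_nonneg [simp]: "0 \<le> pr f a"
  unfolding pr_def by (rule sum_nonneg) (auto intro: nonneg)

lemma pr_ge: "\<omega> \<in> \<Omega> \<Longrightarrow> P \<omega> \<le> pr f (f \<omega>)"
  unfolding pr_def using fin by (intro member_le_sum) (auto intro: nonneg)

lemma pr_pos: "\<omega> \<in> \<Omega> \<Longrightarrow> 0 < P \<omega> \<Longrightarrow> 0 < pr f (f \<omega>)"
  using pr_ge[of \<omega> f] by linarith

lemma pr_if: "pr f a = (\<Sum>\<omega>\<in>\<Omega>. if f \<omega> = a then P \<omega> else 0)"
  unfolding pr_def using fin by (simp add: sum.inter_filter)

lemma pr_inj:
  assumes "\<And>\<omega>. \<omega> \<in> \<Omega> \<Longrightarrow> f \<omega> = a \<longleftrightarrow> g \<omega> = b"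
  shows "pr f a = pr g b"
proof -
  have "{\<omega>\<in>\<Omega>. f \<omega> = a} = {\<omega>\<in>\<Omega>. g \<omega> = b}" using assms by blast
  then show ?thesis by (simp add: pr_def)
qed

lemma pr_mono:
  assumes "\<And>\<omega>. \<omega> \<in> \<Omega> \<Longrightarrow> f \<omega> = a \<Longrightarrow> g \<omega> = b"
  shows "pr f a \<le> pr g b"
  unfolding pr_def using fin by (intro sum_mono2) (auto simp: assms intro: nonneg)

lemma expectation_scaleR:
  fixes F :: "'a \<Rightarrow> 'v::real_vector"
  assumes "finite B" "f ` \<Omega> \<subseteq> B"
  shows "(\<Sum>\<omega>\<in>\<Omega>. P \<omega> *\<^sub>R F (f \<omega>)) = (\<Sum>a\<in>B. pr f a *\<^sub>R F a)"
proof -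
  have "(\<Sum>\<omega>\<in>\<Omega>. P \<omega> *\<^sub>R F (f \<omega>)) = (\<Sum>a\<in>B. \<Sum>\<omega>\<in>{\<omega>\<in>\<Omega>. f \<omega> = a}. P \<omega> *\<^sub>R F (f \<omega>))"
    by (rule sum.group[symmetric]) (use assms fin in auto)
  also have "\<dots> = (\<Sum>a\<in>B. pr f a *\<^sub>R F a)"
    by (rule sum.cong) (auto simp: pr_def scaleR_sum_left)
  finally show ?thesis .
qed

lemma expectation:
  fixes F :: "'a \<Rightarrow> real"
  assumes "finite B" "f ` \<Omega> \<subseteq> B"
  shows "(\<Sum>\<omega>\<in>\<Omega>. P \<omega> * F (f \<omega>)) = (\<Sum>a\<in>B. pr f a * F a)"
  using expectation_scaleR[OF assms, of F] by simp

lemma sum_pr: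
  assumes "finite B" "f ` \<Omega> \<subseteq> B"
  shows "(\<Sum>a\<in>B. pr f a) = 1"
  using expectation[OF assms, of "\<lambda>_. 1"] total by simp

lemma pr_marginal:
  assumes "finite B" "A ` \<Omega> \<subseteq> B"
  shows "(\<Sum>a\<in>B. pr (\<lambda>\<omega>. (A \<omega>, C \<omega>)) (a, c)) = pr C c"
proof -
  have "pr C c = (\<Sum>a\<in>B. \<Sum>\<omega>\<in>{\<omega> \<in> {\<omega>\<in>\<Omega>. C \<omega> = c}. A \<omega> = a}. P \<omega>)"
    unfolding pr_def by (rule sum.group[symmetric]) (use assms fin in auto)
  also have "\<dots> = (\<Sum>a\<in>B. pr (\<lambda>\<omega>. (A \<omega>, C \<omega>)) (a, c))"
    unfolding pr_def by (intro sum.cong refl) auto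
  finally show ?thesis by simp
qed

lemma pr_marginal2:
  assumes "finite B" "A ` \<Omega> \<subseteq> B"
  shows "(\<Sum>a\<in>B. pr (\<lambda>\<omega>. (C \<omega>, A \<omega>)) (c, a)) = pr C c"
proof -
  have "pr (\<lambda>\<omega>. (C \<omega>, A \<omega>)) (c, a) = pr (\<lambda>\<omega>. (A \<omega>, C \<omega>)) (a, c)" for a
    by (rule pr_inj) auto
  then show ?thesis using pr_marginal[OF assms, of C c] by simp
qed

lemma ent_eta:
  assumes "finite B" "f ` \<Omega> \<subseteq> B"
  shows "ent f = (\<Sum>a\<in>B. eta (pr f a))"
  unfolding ent_def expectation[OF assms, of "\<lambda>a. log 2 (pr f a)"] eta_def by (simp add: sum_negf)

text \<open>Entropy sees only the partition that a variable induces on the sample set. This is the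
  tool for reordering, regrouping and dropping redundant entries of tuples.\<close>

lemma ent_kernel:
  assumes "\<And>\<omega>1 \<omega>2. \<omega>1 \<in> \<Omega> \<Longrightarrow> \<omega>2 \<in> \<Omega> \<Longrightarrow> f \<omega>1 = f \<omega>2 \<longleftrightarrow> g \<omega>1 = g \<omega>2"
  shows "ent f = ent g"
proof -
  have "pr f (f \<omega>) = pr g (g \<omega>)" if "\<omega> \<in> \<Omega>" for \<omega>
    by (rule pr_inj) (use assms that in auto)
  then show ?thesis unfolding ent_def by simp
qed

lemma ent_mono:
  assumes "\<And>\<omega>1 \<omega>2. \<omega>1 \<in> \<Omega> \<Longrightarrow> \<omega>2 \<in> \<Omega> \<Longrightarrow> f \<omega>1 = f \<omega>2 \<Longrightarrow> g \<omega>1 = g \<omega>2"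
  shows "ent g \<le> ent f"
proof -
  have "P \<omega> * log 2 (pr f (f \<omega>)) \<le> P \<omega> * log 2 (pr g (g \<omega>))" if "\<omega> \<in> \<Omega>" for \<omega>
  proof (cases "P \<omega> = 0")
    case False
    then have "0 < P \<omega>" using nonneg[OF that] by auto
    moreover have "pr f (f \<omega>) \<le> pr g (g \<omega>)"
      by (rule pr_mono) (use assms that in blast)
    ultimately show ?thesis using pr_pos[OF that, of f] pr_pos[OF that, of g]
      by (intro mult_left_mono) auto
  qed simp
  then show ?thesis unfolding ent_def by (simp add: sum_mono)
qed

text \<open>At a sample point of positive mass all four probabilities are positive and the logarithm
  splits; the other points contribute zero to both sides.\<close>

lemma cond_mutual_info_ent:
  "cond_mutual_info \<Omega> P A B C =
     ent (\<lambda>t. (A t, C t)) + ent (\<lambda>t. (B t, C t)) - ent (\<lambda>t. (A t, B t, C t)) - ent C"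
proof -
  have "P \<omega> * log 2 ((marg \<Omega> P (\<lambda>t. (A t, B t, C t)) \<omega> * marg \<Omega> P C \<omega>) /
         (marg \<Omega> P (\<lambda>t. (A t, C t)) \<omega> * marg \<Omega> P (\<lambda>t. (B t, C t)) \<omega>))
      = P \<omega> * log 2 (pr (\<lambda>t. (A t, B t, C t)) (A \<omega>, B \<omega>, C \<omega>)) + P \<omega> * log 2 (pr C (C \<omega>))
       - P \<omega> * log 2 (pr (\<lambda>t. (A t, C t)) (A \<omega>, C \<omega>)) - P \<omega> * log 2 (pr (\<lambda>t. (B t, C t)) (B \<omega>, C \<omega>))"
    if "\<omega> \<in> \<Omega>" for \<omega>
  proof (cases "P \<omega> = 0")
    case False
    then have p: "0 < P \<omega>" using nonneg[OF that] by auto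
    show ?thesis
      using pr_pos[OF that p, of "\<lambda>t. (A t, B t, C t)"] pr_pos[OF that p, of C]
        pr_pos[OF that p, of "\<lambda>t. (A t, C t)"] pr_pos[OF that p, of "\<lambda>t. (B t, C t)"]
      by (simp add: marg_eq_pr log_mult log_divide algebra_simps)
  qed simp
  then show ?thesis
    unfolding cond_mutual_info_def ent_def by (simp add: sum.distrib sum_subtractf)
qed

lemma ent_const [simp]: "ent (\<lambda>_. c) = 0"
  unfolding ent_def by (simp add: pr_def total)

lemma mutual_info_ent:
  "mutual_info \<Omega> P A B = ent A + ent B - ent (\<lambda>t. (A t, B t))"
proof -
  have "ent (\<lambda>t. (A t, ())) = ent A" "ent (\<lambda>t. (B t, ())) = ent B"
    "ent (\<lambda>t. (A t, B t, ())) = ent (\<lambda>t. (A t, B t))"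
    by (rule ent_kernel; simp)+
  then show ?thesis unfolding mutual_info_def cond_mutual_info_ent by simp
qed

text \<open>\<open>F\<close> plays the density of a subprobability with respect to the true law; the
  bound is ln t \<le> t - 1, averaged.\<close>

lemma gibbs:
  assumes pos: "\<And>\<omega>. \<omega> \<in> \<Omega> \<Longrightarrow> 0 < P \<omega> \<Longrightarrow> 0 < F \<omega>"
    and le: "(\<Sum>\<omega>\<in>\<Omega>. P \<omega> * F \<omega>) \<le> 1"
  shows "(\<Sum>\<omega>\<in>\<Omega>. P \<omega> * log 2 (F \<omega>)) \<le> 0"
proof -
  have "P \<omega> * log 2 (F \<omega>) \<le> (P \<omega> * F \<omega> - P \<omega>) / ln 2" if "\<omega> \<in> \<Omega>" for \<omega>
  proof (cases "P \<omega> = 0")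
    case False
    then have p: "0 < P \<omega>" using nonneg[OF that] by auto
    have "ln (F \<omega>) \<le> F \<omega> - 1" using pos[OF that p] by (rule ln_le_minus_one)
    then have "P \<omega> * ln (F \<omega>) \<le> P \<omega> * (F \<omega> - 1)" using p by simp
    then have "P \<omega> * ln (F \<omega>) / ln 2 \<le> (P \<omega> * (F \<omega> - 1)) / ln 2"
      by (rule divide_right_mono) simp
    then show ?thesis by (simp add: log_def algebra_simps)
  qed simp
  then have "(\<Sum>\<omega>\<in>\<Omega>. P \<omega> * log 2 (F \<omega>)) \<le> (\<Sum>\<omega>\<in>\<Omega>. (P \<omega> * F \<omega> - P \<omega>) / ln 2)"
    by (rule sum_mono)
  also have "\<dots> = ((\<Sum>\<omega>\<in>\<Omega>. P \<omega> * F \<omega>) - 1) / ln 2"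
    by (simp add: sum_subtractf total flip: sum_divide_distrib)
  also have "\<dots> \<le> 0" using le by (simp add: divide_nonpos_pos)
  finally show ?thesis .
qed

text \<open>Nonnegativity of I(A;B|C): Gibbs' inequality compares the true law with p(a,c) p(b,c) /
  p(c), which makes A and B conditionally independent.\<close>

lemma ent_submodular:
  "ent (\<lambda>t. (A t, B t, C t)) + ent C \<le> ent (\<lambda>t. (A t, C t)) + ent (\<lambda>t. (B t, C t))"
proof -
  define a where "a = pr (\<lambda>t. (A t, C t))"
  define b where "b = pr (\<lambda>t. (B t, C t))"
  define d where "d = pr (\<lambda>t. (A t, B t, C t))"
  define F where "F t = (case t of (x, y, z) \<Rightarrow> a (x, z) * b (y, z) / (d t * pr C z))" for t
  let ?F = "\<lambda>\<omega>. F (A \<omega>, B \<omega>, C \<omega>)"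
  have nn [simp]: "0 \<le> a t" "0 \<le> b u" "0 \<le> d v" for t u v by (auto simp: a_def b_def d_def)
  have ps: "0 < a (A \<omega>, C \<omega>)" "0 < b (B \<omega>, C \<omega>)" "0 < d (A \<omega>, B \<omega>, C \<omega>)" "0 < pr C (C \<omega>)"
    if "\<omega> \<in> \<Omega>" "0 < P \<omega>" for \<omega>
    using pr_pos[OF that, of "\<lambda>t. (A t, C t)"] pr_pos[OF that, of "\<lambda>t. (B t, C t)"]
      pr_pos[OF that, of "\<lambda>t. (A t, B t, C t)"] pr_pos[OF that, of C] by (auto simp: a_def b_def d_def)
  have "(\<Sum>\<omega>\<in>\<Omega>. P \<omega> * ?F \<omega>) = (\<Sum>t\<in>A`\<Omega> \<times> B`\<Omega> \<times> C`\<Omega>. d t * F t)"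
    unfolding d_def by (rule expectation) (use fin in auto)
  \<comment> \<open>Only an inequality: cells with \<open>d\<close> equal to zero vanish on the left
    but may carry mass under the comparison law.\<close>
  also have "\<dots> \<le> (\<Sum>(x, y, z)\<in>A`\<Omega> \<times> B`\<Omega> \<times> C`\<Omega>. a (x, z) * b (y, z) / pr C z)"
    by (rule sum_mono) (auto simp: F_def)
  also have "\<dots> = (\<Sum>x\<in>A`\<Omega>. \<Sum>y\<in>B`\<Omega>. \<Sum>z\<in>C`\<Omega>. a (x, z) * b (y, z) / pr C z)"
    by (simp add: sum.cartesian_product)
  also have "\<dots> = (\<Sum>z\<in>C`\<Omega>. \<Sum>x\<in>A`\<Omega>. \<Sum>y\<in>B`\<Omega>. a (x, z) * b (y, z) / pr C z)"
  proof -
    have "(\<Sum>x\<in>A`\<Omega>. \<Sum>y\<in>B`\<Omega>. \<Sum>z\<in>C`\<Omega>. a (x, z) * b (y, z) / pr C z)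
        = (\<Sum>x\<in>A`\<Omega>. \<Sum>z\<in>C`\<Omega>. \<Sum>y\<in>B`\<Omega>. a (x, z) * b (y, z) / pr C z)"
      by (rule sum.cong[OF refl], rule sum.swap)
    then show ?thesis by (rule trans[OF _ sum.swap])
  qed
  also have "\<dots> = (\<Sum>z\<in>C`\<Omega>. (\<Sum>x\<in>A`\<Omega>. a (x, z)) * (\<Sum>y\<in>B`\<Omega>. b (y, z)) / pr C z)"
    by (simp add: sum_product sum_divide_distrib)
  also have "\<dots> = (\<Sum>z\<in>C`\<Omega>. pr C z)"
    unfolding a_def b_def using fin by (simp add: pr_marginal)
  also have "\<dots> = 1" using fin by (simp add: sum_pr)
  finally have "(\<Sum>\<omega>\<in>\<Omega>. P \<omega> * ?F \<omega>) \<le> 1" .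
  then have "(\<Sum>\<omega>\<in>\<Omega>. P \<omega> * log 2 (?F \<omega>)) \<le> 0"
    by (intro gibbs) (auto simp: F_def intro!: divide_pos_pos mult_pos_pos ps)
  moreover have "P \<omega> * log 2 (?F \<omega>) = P \<omega> * log 2 (a (A \<omega>, C \<omega>)) + P \<omega> * log 2 (b (B \<omega>, C \<omega>))
      - P \<omega> * log 2 (d (A \<omega>, B \<omega>, C \<omega>)) - P \<omega> * log 2 (pr C (C \<omega>))" if "\<omega> \<in> \<Omega>" for \<omega>
  proof (cases "P \<omega> = 0")
    case False
    then have p: "0 < P \<omega>" using nonneg[OF that] by auto
    show ?thesis
      using ps[OF that p] by (simp add: F_def log_mult log_divide algebra_simps)
  qed simp
  ultimately show ?thesis
    unfolding ent_def a_def b_def d_def by (simp add: sum.distrib sum_subtractf)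
qed

lemma ent_subadditive: "ent (\<lambda>t. (A t, B t)) \<le> ent A + ent B"
proof -
  have "ent (\<lambda>t. (A t, ())) = ent A" "ent (\<lambda>t. (B t, ())) = ent B"
    "ent (\<lambda>t. (A t, B t, ())) = ent (\<lambda>t. (A t, B t))"
    by (rule ent_kernel; simp)+
  then show ?thesis using ent_submodular[of A B "\<lambda>_. ()"] by simp
qed

text \<open>Compare the law of \<open>M\<close> given \<open>Y\<close> with the kernel that puts mass \<open>1/2\<close> on the decoded value
  and spreads \<open>1/2\<close> uniformly.\<close>

lemma fano:
  fixes M :: "'o \<Rightarrow> 'm" and Y :: "'o \<Rightarrow> 'b" and d :: "'b \<Rightarrow> 'm"
  assumes S: "finite S" "M ` \<Omega> \<subseteq> S"
  shows "ent (\<lambda>t. (M t, Y t)) - ent Y \<le> 1 + (\<Sum>\<omega>\<in>{\<omega>\<in>\<Omega>. d (Y \<omega>) \<noteq> M \<omega>}. P \<omega>) * log 2 (card S)"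
proof -
  have "\<Omega> \<noteq> {}" using total by auto
  then have cS: "0 < card S" using S by (auto simp: card_gt_0_iff)
  define r where "r m y = (if m = d y then 1/2 else 1 / (2 * real (card S)))" for m y
  have rpos: "0 < r m y" for m y using cS by (auto simp: r_def)
  define F where "F t = (case t of (m, y) \<Rightarrow> r m y * pr Y y / pr (\<lambda>t. (M t, Y t)) t)" for t
  let ?F = "\<lambda>\<omega>. F (M \<omega>, Y \<omega>)"
  have r1: "(\<Sum>m\<in>S. r m y) \<le> 1" for y
  proof -
    have "(\<Sum>m\<in>S. r m y) \<le> (\<Sum>m\<in>S. (if m = d y then 1/2 else 0) + 1 / (2 * real (card S)))"
      by (rule sum_mono) (auto simp: r_def)
    also have "\<dots> \<le> 1" using S cS by (simp add: sum.distrib sum.delta')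
    finally show ?thesis .
  qed
  have "(\<Sum>\<omega>\<in>\<Omega>. P \<omega> * ?F \<omega>) = (\<Sum>t\<in>S \<times> Y`\<Omega>. pr (\<lambda>t. (M t, Y t)) t * F t)"
    by (rule expectation) (use fin S in auto)
  also have "\<dots> \<le> (\<Sum>(m, y)\<in>S \<times> Y`\<Omega>. r m y * pr Y y)"
    by (rule sum_mono) (auto simp: F_def intro!: mult_nonneg_nonneg less_imp_le[OF rpos])
  also have "\<dots> = (\<Sum>y\<in>Y`\<Omega>. (\<Sum>m\<in>S. r m y) * pr Y y)"
    by (simp add: sum_distrib_right sum.swap[of _ S] flip: sum.cartesian_product)
  also have "\<dots> \<le> (\<Sum>y\<in>Y`\<Omega>. 1 * pr Y y)"
    by (intro sum_mono mult_right_mono r1) auto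
  also have "\<dots> = 1" using fin by (simp add: sum_pr)
  finally have "(\<Sum>\<omega>\<in>\<Omega>. P \<omega> * ?F \<omega>) \<le> 1" .
  moreover have ps: "0 < pr Y (Y \<omega>)" "0 < pr (\<lambda>t. (M t, Y t)) (M \<omega>, Y \<omega>)"
    if "\<omega> \<in> \<Omega>" "0 < P \<omega>" for \<omega>
    using pr_pos[OF that, of "\<lambda>t. (M t, Y t)"] pr_pos[OF that, of Y] by auto
  ultimately have "(\<Sum>\<omega>\<in>\<Omega>. P \<omega> * log 2 (?F \<omega>)) \<le> 0"
    by (intro gibbs) (auto simp: F_def intro!: divide_pos_pos mult_pos_pos ps rpos)
  moreover have "P \<omega> * log 2 (?F \<omega>) = P \<omega> * log 2 (r (M \<omega>) (Y \<omega>)) + P \<omega> * log 2 (pr Y (Y \<omega>))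
      - P \<omega> * log 2 (pr (\<lambda>t. (M t, Y t)) (M \<omega>, Y \<omega>))" if "\<omega> \<in> \<Omega>" for \<omega>
  proof (cases "P \<omega> = 0")
    case False
    then have p: "0 < P \<omega>" using nonneg[OF that] by auto
    show ?thesis
      using ps[OF that p] rpos[of "M \<omega>" "Y \<omega>"] by (simp add: F_def log_mult log_divide algebra_simps)
  qed simp
  ultimately have "ent (\<lambda>t. (M t, Y t)) - ent Y \<le> - (\<Sum>\<omega>\<in>\<Omega>. P \<omega> * log 2 (r (M \<omega>) (Y \<omega>)))"
    unfolding ent_def by (simp add: sum.distrib sum_subtractf)
  also have "\<dots> \<le> (\<Sum>\<omega>\<in>\<Omega>. P \<omega> + (if d (Y \<omega>) \<noteq> M \<omega> then P \<omega> else 0) * log 2 (card S))"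
    unfolding sum_negf[symmetric]
  proof (rule sum_mono)
    fix \<omega> assume "\<omega> \<in> \<Omega>"
    \<comment> \<open>A correct decoding costs exactly one bit under \<open>r\<close>, a wrong one
      costs one bit more than the logarithm of the size of \<open>S\<close>.\<close>
    have "log 2 (2 * real (card S)) = 1 + log 2 (card S)" using cS by (simp add: log_mult)
    then show "- (P \<omega> * log 2 (r (M \<omega>) (Y \<omega>))) \<le> P \<omega> + (if d (Y \<omega>) \<noteq> M \<omega> then P \<omega> else 0) * log 2 (card S)"
      using cS by (auto simp: r_def log_divide algebra_simps)
  qed
  also have "\<dots> = 1 + (\<Sum>\<omega>\<in>{\<omega>\<in>\<Omega>. d (Y \<omega>) \<noteq> M \<omega>}. P \<omega>) * log 2 (card S)"
    using fin by (simp add: sum.distrib total sum.inter_filter flip: sum_distrib_right)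
  finally show ?thesis .
qed

section \<open>Entropy behind a channel and conditional laws\<close>

lemma cond_ent_channel:
  fixes X :: "'o \<Rightarrow> 'x::finite" and Y :: "'o \<Rightarrow> 'y::finite" and q :: "'a \<Rightarrow> real^'x"
  assumes joint: "\<And>a x y. a \<in> A ` \<Omega> \<Longrightarrow>
      pr (\<lambda>\<omega>. (A \<omega>, X \<omega>, Y \<omega>)) (a, x, y) = pr (\<lambda>\<omega>. (A \<omega>, X \<omega>)) (a, x) * K x y"
    and q: "\<And>a x. a \<in> A ` \<Omega> \<Longrightarrow> pr (\<lambda>\<omega>. (A \<omega>, X \<omega>)) (a, x) = pr A a * q a $ x"
  shows "ent (\<lambda>\<omega>. (A \<omega>, Y \<omega>)) - ent A = (\<Sum>\<omega>\<in>\<Omega>. P \<omega> * hout K (q (A \<omega>)))"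
proof -
  define r where "r a y = (\<Sum>x\<in>UNIV. q a $ x * K x y)" for a y
  have prAY: "pr (\<lambda>\<omega>. (A \<omega>, Y \<omega>)) (a, y) = pr A a * r a y" if a: "a \<in> A ` \<Omega>" for a y
  proof -
    have "pr (\<lambda>\<omega>. (A \<omega>, Y \<omega>)) (a, y) = (\<Sum>x\<in>UNIV. pr (\<lambda>\<omega>. (X \<omega>, A \<omega>, Y \<omega>)) (x, a, y))"
      by (rule pr_marginal[symmetric]) auto
    also have "\<dots> = (\<Sum>x\<in>UNIV. pr (\<lambda>\<omega>. (A \<omega>, X \<omega>, Y \<omega>)) (a, x, y))"
      by (intro sum.cong refl pr_inj) auto
    also have "\<dots> = pr A a * r a y"
      unfolding r_def sum_distrib_left by (intro sum.cong refl) (simp add: joint[OF a] q[OF a])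
    finally show ?thesis .
  qed
  \<comment> \<open>\<open>eta_mult\<close> wants a nonnegative \<open>r a y\<close>. Where
    \<open>pr A a\<close> is positive this follows from \<open>prAY\<close>; elsewhere
    \<open>q a\<close> is arbitrary, but both sides vanish.\<close>
  have eq: "eta (pr A a * r a y) = pr A a * eta (r a y) + r a y * eta (pr A a)" if a: "a \<in> A ` \<Omega>" for a y
  proof (cases "pr A a = 0")
    case False
    then have "0 < pr A a" by (simp add: order_less_le)
    moreover have "0 \<le> pr A a * r a y" unfolding prAY[OF a, symmetric] by simp
    ultimately have "0 \<le> r a y" by (simp add: zero_le_mult_iff)
    then show ?thesis by (simp add: eta_mult)
  qed simp
  have rs: "pr A a * (\<Sum>y\<in>UNIV. r a y) = pr A a" if a: "a \<in> A ` \<Omega>" for a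
    unfolding sum_distrib_left prAY[OF a, symmetric] by (rule pr_marginal2) auto
  have rs': "(\<Sum>y\<in>UNIV. r a y) * eta (pr A a) = eta (pr A a)" if a: "a \<in> A ` \<Omega>" for a
    using rs[OF a] by (cases "pr A a = 0") auto
  have "ent (\<lambda>\<omega>. (A \<omega>, Y \<omega>)) = (\<Sum>(a, y)\<in>A ` \<Omega> \<times> UNIV. eta (pr (\<lambda>\<omega>. (A \<omega>, Y \<omega>)) (a, y)))"
    by (subst ent_eta[of "A ` \<Omega> \<times> UNIV"]) (use fin in auto)
  also have "\<dots> = (\<Sum>a\<in>A ` \<Omega>. \<Sum>y\<in>UNIV. eta (pr A a * r a y))"
    unfolding sum.cartesian_product[symmetric] by (intro sum.cong refl) (simp add: prAY)
  also have "\<dots> = (\<Sum>a\<in>A ` \<Omega>. pr A a * hout K (q a) + eta (pr A a))"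
    by (intro sum.cong refl)
      (simp add: eq sum.distrib hout_def rs' flip: sum_distrib_left sum_distrib_right r_def)
  also have "\<dots> = (\<Sum>\<omega>\<in>\<Omega>. P \<omega> * hout K (q (A \<omega>))) + ent A"
    using fin by (simp add: sum.distrib ent_eta[of "A ` \<Omega>"]
        expectation[of "A ` \<Omega>" A "\<lambda>a. hout K (q a)"])
  finally show ?thesis by simp
qed

text \<open>Conditional expectation with vector values, so that laws of X and tuples of entropies
  can be conditioned at once. On values of probability zero it is the zero vector.\<close>

definition cexp :: "('o \<Rightarrow> 'a) \<Rightarrow> ('o \<Rightarrow> 'v::real_vector) \<Rightarrow> 'a \<Rightarrow> 'v" where
  "cexp A F a = (\<Sum>\<omega>\<in>{\<omega>\<in>\<Omega>. A \<omega> = a}. (P \<omega> / pr A a) *\<^sub>R F \<omega>)"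

lemma pr_scaleR_cexp: "pr A a *\<^sub>R cexp A F a = (\<Sum>\<omega>\<in>{\<omega>\<in>\<Omega>. A \<omega> = a}. P \<omega> *\<^sub>R F \<omega>)"
proof (cases "pr A a = 0")
  case True
  have "P \<omega> = 0" if "\<omega> \<in> \<Omega>" "A \<omega> = a" for \<omega>
    using pr_ge[OF that(1), of A] nonneg[OF that(1)] True that by simp
  then show ?thesis using True by simp
next
  case False
  then show ?thesis by (simp add: cexp_def scaleR_right.sum)
qed

lemma expectation_cexp: "(\<Sum>\<omega>\<in>\<Omega>. P \<omega> *\<^sub>R cexp A F (A \<omega>)) = (\<Sum>\<omega>\<in>\<Omega>. P \<omega> *\<^sub>R F \<omega>)"
proof -
  have "(\<Sum>\<omega>\<in>\<Omega>. P \<omega> *\<^sub>R cexp A F (A \<omega>)) = (\<Sum>a\<in>A ` \<Omega>. pr A a *\<^sub>R cexp A F a)"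
    by (rule expectation_scaleR) (use fin in auto)
  also have "\<dots> = (\<Sum>\<omega>\<in>\<Omega>. P \<omega> *\<^sub>R F \<omega>)"
    unfolding pr_scaleR_cexp by (rule sum.group) (use fin in auto)
  finally show ?thesis .
qed

text \<open>Conditioning on W is a plain expectation with a weight \<open>c\<close> that is a
  function of A; such a weight can be pulled into the inner conditional expectation.\<close>

lemma cexp_tower:
  fixes F :: "'o \<Rightarrow> 'v::real_vector"
  assumes W: "\<And>\<omega>. \<omega> \<in> \<Omega> \<Longrightarrow> W \<omega> = g (A \<omega>)"
  shows "cexp W (\<lambda>\<omega>. cexp A F (A \<omega>)) w = cexp W F w"
proof -
  define c where "c a = (if g a = w then 1 / pr W w else 0)" for a
  have C: "cexp W G w = (\<Sum>\<omega>\<in>\<Omega>. P \<omega> *\<^sub>R (c (A \<omega>) *\<^sub>R G \<omega>))" for G :: "'o \<Rightarrow> 'v"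
  proof -
    have "cexp W G w = (\<Sum>\<omega>\<in>\<Omega>. if W \<omega> = w then (P \<omega> / pr W w) *\<^sub>R G \<omega> else 0)"
      unfolding cexp_def using fin by (simp add: sum.inter_filter)
    also have "\<dots> = (\<Sum>\<omega>\<in>\<Omega>. P \<omega> *\<^sub>R (c (A \<omega>) *\<^sub>R G \<omega>))"
      by (rule sum.cong) (auto simp: c_def W)
    finally show ?thesis .
  qed
  have D: "cexp A (\<lambda>\<omega>. c (A \<omega>) *\<^sub>R F \<omega>) a = c a *\<^sub>R cexp A F a" for a
    unfolding cexp_def scaleR_right.sum by (rule sum.cong) (auto simp: mult.commute)
  show ?thesis
    unfolding C D[symmetric] by (rule expectation_cexp)
qed

text \<open>A conditional mean is a convex combination over the fibre. With a singleton as convex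
  set this also evaluates conditional means of variables constant on the fibre.\<close>

lemma cexp_in_convex:
  assumes "convex C" "pr A a \<noteq> 0" "\<And>\<omega>. \<omega> \<in> \<Omega> \<Longrightarrow> 0 < P \<omega> \<Longrightarrow> A \<omega> = a \<Longrightarrow> F \<omega> \<in> C"
  shows "cexp A F a \<in> C"
  unfolding cexp_def
proof (rule convex_sum_pos)
  have p: "0 < pr A a" using assms(2) by (simp add: order_less_le)
  show "(\<Sum>\<omega>\<in>{\<omega> \<in> \<Omega>. A \<omega> = a}. P \<omega> / pr A a) = 1"
    using assms(2) by (simp add: pr_def flip: sum_divide_distrib)
  show "0 \<le> P \<omega> / pr A a" if "\<omega> \<in> {\<omega> \<in> \<Omega>. A \<omega> = a}" for \<omega>
    using that nonneg by simp
  show "F \<omega> \<in> C" if "\<omega> \<in> {\<omega> \<in> \<Omega>. A \<omega> = a}" "0 < P \<omega> / pr A a" for \<omega>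
    using that assms(3) p by (simp add: zero_less_divide_iff)
qed (use fin assms in auto)

text \<open>The conditional law of X given A, written as the conditional mean of the unit vector of
  X so that the tower property applies to it.\<close>

definition claw :: "('o \<Rightarrow> 'a) \<Rightarrow> ('o \<Rightarrow> 'x::finite) \<Rightarrow> 'a \<Rightarrow> real^'x" where
  "claw A X = cexp A (\<lambda>\<omega>. axis (X \<omega>) 1)"

lemma claw_nth: "pr (\<lambda>\<omega>. (A \<omega>, X \<omega>)) (a, x) = pr A a * claw A X a $ x"
proof -
  have "pr A a * claw A X a $ x = (pr A a *\<^sub>R claw A X a) $ x" by simp
  also have "\<dots> = (\<Sum>\<omega>\<in>{\<omega>\<in>\<Omega>. A \<omega> = a}. if X \<omega> = x then P \<omega> else 0)"
    unfolding claw_def pr_scaleR_cexp sum_component by (rule sum.cong) (auto simp: axis_def)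
  also have "\<dots> = (\<Sum>\<omega>\<in>{\<omega> \<in> {\<omega>\<in>\<Omega>. A \<omega> = a}. X \<omega> = x}. P \<omega>)"
    by (rule sum.inter_filter[symmetric]) (use fin in auto)
  also have "\<dots> = pr (\<lambda>\<omega>. (A \<omega>, X \<omega>)) (a, x)"
    unfolding pr_def by (rule sum.cong) auto
  finally show ?thesis by simp
qed

lemma claw_in_prob_simplex: "pr A a \<noteq> 0 \<Longrightarrow> claw A X a \<in> prob_simplex"
  unfolding claw_def by (rule cexp_in_convex[OF convex_prob_simplex]) (auto simp: axis_in_prob_simplex)

end

section \<open>The relaxed region\<close>

text \<open>At 0 the limit from the right is t log t \<rightarrow> 0; the real logarithm is extended
  evenly to negative arguments, so \<open>eta\<close> is odd and the left limit follows. Hence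
  \<open>hout\<close> is continuous on the whole vector space.\<close>

lemma isCont_eta: "isCont eta t"
proof (cases "t = 0")
  case False
  then show ?thesis
    unfolding eta_def log_def by (intro continuous_intros) auto
next
  case True
  have "((\<lambda>t::real. - (t * (ln t / ln 2))) \<longlongrightarrow> 0) (at_right 0)" by real_asymp
  then have r: "(eta \<longlongrightarrow> 0) (at_right 0)" by (simp add: eta_def[abs_def] log_def)
  have odd: "eta (- t) = - eta t" for t
    by (simp add: eta_def log_def ln_minus)
  have "((\<lambda>t. eta (- t)) \<longlongrightarrow> - 0) (at_right 0)"
    unfolding odd by (rule tendsto_minus[OF r])
  then have "(eta \<longlongrightarrow> 0) (at_left 0)"
    by (simp add: filterlim_at_left_to_right[of _ _ 0])
  with r have "(eta \<longlongrightarrow> 0) (at 0)" by (rule filterlim_split_at[rotated])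
  then show ?thesis using True by (simp add: isCont_def)
qed

lemma continuous_on_eta [continuous_intros]:
  "continuous_on S f \<Longrightarrow> continuous_on S (\<lambda>x. eta (f x))"
  by (rule continuous_on_compose2[of UNIV eta]) (auto simp: continuous_on_eq_continuous_at isCont_eta)

lemma continuous_on_hout [continuous_intros]:
  "continuous_on S f \<Longrightarrow> continuous_on S (\<lambda>x. hout K (f x))"
  unfolding hout_def by (intro continuous_intros)

lemma compact_prob_simplex: "compact (prob_simplex :: (real^'x::finite) set)"
proof -
  have "prob_simplex = (\<Inter>x. {q::real^'x. 0 \<le> q $ x}) \<inter> {q. (\<Sum>x\<in>UNIV. q $ x) = 1}"
    by (auto simp: prob_simplex_def)
  moreover have "closed \<dots>"
    by (intro closed_Int closed_INT ballI closed_Collect_le closed_Collect_eq continuous_intros)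
  ultimately have "closed (prob_simplex :: (real^'x) set)" by simp
  moreover have "prob_simplex \<subseteq> cbox 0 (1 :: real^'x)"
  proof
    fix q :: "real^'x" assume "q \<in> prob_simplex"
    then have q: "\<And>x. 0 \<le> q $ x" "(\<Sum>x\<in>UNIV. q $ x) = 1" by (auto simp: prob_simplex_def)
    have "q $ x \<le> 1" for x
      using member_le_sum[of x UNIV "\<lambda>x. q $ x"] q by auto
    then show "q \<in> cbox 0 1" using q by (auto simp: mem_box_cart)
  qed
  ultimately show ?thesis
    using compact_Int_closed[OF compact_cbox[of 0 "1::real^'x"]] by (metis inf.absorb_iff2 inf_commute)
qed

text \<open>A point (q, a, b) of the convex hull of this graph is a splitting of the law q by an
  auxiliary variable A, with a = H(Y|A) and b = H(Z|A).\<close>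

definition hgraph :: "('x::finite \<Rightarrow> 'y::finite \<Rightarrow> real) \<Rightarrow> ('x \<Rightarrow> 'z::finite \<Rightarrow> real) \<Rightarrow>
    ((real^'x) \<times> real \<times> real) set" where
  "hgraph K L = (\<lambda>q. (q, hout K q, hout L q)) ` prob_simplex"

text \<open>The data of a single value of W: the law q of X given that value, its output entropies,
  and two splittings of the same q, one by U and one by V. Taking the hull averages over W.\<close>

definition split_points :: "('x::finite \<Rightarrow> 'y::finite \<Rightarrow> real) \<Rightarrow> ('x \<Rightarrow> 'z::finite \<Rightarrow> real) \<Rightarrow>
    ((real^'x) \<times> real \<times> real \<times> (real \<times> real) \<times> (real \<times> real)) set" where
  "split_points K L = {(q, hout K q, hout L q, s, t) |q s t.
     (q, s) \<in> convex hull hgraph K L \<and> (q, t) \<in> convex hull hgraph K L}"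

text \<open>In a point \<open>(q, hy, hz, (a, b), (c, d))\<close> the entries stand for the law of \<open>X\<close> and for \<open>H(Y|W)\<close>,
  \<open>H(Z|W)\<close>, \<open>H(Y|U,W)\<close>, \<open>H(Z|U,W)\<close>, \<open>H(Y|V,W)\<close>, \<open>H(Z|V,W)\<close>.\<close>

definition relaxed_bounds ::
  "('x::finite \<Rightarrow> 'y::finite \<Rightarrow> real) \<Rightarrow> ('x \<Rightarrow> 'z::finite \<Rightarrow> real) \<Rightarrow>
   ((real^'x) \<times> real \<times> real \<times> (real \<times> real) \<times> (real \<times> real)) \<Rightarrow> real \<times> real \<times> real \<Rightarrow> bool" where
  "relaxed_bounds K L = (\<lambda>(q, hy, hz, (a, b), (c, d)) (R0, R1, R2).
     R0 \<le> hout K q - hy \<and> R0 \<le> hout L q - hz \<and>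
     R0 + R1 \<le> hout K q - a \<and> R0 + R2 \<le> hout L q - d \<and>
     R0 + R1 + R2 \<le> hout K q - a + b - (\<Sum>x\<in>UNIV. q $ x * hrow L x) \<and>
     R0 + R1 + R2 \<le> hout L q - d + c - (\<Sum>x\<in>UNIV. q $ x * hrow K x))"

definition relaxed_region ::
  "('x::finite \<Rightarrow> 'y::finite \<Rightarrow> real) \<Rightarrow> ('x \<Rightarrow> 'z::finite \<Rightarrow> real) \<Rightarrow> (real \<times> real \<times> real) set" where
  "relaxed_region K L = {R. \<exists>p. p \<in> convex hull split_points K L \<and> relaxed_bounds K L p R}"

lemma compact_hull_hgraph: "compact (convex hull hgraph K L)"
  unfolding hgraph_def
  by (intro compact_convex_hull compact_continuous_image continuous_intros compact_prob_simplex)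

text \<open>A continuous image of those pairs of hull points that agree in their first
  component.\<close>

lemma compact_split_points: "compact (split_points K L)"
proof -
  let ?C = "convex hull hgraph K L"
  have "split_points K L = (\<lambda>(s, t). (fst s, hout K (fst s), hout L (fst s), snd s, snd t)) `
      ((?C \<times> ?C) \<inter> {(s, t). fst s = fst t})"
    unfolding split_points_def by (force simp: image_iff)
  moreover have "compact ((?C \<times> ?C) \<inter> {(s, t). fst s = fst t})"
    by (intro compact_Int_closed compact_Times compact_hull_hgraph)
       (simp add: case_prod_unfold, intro closed_Collect_eq continuous_intros)
  ultimately show ?thesis
    by (simp add: case_prod_unfold, intro compact_continuous_image continuous_intros)
qed

text \<open>The bounds are weak inequalities between continuous functions of the point and the
  rates, and a closed relation projects to a closed set along a compact factor.\<close>

lemma closed_relaxed_region: "closed (relaxed_region K L)"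
proof -
  have "closed {(p, R). relaxed_bounds K L p R}"
    unfolding relaxed_bounds_def case_prod_unfold
    by (intro closed_Collect_conj closed_Collect_le continuous_intros)
  from closed_compact_projection[OF compact_convex_hull[OF compact_split_points[of K L]] this]
  show ?thesis by (simp add: relaxed_region_def)
qed

section \<open>One-time pads\<close>

lemma marg_transport:
  assumes bij: "bij_betw \<phi> \<Omega>1 \<Omega>" and P: "\<And>\<omega>. \<omega> \<in> \<Omega>1 \<Longrightarrow> P (\<phi> \<omega>) = P1 \<omega>"
    and f: "\<And>\<omega> \<omega>'. \<omega> \<in> \<Omega>1 \<Longrightarrow> \<omega>' \<in> \<Omega>1 \<Longrightarrow> f (\<phi> \<omega>) = f (\<phi> \<omega>') \<longleftrightarrow> f1 \<omega> = f1 \<omega>'"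
    and \<omega>: "\<omega> \<in> \<Omega>1"
  shows "marg \<Omega> P f (\<phi> \<omega>) = marg \<Omega>1 P1 f1 \<omega>"
proof -
  have inj: "inj_on \<phi> {\<omega>' \<in> \<Omega>1. f1 \<omega>' = f1 \<omega>}"
    using bij by (auto simp: bij_betw_def intro: inj_on_subset)
  have "{\<omega>' \<in> \<Omega>. f \<omega>' = f (\<phi> \<omega>)} = \<phi> ` {\<omega>' \<in> \<Omega>1. f1 \<omega>' = f1 \<omega>}"
    using bij f[OF _ \<omega>] by (auto simp: bij_betw_def)
  then have "marg \<Omega> P f (\<phi> \<omega>) = (\<Sum>\<omega>'\<in>{\<omega>' \<in> \<Omega>1. f1 \<omega>' = f1 \<omega>}. P (\<phi> \<omega>'))"
    by (simp add: marg_def sum.reindex[OF inj] o_def)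
  then show ?thesis by (simp add: marg_def P)
qed

text \<open>Mutual information depends on the variables only through the masses of the cells that
  they cut out, so it survives a bijective relabelling of the sample set.\<close>

lemma cond_mutual_info_transport:
  assumes bij: "bij_betw \<phi> \<Omega>1 \<Omega>" and P: "\<And>\<omega>. \<omega> \<in> \<Omega>1 \<Longrightarrow> P (\<phi> \<omega>) = P1 \<omega>"
    and A: "\<And>\<omega> \<omega>'. \<omega> \<in> \<Omega>1 \<Longrightarrow> \<omega>' \<in> \<Omega>1 \<Longrightarrow> A (\<phi> \<omega>) = A (\<phi> \<omega>') \<longleftrightarrow> A1 \<omega> = A1 \<omega>'"
    and B: "\<And>\<omega> \<omega>'. \<omega> \<in> \<Omega>1 \<Longrightarrow> \<omega>' \<in> \<Omega>1 \<Longrightarrow> B (\<phi> \<omega>) = B (\<phi> \<omega>') \<longleftrightarrow> B1 \<omega> = B1 \<omega>'"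
    and C: "\<And>\<omega> \<omega>'. \<omega> \<in> \<Omega>1 \<Longrightarrow> \<omega>' \<in> \<Omega>1 \<Longrightarrow> C (\<phi> \<omega>) = C (\<phi> \<omega>') \<longleftrightarrow> C1 \<omega> = C1 \<omega>'"
  shows "cond_mutual_info \<Omega> P A B C = cond_mutual_info \<Omega>1 P1 A1 B1 C1"
proof -
  have m: "marg \<Omega> P (\<lambda>t. (A t, B t, C t)) (\<phi> \<omega>) = marg \<Omega>1 P1 (\<lambda>t. (A1 t, B1 t, C1 t)) \<omega>"
    "marg \<Omega> P (\<lambda>t. (A t, C t)) (\<phi> \<omega>) = marg \<Omega>1 P1 (\<lambda>t. (A1 t, C1 t)) \<omega>"
    "marg \<Omega> P (\<lambda>t. (B t, C t)) (\<phi> \<omega>) = marg \<Omega>1 P1 (\<lambda>t. (B1 t, C1 t)) \<omega>"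
    "marg \<Omega> P C (\<phi> \<omega>) = marg \<Omega>1 P1 C1 \<omega>" if "\<omega> \<in> \<Omega>1" for \<omega>
    by (rule marg_transport[of \<phi> \<Omega>1 \<Omega> P P1, OF bij P _ that]; simp add: A B C)+
  show ?thesis unfolding cond_mutual_info_def
    by (rule sum.reindex_bij_betw[OF bij, symmetric, THEN trans]) (simp add: m P)
qed

lemma is_pmf_on_to_nat:
  fixes A :: "'a::countable set"
  assumes "is_pmf_on A p"
  shows "is_pmf_on (to_nat ` A) (\<lambda>n. p (from_nat n))"
  using assms by (auto simp: is_pmf_on_def sum.reindex inj_on_subset[OF inj_to_nat])

text \<open>\<open>outer_bound\<close> takes its auxiliary alphabets among the naturals and nests
  its tuples flatly. Here the alphabets may lie in any countable types, and the auxiliary triple is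
  grouped so that it can serve as one variable.\<close>

lemma outer_boundI:
  fixes Ch :: "'x::finite \<Rightarrow> 'y::finite \<Rightarrow> 'z::finite \<Rightarrow> real"
    and AU :: "'u::countable set" and AV :: "'v::countable set" and AW :: "'w::countable set"
    and pU :: "'u \<Rightarrow> real" and pV :: "'v \<Rightarrow> real" and pW :: "'u \<Rightarrow> 'v \<Rightarrow> 'w \<Rightarrow> real"
    and pX :: "'u \<Rightarrow> 'v \<Rightarrow> 'w \<Rightarrow> 'x \<Rightarrow> real"
  defines "\<Omega> \<equiv> (AU \<times> AV \<times> AW) \<times> (UNIV :: ('x \<times> 'y \<times> 'z) set)"
    and "P \<equiv> (\<lambda>((u, v, w), x, y, z). pU u * pV v * pW u v w * pX u v w x * Ch x y z)"
    and "U \<equiv> (\<lambda>\<omega>::('u \<times> 'v \<times> 'w) \<times> 'x \<times> 'y \<times> 'z. fst (fst \<omega>))"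
    and "V \<equiv> (\<lambda>\<omega>::('u \<times> 'v \<times> 'w) \<times> 'x \<times> 'y \<times> 'z. fst (snd (fst \<omega>)))"
    and "W \<equiv> (\<lambda>\<omega>::('u \<times> 'v \<times> 'w) \<times> 'x \<times> 'y \<times> 'z. snd (snd (fst \<omega>)))"
    and "Y \<equiv> (\<lambda>\<omega>::('u \<times> 'v \<times> 'w) \<times> 'x \<times> 'y \<times> 'z. fst (snd (snd \<omega>)))"
    and "Z \<equiv> (\<lambda>\<omega>::('u \<times> 'v \<times> 'w) \<times> 'x \<times> 'y \<times> 'z. snd (snd (snd \<omega>)))"
  assumes fin: "finite AU" "finite AV" "finite AW"
    and pmf: "is_pmf_on AU pU" "is_pmf_on AV pV" "\<And>u v. u \<in> AU \<Longrightarrow> v \<in> AV \<Longrightarrow> is_pmf_on AW (pW u v)"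
      "\<And>u v w. u \<in> AU \<Longrightarrow> v \<in> AV \<Longrightarrow> w \<in> AW \<Longrightarrow> is_pmf_on UNIV (pX u v w)"
    and R: "R0 \<le> mutual_info \<Omega> P W Y" "R0 \<le> mutual_info \<Omega> P W Z"
      "R0 + R1 \<le> mutual_info \<Omega> P (\<lambda>t. (U t, W t)) Y"
      "R0 + R2 \<le> mutual_info \<Omega> P (\<lambda>t. (V t, W t)) Z"
      "R0 + R1 + R2 \<le> mutual_info \<Omega> P (\<lambda>t. (U t, W t)) Y + cond_mutual_info \<Omega> P V Z (\<lambda>t. (U t, W t))"
      "R0 + R1 + R2 \<le> mutual_info \<Omega> P (\<lambda>t. (V t, W t)) Z + cond_mutual_info \<Omega> P U Y (\<lambda>t. (V t, W t))"
  shows "(R0, R1, R2) \<in> outer_bound Ch"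
proof -
  let ?\<Omega> = "to_nat ` AU \<times> to_nat ` AV \<times> to_nat ` AW \<times> (UNIV :: 'x set) \<times> (UNIV :: 'y set) \<times> (UNIV :: 'z set)"
  let ?pU = "\<lambda>u. pU (from_nat u)" and ?pV = "\<lambda>v. pV (from_nat v)"
  let ?pW = "\<lambda>u v w. pW (from_nat u) (from_nat v) (from_nat w)"
  let ?pX = "\<lambda>u v w. pX (from_nat u) (from_nat v) (from_nat w)"
  let ?P = "\<lambda>(u, v, w, x, y, z). ?pU u * ?pV v * ?pW u v w * ?pX u v w x * Ch x y z"
  let ?U = "\<lambda>(u, v, w, x, y, z). u" and ?V = "\<lambda>(u, v, w, x, y, z). v" and ?W = "\<lambda>(u, v, w, x, y, z). w"
  let ?Y = "\<lambda>(u, v, w, x, y, z). y" and ?Z = "\<lambda>(u, v, w, x, y, z). z"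
  define \<phi> :: "('u \<times> 'v \<times> 'w) \<times> 'x \<times> 'y \<times> 'z \<Rightarrow> nat \<times> nat \<times> nat \<times> 'x \<times> 'y \<times> 'z"
    where "\<phi> = (\<lambda>((u, v, w), x, y, z). (to_nat u, to_nat v, to_nat w, x, y, z))"
  have bij: "bij_betw \<phi> \<Omega> ?\<Omega>"
    unfolding bij_betw_def inj_on_def \<phi>_def \<Omega>_def by (auto simp: image_iff; force)
  have PP: "?P (\<phi> \<omega>) = P \<omega>" if "\<omega> \<in> \<Omega>" for \<omega>
    by (auto simp: \<phi>_def P_def split: prod.splits)
  note T = cond_mutual_info_transport[of \<phi> \<Omega> ?\<Omega> ?P P, OF bij PP]
  have mi: "mutual_info ?\<Omega> ?P ?W ?Y = mutual_info \<Omega> P W Y"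
    "mutual_info ?\<Omega> ?P ?W ?Z = mutual_info \<Omega> P W Z"
    "mutual_info ?\<Omega> ?P (\<lambda>t. (?U t, ?W t)) ?Y = mutual_info \<Omega> P (\<lambda>t. (U t, W t)) Y"
    "mutual_info ?\<Omega> ?P (\<lambda>t. (?V t, ?W t)) ?Z = mutual_info \<Omega> P (\<lambda>t. (V t, W t)) Z"
    "cond_mutual_info ?\<Omega> ?P ?V ?Z (\<lambda>t. (?U t, ?W t)) = cond_mutual_info \<Omega> P V Z (\<lambda>t. (U t, W t))"
    "cond_mutual_info ?\<Omega> ?P ?U ?Y (\<lambda>t. (?V t, ?W t)) = cond_mutual_info \<Omega> P U Y (\<lambda>t. (V t, W t))"
    unfolding mutual_info_def
    by (rule T; auto simp: \<phi>_def U_def V_def W_def Y_def Z_def split: prod.splits)+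
  have pm: "is_pmf_on (to_nat ` AU) ?pU" "is_pmf_on (to_nat ` AV) ?pV"
    "\<forall>u\<in>to_nat ` AU. \<forall>v\<in>to_nat ` AV. is_pmf_on (to_nat ` AW) (?pW u v)"
    "\<forall>u\<in>to_nat ` AU. \<forall>v\<in>to_nat ` AV. \<forall>w\<in>to_nat ` AW. is_pmf_on UNIV (?pX u v w)"
    using pmf by (auto intro: is_pmf_on_to_nat)
  show ?thesis
    unfolding outer_bound_def
    apply (rule CollectI)
    apply (simp only: prod.case Let_def)
    apply (rule exI[of _ "to_nat ` AU"], rule exI[of _ "to_nat ` AV"], rule exI[of _ "to_nat ` AW"])
    apply (rule exI[of _ ?pU], rule exI[of _ ?pV], rule exI[of _ ?pW], rule exI[of _ ?pX])
    apply (simp only: mi min.bounded_iff)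
    apply (intro conjI pm R finite_imageI fin)
    done
qed

section \<open>Channel marginals and finite splittings\<close>

definition chY :: "('x \<Rightarrow> 'y::finite \<Rightarrow> 'z::finite \<Rightarrow> real) \<Rightarrow> 'x \<Rightarrow> 'y \<Rightarrow> real" where
  "chY Ch x y = (\<Sum>z\<in>UNIV. Ch x y z)"

definition chZ :: "('x \<Rightarrow> 'y::finite \<Rightarrow> 'z::finite \<Rightarrow> real) \<Rightarrow> 'x \<Rightarrow> 'z \<Rightarrow> real" where
  "chZ Ch x z = (\<Sum>y\<in>UNIV. Ch x y z)"

definition decomposes :: "('x::finite \<Rightarrow> 'y::finite \<Rightarrow> real) \<Rightarrow> ('x \<Rightarrow> 'z::finite \<Rightarrow> real) \<Rightarrow> nat \<Rightarrow>
    (nat \<Rightarrow> real) \<Rightarrow> (nat \<Rightarrow> real^'x) \<Rightarrow> (real^'x) \<times> real \<times> real \<Rightarrow> bool" where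
  "decomposes K L N l Q s \<longleftrightarrow> (\<forall>i<N. 0 \<le> l i \<and> Q i \<in> prob_simplex) \<and> (\<Sum>i<N. l i) = 1 \<and>
      (\<Sum>i<N. l i *\<^sub>R (Q i, hout K (Q i), hout L (Q i))) = s"

text \<open>Padding with zero weights allows every sufficiently large number of pieces. One common
  number then serves all values of W and both splittings, so the pads can be taken modulo a single
  N.\<close>

lemma hull_hgraph_decomposes:
  assumes "s \<in> convex hull hgraph K L"
  shows "\<exists>N0. \<forall>N\<ge>N0. \<exists>l Q. decomposes K L N l Q s"
proof -
  obtain S u where S: "finite S" "S \<subseteq> hgraph K L" "\<forall>x\<in>S. 0 \<le> u x" "sum u S = 1" "(\<Sum>v\<in>S. u v *\<^sub>R v) = s"
    using assms unfolding convex_hull_explicit by blast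
  obtain h where h: "bij_betw h {..<card S} S"
    using ex_bij_betw_nat_finite[OF S(1)] by (auto simp: atLeast0LessThan)
  have "\<exists>l Q. decomposes K L N l Q s" if N: "card S \<le> N" for N
  proof -
    define l where "l i = (if i < card S then u (h i) else 0)" for i
    \<comment> \<open>The padded pieces carry weight zero; an arbitrary vertex keeps them in the
      simplex.\<close>
    define Q where "Q i = (if i < card S then fst (h i) else axis undefined 1)" for i
    have hS: "h i \<in> S" if "i < card S" for i using h that by (auto simp: bij_betw_def)
    have 1: "\<forall>i<N. 0 \<le> l i \<and> Q i \<in> prob_simplex"
      using hS S(2,3) by (force simp: l_def Q_def axis_in_prob_simplex hgraph_def)
    have "(\<Sum>i<N. l i) = (\<Sum>i<card S. u (h i))"
      using N by (intro sum.mono_neutral_cong_right) (auto simp: l_def)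
    also have "\<dots> = 1"
      using S(4) sum.reindex_bij_betw[OF h, of u] by simp
    finally have 2: "(\<Sum>i<N. l i) = 1" .
    have "(\<Sum>i<N. l i *\<^sub>R (Q i, hout K (Q i), hout L (Q i))) = (\<Sum>i<card S. u (h i) *\<^sub>R h i)"
    proof (intro sum.mono_neutral_cong_right)
      show "l i *\<^sub>R (Q i, hout K (Q i), hout L (Q i)) = u (h i) *\<^sub>R h i" if "i \<in> {..<card S}" for i
        using hS[of i] S(2) that by (force simp: l_def Q_def hgraph_def)
    qed (use N in \<open>auto simp: l_def zero_prod_def\<close>)
    also have "\<dots> = s"
      using S(5) sum.reindex_bij_betw[OF h, of "\<lambda>v. u v *\<^sub>R v"] by (rule trans[rotated])
    finally show ?thesis using 1 2 unfolding decomposes_def by blast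
  qed
  then show ?thesis by blast
qed

text \<open>Translation by a key permutes the residues; this is the mechanism of the one-time
  pad.\<close>

lemma sum_shift_mod:
  fixes F :: "nat \<Rightarrow> 'a::comm_monoid_add"
  shows "(\<Sum>a<N. F ((a + k) mod N)) = (\<Sum>a<N. F a)"
proof (cases "N = 0")
  case False
  have inj: "inj_on (\<lambda>a. (a + k) mod N) {..<N}"
  proof (rule inj_onI)
    fix a b assume ab: "a \<in> {..<N}" "b \<in> {..<N}" "(a + k) mod N = (b + k) mod N"
    then have "[a + k = b + k] (mod N)" by (simp add: cong_def)
    then have "[a = b] (mod N)" by (simp add: cong_add_rcancel_nat)
    then show "a = b" using ab by (simp add: cong_def)
  qed
  have "(\<lambda>a. (a + k) mod N) ` {..<N} = {..<N}"
    by (rule endo_inj_surj[OF _ _ inj]) (use False in auto)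
  with inj have "bij_betw (\<lambda>a. (a + k) mod N) {..<N} {..<N}" by (simp add: bij_betw_def)
  then show ?thesis by (rule sum.reindex_bij_betw)
qed simp

lemma dm_bcD:
  assumes "dm_bc Ch"
  shows "0 \<le> Ch x y z" "(\<Sum>y\<in>UNIV. \<Sum>z\<in>UNIV. Ch x y z) = 1"
  using assms unfolding dm_bc_def by auto

lemma sum_delta2:
  fixes F :: "'x::finite \<Rightarrow> 'y::finite \<Rightarrow> real"
  shows "(\<Sum>x'\<in>UNIV. \<Sum>y'\<in>UNIV. if x' = x \<and> y' = y then F x' y' else 0) = F x y"
proof -
  have "(\<Sum>x'\<in>UNIV. \<Sum>y'\<in>UNIV. if x' = x \<and> y' = y then F x' y' else 0)
      = (\<Sum>x'\<in>UNIV. if x' = x then F x' y else 0)"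
    by (intro sum.cong refl) auto
  then show ?thesis by simp
qed

section \<open>Output entropies under a given law of the auxiliary variables and input\<close>

locale bc_model =
  fixes T :: "'t set" and \<theta> :: "'t \<Rightarrow> real" and \<xi> :: "'t \<Rightarrow> 'x::finite \<Rightarrow> real"
    and Ch :: "'x \<Rightarrow> 'y::finite \<Rightarrow> 'z::finite \<Rightarrow> real"
  assumes finT: "finite T" and \<theta>: "is_pmf_on T \<theta>" and \<xi>: "\<And>t. t \<in> T \<Longrightarrow> is_pmf_on UNIV (\<xi> t)"
    and Ch: "dm_bc Ch"
begin

lemma sum_model:
  fixes F :: "'t \<times> 'x \<times> 'y \<times> 'z \<Rightarrow> real"
  shows "sum F (T \<times> UNIV) = (\<Sum>t\<in>T. \<Sum>x\<in>UNIV. \<Sum>y\<in>UNIV. \<Sum>z\<in>UNIV. F (t, x, y, z))"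
  by (simp add: sum.cartesian_product case_prod_unfold)

sublocale fin_pmf "T \<times> UNIV" "\<lambda>(t, x, y, z). \<theta> t * \<xi> t x * Ch x y z"
proof
  show "finite (T \<times> (UNIV :: ('x \<times> 'y \<times> 'z) set))" using finT by simp
  show "0 \<le> (case \<omega> of (t, x, y, z) \<Rightarrow> \<theta> t * \<xi> t x * Ch x y z)" if "\<omega> \<in> T \<times> UNIV" for \<omega>
    using that \<theta> \<xi> dm_bcD(1)[OF Ch] by (auto simp: is_pmf_on_def)
  have "(\<Sum>x\<in>UNIV. \<Sum>y\<in>UNIV. \<Sum>z\<in>UNIV. \<theta> t * \<xi> t x * Ch x y z) = \<theta> t" if "t \<in> T" for t
    using \<xi>[OF that] dm_bcD(2)[OF Ch] by (simp add: is_pmf_on_def flip: sum_distrib_left)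
  then show "(\<Sum>(t, x, y, z)\<in>T \<times> UNIV. \<theta> t * \<xi> t x * Ch x y z) = 1"
    unfolding sum_model using \<theta> by (simp add: is_pmf_on_def)
qed

lemma pr_input:
  "pr (\<lambda>\<omega>. (g (fst \<omega>), fst (snd \<omega>))) (a, x) = (\<Sum>t\<in>{t\<in>T. g t = a}. \<theta> t * \<xi> t x)"
proof -
  have "(\<Sum>x'\<in>UNIV. \<Sum>y\<in>UNIV. \<Sum>z\<in>UNIV. if g t = a \<and> x' = x then \<theta> t * \<xi> t x' * Ch x' y z else 0)
      = (if g t = a then \<theta> t * \<xi> t x else 0)" for t
  proof -
    have "(\<Sum>x'\<in>UNIV. \<Sum>y\<in>UNIV. \<Sum>z\<in>UNIV. if g t = a \<and> x' = x then \<theta> t * \<xi> t x' * Ch x' y z else 0)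
      = (\<Sum>x'\<in>UNIV. if x' = x then (if g t = a then \<theta> t * \<xi> t x' else 0) else 0)"
      using dm_bcD(2)[OF Ch] by (intro sum.cong refl) (auto simp flip: sum_distrib_left)
    then show ?thesis by simp
  qed
  then show ?thesis unfolding pr_if sum_model prod.case using finT by (simp add: sum.inter_filter)
qed

lemma pr_inputY:
  "pr (\<lambda>\<omega>. (g (fst \<omega>), fst (snd \<omega>), fst (snd (snd \<omega>)))) (a, x, y)
    = (\<Sum>t\<in>{t\<in>T. g t = a}. \<theta> t * \<xi> t x) * chY Ch x y"
proof -
  have "(\<Sum>x'\<in>UNIV. \<Sum>y'\<in>UNIV. \<Sum>z\<in>UNIV. if g t = a \<and> x' = x \<and> y' = y then \<theta> t * \<xi> t x' * Ch x' y' z else 0)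
      = (if g t = a then \<theta> t * \<xi> t x else 0) * chY Ch x y" for t
  proof -
    have "(\<Sum>x'\<in>UNIV. \<Sum>y'\<in>UNIV. \<Sum>z\<in>UNIV. if g t = a \<and> x' = x \<and> y' = y then \<theta> t * \<xi> t x' * Ch x' y' z else 0)
      = (\<Sum>x'\<in>UNIV. \<Sum>y'\<in>UNIV. if x' = x \<and> y' = y then (if g t = a then \<theta> t * \<xi> t x' * chY Ch x' y' else 0) else 0)"
      by (intro sum.cong refl) (auto simp: chY_def sum_distrib_left)
    then show ?thesis by (simp add: sum_delta2)
  qed
  then show ?thesis unfolding pr_if sum_model prod.case using finT by (simp add: sum.inter_filter sum_distrib_right)
qed

lemma pr_inputZ:
  "pr (\<lambda>\<omega>. (g (fst \<omega>), fst (snd \<omega>), snd (snd (snd \<omega>)))) (a, x, z)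
    = (\<Sum>t\<in>{t\<in>T. g t = a}. \<theta> t * \<xi> t x) * chZ Ch x z"
proof -
  have "(\<Sum>x'\<in>UNIV. \<Sum>y\<in>UNIV. \<Sum>z'\<in>UNIV. if g t = a \<and> x' = x \<and> z' = z then \<theta> t * \<xi> t x' * Ch x' y z' else 0)
      = (if g t = a then \<theta> t * \<xi> t x else 0) * chZ Ch x z" for t
  proof -
    have "(\<Sum>x'\<in>UNIV. \<Sum>y\<in>UNIV. \<Sum>z'\<in>UNIV. if g t = a \<and> x' = x \<and> z' = z then \<theta> t * \<xi> t x' * Ch x' y z' else 0)
      = (\<Sum>x'\<in>UNIV. \<Sum>z'\<in>UNIV. \<Sum>y\<in>UNIV. if g t = a \<and> x' = x \<and> z' = z then \<theta> t * \<xi> t x' * Ch x' y z' else 0)"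
      by (rule sum.cong[OF refl], rule sum.swap)
    also have "\<dots> = (\<Sum>x'\<in>UNIV. \<Sum>z'\<in>UNIV. if x' = x \<and> z' = z then (if g t = a then \<theta> t * \<xi> t x' * chZ Ch x' z' else 0) else 0)"
      by (intro sum.cong refl) (auto simp: chZ_def sum_distrib_left)
    finally show ?thesis by (simp add: sum_delta2)
  qed
  then show ?thesis unfolding pr_if sum_model prod.case using finT by (simp add: sum.inter_filter sum_distrib_right)
qed

lemma expectation_model:
  "(\<Sum>\<omega>\<in>T \<times> (UNIV :: ('x \<times> 'y \<times> 'z) set). (case \<omega> of (t, x, y, z) \<Rightarrow> \<theta> t * \<xi> t x * Ch x y z) * F (fst \<omega>))
    = (\<Sum>t\<in>T. \<theta> t * F t)"
proof -
  have "(\<Sum>x\<in>UNIV. \<Sum>y\<in>UNIV. \<Sum>z\<in>UNIV. \<theta> t * \<xi> t x * Ch x y z * F t) = \<theta> t * F t" if "t \<in> T" for t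
    using \<xi>[OF that] dm_bcD(2)[OF Ch]
    by (simp add: is_pmf_on_def flip: sum_distrib_left sum_distrib_right)
  then show ?thesis unfolding sum_model by simp
qed

text \<open>It suffices to factor the joint mass on a fibre of \<open>g\<close> into a scalar and a
  probability vector: summing over x identifies the scalar \<open>\<kappa> a\<close> as the
  probability of the fibre, hence \<open>q a\<close> acts as the conditional law of X.\<close>

lemma cond_ent_model:
  assumes J: "\<And>a x. a \<in> g ` T \<Longrightarrow> (\<Sum>t\<in>{t\<in>T. g t = a}. \<theta> t * \<xi> t x) = \<kappa> a * q a $ x"
    and q: "\<And>a. a \<in> g ` T \<Longrightarrow> q a \<in> prob_simplex"
  shows "ent (\<lambda>\<omega>. (g (fst \<omega>), fst (snd (snd \<omega>)))) - ent (\<lambda>\<omega>. g (fst \<omega>))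
          = (\<Sum>t\<in>T. \<theta> t * hout (chY Ch) (q (g t)))"
    and "ent (\<lambda>\<omega>. (g (fst \<omega>), snd (snd (snd \<omega>)))) - ent (\<lambda>\<omega>. g (fst \<omega>))
          = (\<Sum>t\<in>T. \<theta> t * hout (chZ Ch) (q (g t)))"
proof -
  let ?A = "\<lambda>\<omega>::'t \<times> 'x \<times> 'y \<times> 'z. g (fst \<omega>)"
  let ?X = "\<lambda>\<omega>::'t \<times> 'x \<times> 'y \<times> 'z. fst (snd \<omega>)"
  have im: "a \<in> ?A ` (T \<times> UNIV) \<Longrightarrow> a \<in> g ` T" for a by auto
  have Q: "pr (\<lambda>\<omega>. (?A \<omega>, ?X \<omega>)) (a, x) = pr ?A a * q a $ x" if "a \<in> ?A ` (T \<times> UNIV)" for a x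
  proof -
    note a = im[OF that]
    have "pr ?A a = (\<Sum>x\<in>UNIV. pr (\<lambda>\<omega>. (?A \<omega>, ?X \<omega>)) (a, x))"
      by (rule pr_marginal2[symmetric]) auto
    also have "\<dots> = \<kappa> a"
      using q[OF a] by (simp add: pr_input J[OF a] prob_simplex_def flip: sum_distrib_left)
    finally show ?thesis by (simp add: pr_input J[OF a])
  qed
  show "ent (\<lambda>\<omega>. (?A \<omega>, fst (snd (snd \<omega>)))) - ent ?A = (\<Sum>t\<in>T. \<theta> t * hout (chY Ch) (q (g t)))"
    by (subst cond_ent_channel[where X = ?X and q = q and K = "chY Ch"])
       (simp_all add: pr_inputY pr_input[symmetric] Q expectation_model[of "\<lambda>t. hout (chY Ch) (q (g t))"])
  show "ent (\<lambda>\<omega>. (?A \<omega>, snd (snd (snd \<omega>)))) - ent ?A = (\<Sum>t\<in>T. \<theta> t * hout (chZ Ch) (q (g t)))"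
    by (subst cond_ent_channel[where X = ?X and q = q and K = "chZ Ch"])
       (simp_all add: pr_inputZ pr_input[symmetric] Q expectation_model[of "\<lambda>t. hout (chZ Ch) (q (g t))"])
qed

end

text \<open>Here \<open>\<mu>\<close>, \<open>\<alpha> w\<close>, \<open>\<beta> w\<close> are the laws of \<open>W\<close> and of \<open>U\<close>, \<open>V\<close> given \<open>W = w\<close>, while \<open>q w\<close>, \<open>Q w u\<close>,
  \<open>S w v\<close> are the laws of \<open>X\<close> given \<open>W\<close>, \<open>(W, U)\<close>, \<open>(W, V)\<close>.\<close>

locale masking =
  fixes Ch :: "'x::finite \<Rightarrow> 'y::finite \<Rightarrow> 'z::finite \<Rightarrow> real"
    and k N :: nat and \<mu> :: "nat \<Rightarrow> real" and q :: "nat \<Rightarrow> real^'x"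
    and \<alpha> \<beta> :: "nat \<Rightarrow> nat \<Rightarrow> real" and Q S :: "nat \<Rightarrow> nat \<Rightarrow> real^'x"
  assumes Ch: "dm_bc Ch" and N: "0 < N"
    and \<mu>: "\<And>w. w < k \<Longrightarrow> 0 \<le> \<mu> w" "(\<Sum>w<k. \<mu> w) = 1"
    and q: "\<And>w. w < k \<Longrightarrow> q w \<in> prob_simplex"
    and \<alpha>: "\<And>w u. w < k \<Longrightarrow> u < N \<Longrightarrow> 0 \<le> \<alpha> w u" "\<And>w. w < k \<Longrightarrow> (\<Sum>u<N. \<alpha> w u) = 1"
    and Q: "\<And>w u. w < k \<Longrightarrow> u < N \<Longrightarrow> Q w u \<in> prob_simplex"
      "\<And>w. w < k \<Longrightarrow> (\<Sum>u<N. \<alpha> w u *\<^sub>R Q w u) = q w"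
    and \<beta>: "\<And>w v. w < k \<Longrightarrow> v < N \<Longrightarrow> 0 \<le> \<beta> w v" "\<And>w. w < k \<Longrightarrow> (\<Sum>v<N. \<beta> w v) = 1"
    and S: "\<And>w v. w < k \<Longrightarrow> v < N \<Longrightarrow> S w v \<in> prob_simplex"
      "\<And>w. w < k \<Longrightarrow> (\<Sum>v<N. \<beta> w v *\<^sub>R S w v) = q w"
begin

text \<open>The coupling in which \<open>U\<close> and \<open>V\<close> are conditionally independent given \<open>(W, X)\<close>; if \<open>q w $ x = 0\<close>
  then the numerator vanishes as well.\<close>

definition p0 :: "nat \<Rightarrow> nat \<Rightarrow> nat \<Rightarrow> 'x \<Rightarrow> real" where
  "p0 w u v x = \<mu> w * (\<alpha> w u * Q w u $ x) * (\<beta> w v * S w v $ x) / q w $ x"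

lemma mixture_nth:
  assumes "w < k"
  shows "(\<Sum>u<N. \<alpha> w u * Q w u $ x) = q w $ x" "(\<Sum>v<N. \<beta> w v * S w v $ x) = q w $ x"
  using arg_cong[OF Q(2)[OF assms], of "\<lambda>p. p $ x"] arg_cong[OF S(2)[OF assms], of "\<lambda>p. p $ x"] by simp_all

lemma simplexD:
  assumes "w < k"
  shows "u < N \<Longrightarrow> 0 \<le> Q w u $ x" "u < N \<Longrightarrow> 0 \<le> S w u $ x" "0 \<le> q w $ x"
    "u < N \<Longrightarrow> (\<Sum>x\<in>UNIV. Q w u $ x) = 1" "u < N \<Longrightarrow> (\<Sum>x\<in>UNIV. S w u $ x) = 1" "(\<Sum>x\<in>UNIV. q w $ x) = 1"
  using Q(1)[OF assms] S(1)[OF assms] q[OF assms] by (auto simp: prob_simplex_def)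

lemma p0_nonneg: "w < k \<Longrightarrow> u < N \<Longrightarrow> v < N \<Longrightarrow> 0 \<le> p0 w u v x"
  unfolding p0_def using \<mu>(1) \<alpha>(1) \<beta>(1) simplexD by simp

text \<open>The coupling retains the prescribed law of (W, U, X): the mixture of the
  \<open>S w v\<close> is \<open>q w\<close>, which cancels the denominator.\<close>

lemma p0_sum_v:
  assumes "w < k" "u < N"
  shows "(\<Sum>v<N. p0 w u v x) = \<mu> w * \<alpha> w u * Q w u $ x"
proof -
  have "(\<Sum>v<N. p0 w u v x) = \<mu> w * (\<alpha> w u * Q w u $ x) * q w $ x / q w $ x"
    unfolding p0_def mixture_nth(2)[OF assms(1), symmetric]
    by (simp add: sum_distrib_left sum_divide_distrib)
  \<comment> \<open>When the denominator is zero the left side is zero by convention; the right side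
    is zero as one of several nonnegative terms with sum \<open>q w $ x\<close>.\<close>
  moreover have "\<alpha> w u * Q w u $ x = 0" if "q w $ x = 0"
    by (rule sum_nonneg_0[of "{..<N}" "\<lambda>u. \<alpha> w u * Q w u $ x"])
      (use mixture_nth(1)[OF assms(1), of x] that assms \<alpha>(1) simplexD(1) in auto)
  ultimately show ?thesis by (cases "q w $ x = 0") auto
qed

lemma p0_sum_u:
  assumes "w < k" "v < N"
  shows "(\<Sum>u<N. p0 w u v x) = \<mu> w * \<beta> w v * S w v $ x"
proof -
  have "(\<Sum>u<N. p0 w u v x) = \<mu> w * q w $ x * (\<beta> w v * S w v $ x) / q w $ x"
    unfolding p0_def mixture_nth(1)[OF assms(1), symmetric]
    by (simp add: sum_distrib_left sum_distrib_right sum_divide_distrib)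
  moreover have "\<beta> w v * S w v $ x = 0" if "q w $ x = 0"
    by (rule sum_nonneg_0[of "{..<N}" "\<lambda>v. \<beta> w v * S w v $ x"])
      (use mixture_nth(2)[OF assms(1), of x] that assms \<beta>(1) simplexD(2) in auto)
  ultimately show ?thesis by (cases "q w $ x = 0") auto
qed

lemma p0_sum_uv:
  assumes "w < k"
  shows "(\<Sum>u<N. \<Sum>v<N. p0 w u v x) = \<mu> w * q w $ x"
  using assms by (simp add: p0_sum_v mult.assoc mixture_nth flip: sum_distrib_left)

section \<open>Masking by shifts modulo N and modulo the size of the input alphabet\<close>

definition m :: nat where "m = CARD('x)"

text \<open>An arbitrary identification of the input alphabet with the residues modulo
  \<open>m\<close>, which gives X a group structure for masking.\<close>

definition e :: "nat \<Rightarrow> 'x" where "e = (SOME e. bij_betw e {..<m} UNIV)"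

text \<open>Unmasking of X from the stored residue \<open>C\<close> and both key parts. With any two
  of the arguments fixed, the third runs through the whole alphabet exactly once.\<close>

definition xm :: "nat \<Rightarrow> nat \<Rightarrow> nat \<Rightarrow> 'x" where "xm C l1 l2 = e ((C + l1 + l2) mod m)"

definition sm :: "nat \<Rightarrow> nat \<Rightarrow> nat" where "sm A k1 = (A + k1) mod N"

lemma m_pos: "0 < m" by (simp add: m_def)

lemma bij_e: "bij_betw e {..<m} UNIV"
proof -
  have "\<exists>e. bij_betw e {..<m} (UNIV :: 'x set)"
    using ex_bij_betw_nat_finite[of "UNIV :: 'x set"] by (auto simp: m_def atLeast0LessThan)
  then show ?thesis unfolding e_def by (rule someI_ex)
qed

lemma sm_less: "sm A k1 < N" using N by (simp add: sm_def)

lemma sum_sm: "(\<Sum>A<N. F (sm A k1)) = (\<Sum>u<N. F u)" "(\<Sum>k1<N. F (sm A k1)) = (\<Sum>u<N. F u)"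
  for F :: "nat \<Rightarrow> real"
  using sum_shift_mod[of F k1 N] sum_shift_mod[of F A N] by (simp_all add: sm_def add.commute)

lemma sum_xm: "(\<Sum>C<m. F (xm C l1 l2)) = (\<Sum>x\<in>UNIV. F x)" "(\<Sum>l1<m. F (xm C l1 l2)) = (\<Sum>x\<in>UNIV. F x)"
  "(\<Sum>l2<m. F (xm C l1 l2)) = (\<Sum>x\<in>UNIV. F x)"
  for F :: "'x \<Rightarrow> real"
proof -
  have "(\<Sum>j<m. F (e ((j + i) mod m))) = (\<Sum>x\<in>UNIV. F x)" for i
    unfolding sum_shift_mod[of "\<lambda>j. F (e j)"] by (rule sum.reindex_bij_betw[OF bij_e])
  from this[of "l1 + l2"] this[of "C + l2"] this[of "C + l1"]
  show "(\<Sum>C<m. F (xm C l1 l2)) = (\<Sum>x\<in>UNIV. F x)" "(\<Sum>l1<m. F (xm C l1 l2)) = (\<Sum>x\<in>UNIV. F x)"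
    "(\<Sum>l2<m. F (xm C l1 l2)) = (\<Sum>x\<in>UNIV. F x)"
    by (simp_all add: xm_def ac_simps)
qed

definition Keys :: "(nat \<times> nat) set" where "Keys = {..<N} \<times> {..<m}"

definition AW :: "(nat \<times> nat \<times> nat \<times> nat) set" where
  "AW = {..<k} \<times> {..<N} \<times> {..<N} \<times> {..<m}"

definition pK :: "nat \<times> nat \<Rightarrow> real" where "pK = (\<lambda>_. 1 / (real N * real m))"

text \<open>The masked entries A, B, C are translates of U, V, X by the keys, so their law given the
  keys is \<open>p0\<close> at the unmasked values.\<close>

definition pW :: "nat \<times> nat \<Rightarrow> nat \<times> nat \<Rightarrow> nat \<times> nat \<times> nat \<times> nat \<Rightarrow> real" where
  "pW = (\<lambda>(k1, l1) (k2, l2) (w, A, B, C). p0 w (sm A k1) (sm B k2) (xm C l1 l2))"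

definition pX :: "nat \<times> nat \<Rightarrow> nat \<times> nat \<Rightarrow> nat \<times> nat \<times> nat \<times> nat \<Rightarrow> 'x \<Rightarrow> real" where
  "pX = (\<lambda>(k1, l1) (k2, l2) (w, A, B, C) x. if x = xm C l1 l2 then 1 else 0)"

lemma fin_sets: "finite Keys" "finite AW" by (auto simp: Keys_def AW_def)

lemma pmf_pK: "is_pmf_on Keys pK"
  using N m_pos by (simp add: is_pmf_on_def Keys_def pK_def card_cartesian_product)

lemma sum_Keys: "sum F Keys = (\<Sum>a<N. \<Sum>b<m. F (a, b))" for F :: "_ \<Rightarrow> real"
  by (simp add: Keys_def sum.cartesian_product)

lemma sum_AW:
  fixes F :: "nat \<Rightarrow> nat \<Rightarrow> nat \<Rightarrow> 'x \<Rightarrow> real"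
  shows "(\<Sum>(w, A, B, C)\<in>AW. F w (sm A k1) (sm B k2) (xm C l1 l2)) = (\<Sum>w<k. \<Sum>u<N. \<Sum>v<N. \<Sum>x\<in>UNIV. F w u v x)"
proof -
  have "(\<Sum>(w, A, B, C)\<in>AW. F w (sm A k1) (sm B k2) (xm C l1 l2))
     = (\<Sum>w<k. \<Sum>A<N. \<Sum>B<N. \<Sum>C<m. F w (sm A k1) (sm B k2) (xm C l1 l2))"
    by (simp add: AW_def sum.cartesian_product)
  also have "\<dots> = (\<Sum>w<k. \<Sum>A<N. \<Sum>B<N. \<Sum>x\<in>UNIV. F w (sm A k1) (sm B k2) x)"
    by (simp add: sum_xm(1))
  also have "\<dots> = (\<Sum>w<k. \<Sum>A<N. \<Sum>v<N. \<Sum>x\<in>UNIV. F w (sm A k1) v x)"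
    by (simp add: sum_sm(1)[of "\<lambda>v. \<Sum>x\<in>UNIV. F _ _ v x"])
  also have "\<dots> = (\<Sum>w<k. \<Sum>u<N. \<Sum>v<N. \<Sum>x\<in>UNIV. F w u v x)"
    by (simp add: sum_sm(1)[of "\<lambda>u. \<Sum>v<N. \<Sum>x\<in>UNIV. F _ u v x"])
  finally show ?thesis .
qed

lemma sum_p0_u:
  "(\<Sum>w<k. \<Sum>u<N. \<Sum>v<N. \<Sum>x\<in>UNIV. p0 w u v x * F w u x) = (\<Sum>w<k. \<Sum>u<N. \<mu> w * \<alpha> w u * (\<Sum>x\<in>UNIV. Q w u $ x * F w u x))"
proof (intro sum.cong refl)
  fix w u assume "w \<in> {..<k}" "u \<in> {..<N}"
  then have w: "w < k" "u < N" by auto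
  have "(\<Sum>v<N. \<Sum>x\<in>UNIV. p0 w u v x * F w u x) = (\<Sum>x\<in>UNIV. (\<Sum>v<N. p0 w u v x) * F w u x)"
    by (subst sum.swap) (simp add: sum_distrib_right)
  also have "\<dots> = \<mu> w * \<alpha> w u * (\<Sum>x\<in>UNIV. Q w u $ x * F w u x)"
    by (simp add: p0_sum_v[OF w] sum_distrib_left ac_simps)
  finally show "(\<Sum>v<N. \<Sum>x\<in>UNIV. p0 w u v x * F w u x) = \<mu> w * \<alpha> w u * (\<Sum>x\<in>UNIV. Q w u $ x * F w u x)" .
qed

lemma sum_p0_v:
  "(\<Sum>w<k. \<Sum>u<N. \<Sum>v<N. \<Sum>x\<in>UNIV. p0 w u v x * F w v x) = (\<Sum>w<k. \<Sum>v<N. \<mu> w * \<beta> w v * (\<Sum>x\<in>UNIV. S w v $ x * F w v x))"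
proof (rule sum.cong[OF refl])
  fix w assume "w \<in> {..<k}"
  then have w: "w < k" by auto
  have "(\<Sum>u<N. \<Sum>v<N. \<Sum>x\<in>UNIV. p0 w u v x * F w v x) = (\<Sum>v<N. \<Sum>u<N. \<Sum>x\<in>UNIV. p0 w u v x * F w v x)"
    by (rule sum.swap)
  also have "\<dots> = (\<Sum>v<N. \<mu> w * \<beta> w v * (\<Sum>x\<in>UNIV. S w v $ x * F w v x))"
  proof (intro sum.cong refl)
    fix v assume "v \<in> {..<N}"
    then have v: "v < N" by auto
    have "(\<Sum>u<N. \<Sum>x\<in>UNIV. p0 w u v x * F w v x) = (\<Sum>x\<in>UNIV. (\<Sum>u<N. p0 w u v x) * F w v x)"
      by (subst sum.swap) (simp add: sum_distrib_right)
    also have "\<dots> = \<mu> w * \<beta> w v * (\<Sum>x\<in>UNIV. S w v $ x * F w v x)"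
      by (simp add: p0_sum_u[OF w v] sum_distrib_left ac_simps)
    finally show "(\<Sum>u<N. \<Sum>x\<in>UNIV. p0 w u v x * F w v x) = \<mu> w * \<beta> w v * (\<Sum>x\<in>UNIV. S w v $ x * F w v x)" .
  qed
  finally show "(\<Sum>u<N. \<Sum>v<N. \<Sum>x\<in>UNIV. p0 w u v x * F w v x)
     = (\<Sum>v<N. \<mu> w * \<beta> w v * (\<Sum>x\<in>UNIV. S w v $ x * F w v x))" .
qed

lemma sum_p0_x:
  "(\<Sum>w<k. \<Sum>u<N. \<Sum>v<N. \<Sum>x\<in>UNIV. p0 w u v x * F w x) = (\<Sum>w<k. \<mu> w * (\<Sum>x\<in>UNIV. q w $ x * F w x))"
  unfolding sum_p0_u[of "\<lambda>w u x. F w x"]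
proof (rule sum.cong[OF refl])
  fix w assume "w \<in> {..<k}"
  then have w: "w < k" by auto
  have "(\<Sum>u<N. \<mu> w * \<alpha> w u * (\<Sum>x\<in>UNIV. Q w u $ x * F w x))
      = (\<Sum>x\<in>UNIV. \<Sum>u<N. \<mu> w * ((\<alpha> w u * Q w u $ x) * F w x))"
    by (subst sum.swap) (simp add: sum_distrib_left ac_simps)
  also have "\<dots> = \<mu> w * (\<Sum>x\<in>UNIV. q w $ x * F w x)"
    by (simp add: mixture_nth(1)[OF w, symmetric] flip: sum_distrib_left sum_distrib_right)
  finally show "(\<Sum>u<N. \<mu> w * \<alpha> w u * (\<Sum>x\<in>UNIV. Q w u $ x * F w x)) = \<mu> w * (\<Sum>x\<in>UNIV. q w $ x * F w x)" .
qed

lemma pmf_pW: "is_pmf_on AW (pW a b)"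
proof -
  obtain k1 l1 k2 l2 where ab: "a = (k1, l1)" "b = (k2, l2)" by (metis surj_pair)
  have "sum (pW a b) AW = (\<Sum>w<k. \<mu> w * (\<Sum>x\<in>UNIV. q w $ x * 1))"
    unfolding ab pW_def prod.case sum_AW sum_p0_x[symmetric] by simp
  also have "\<dots> = 1" using \<mu>(2) by (simp add: simplexD(6))
  finally show ?thesis
    unfolding is_pmf_on_def ab by (auto simp: pW_def AW_def intro!: p0_nonneg sm_less)
qed

lemma pmf_pX: "is_pmf_on UNIV (pX a b c)"
  by (cases a; cases b; cases c) (simp add: is_pmf_on_def pX_def)

definition T :: "((nat \<times> nat) \<times> (nat \<times> nat) \<times> (nat \<times> nat \<times> nat \<times> nat)) set" where
  "T = Keys \<times> Keys \<times> AW"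

definition th :: "((nat \<times> nat) \<times> (nat \<times> nat) \<times> (nat \<times> nat \<times> nat \<times> nat)) \<Rightarrow> real" where
  "th = (\<lambda>(u, v, w). pK u * pK v * pW u v w)"

definition xi :: "((nat \<times> nat) \<times> (nat \<times> nat) \<times> (nat \<times> nat \<times> nat \<times> nat)) \<Rightarrow> 'x \<Rightarrow> real" where
  "xi = (\<lambda>(u, v, w). pX u v w)"

lemma sum_T: "sum F T = (\<Sum>u\<in>Keys. \<Sum>v\<in>Keys. \<Sum>w\<in>AW. F (u, v, w))" for F :: "_ \<Rightarrow> real"
  by (simp add: T_def sum.cartesian_product)

sublocale bc_model T th xi Ch
proof
  show "finite T" by (simp add: T_def fin_sets)
  have "sum th T = (\<Sum>u\<in>Keys. \<Sum>v\<in>Keys. pK u * pK v)"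
    using pmf_pW by (simp add: sum_T th_def is_pmf_on_def flip: sum_distrib_left)
  also have "\<dots> = 1" using pmf_pK by (simp add: is_pmf_on_def flip: sum_distrib_left)
  finally show "is_pmf_on T th"
    using pmf_pW pmf_pK by (auto simp: is_pmf_on_def th_def T_def)
  show "is_pmf_on UNIV (xi t)" for t by (auto simp: xi_def pmf_pX split: prod.splits)
qed (rule Ch)

text \<open>For functions of unmasked values the shift is undone by a change of variables inside
  \<open>AW\<close>, for each choice of keys, and the keys then average out.\<close>

lemma expect_T:
  fixes F :: "nat \<Rightarrow> nat \<Rightarrow> nat \<Rightarrow> 'x \<Rightarrow> real"
  shows "(\<Sum>t\<in>T. th t * (case t of ((k1, l1), (k2, l2), w, A, B, C) \<Rightarrow> F w (sm A k1) (sm B k2) (xm C l1 l2)))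
    = (\<Sum>w<k. \<Sum>u<N. \<Sum>v<N. \<Sum>x\<in>UNIV. p0 w u v x * F w u v x)" (is "?l = ?r")
proof -
  have "(\<Sum>w\<in>AW. th (u, v, w) * (case (u, v, w) of ((k1, l1), (k2, l2), w, A, B, C) \<Rightarrow> F w (sm A k1) (sm B k2) (xm C l1 l2)))
      = pK u * pK v * ?r" for u v
  proof -
    obtain k1 l1 k2 l2 where ab: "u = (k1, l1)" "v = (k2, l2)" by (metis surj_pair)
    have "(\<Sum>w\<in>AW. th (u, v, w) * (case (u, v, w) of ((k1, l1), (k2, l2), w, A, B, C) \<Rightarrow> F w (sm A k1) (sm B k2) (xm C l1 l2)))
      = (\<Sum>(w, A, B, C)\<in>AW. pK u * pK v * (p0 w (sm A k1) (sm B k2) (xm C l1 l2) * F w (sm A k1) (sm B k2) (xm C l1 l2)))"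
      by (rule sum.cong) (auto simp: ab th_def pW_def)
    also have "\<dots> = pK u * pK v * ?r"
      by (subst sum_AW) (simp add: sum_distrib_left)
    finally show ?thesis .
  qed
  then have "?l = (\<Sum>u\<in>Keys. \<Sum>v\<in>Keys. pK u * pK v * ?r)" by (simp only: sum_T)
  also have "\<dots> = ?r"
    using pmf_pK by (simp add: is_pmf_on_def flip: sum_distrib_left sum_distrib_right)
  finally show ?thesis .
qed

abbreviation Uv where "Uv t \<equiv> fst t"
abbreviation Vv where "Vv t \<equiv> fst (snd t)"
abbreviation Wv where "Wv t \<equiv> snd (snd t)"

lemma sum_mult_delta: "(\<Sum>x'\<in>UNIV. F x' * (if x = x' then 1 else 0)) = F x" for F :: "'x \<Rightarrow> real"
proof -
  have "(\<Sum>x'\<in>UNIV. F x' * (if x = x' then 1 else 0)) = (\<Sum>x'\<in>UNIV. if x = x' then F x' else 0)"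
    by (rule sum.cong) auto
  then show ?thesis by simp
qed

lemma sum_xm_delta: "(\<Sum>l2<m. F (xm C l1 l2) * (if x = xm C l1 l2 then 1 else 0)) = F x"
  "(\<Sum>l1<m. F (xm C l1 l2) * (if x = xm C l1 l2 then 1 else 0)) = F x" for F :: "'x \<Rightarrow> real"
  using sum_xm(2,3)[of "\<lambda>x'. F x' * (if x = x' then 1 else 0)"]
  by (simp_all only: sum_mult_delta)

text \<open>The first key reveals U, while V and X remain covered by the unseen second key. Summing
  over that key runs over all v, and for each x exactly one \<open>l2\<close> unmasks
  \<open>C\<close> to x. What is left is the law of X given (W, U).\<close>

lemma fiber_UW:
  assumes "a \<in> (\<lambda>t. (Uv t, Wv t)) ` T"
  shows "(\<Sum>t\<in>{t\<in>T. (Uv t, Wv t) = a}. th t * xi t x)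
    = (case a of ((k1, l1), w, A, B, C) \<Rightarrow> (1 / (real N * real m))\<^sup>2 * \<mu> w * \<alpha> w (sm A k1))
      * (case a of ((k1, l1), w, A, B, C) \<Rightarrow> Q w (sm A k1)) $ x"
proof -
  obtain k1 l1 w A B C where a: "a = ((k1, l1), (w, A, B, C))" and K: "(k1, l1) \<in> Keys" and W: "(w, A, B, C) \<in> AW"
    using assms by (elim imageE) (auto simp: T_def)
  have w: "w < k" using W by (auto simp: AW_def)
  have "{t\<in>T. (Uv t, Wv t) = a} = (\<lambda>v. ((k1, l1), v, (w, A, B, C))) ` Keys"
    using K W by (auto simp: T_def a)
  then have "(\<Sum>t\<in>{t\<in>T. (Uv t, Wv t) = a}. th t * xi t x)
      = (\<Sum>v\<in>Keys. th ((k1, l1), v, (w, A, B, C)) * xi ((k1, l1), v, (w, A, B, C)) x)"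
    by (simp add: sum.reindex inj_on_def)
  also have "\<dots> = (1 / (real N * real m))\<^sup>2 * (\<Sum>k2<N. \<Sum>l2<m. p0 w (sm A k1) (sm B k2) (xm C l1 l2) * (if x = xm C l1 l2 then 1 else 0))"
    unfolding sum_Keys sum_distrib_left
    by (intro sum.cong refl) (simp add: th_def xi_def pK_def pW_def pX_def power2_eq_square)
  also have "(\<Sum>k2<N. \<Sum>l2<m. p0 w (sm A k1) (sm B k2) (xm C l1 l2) * (if x = xm C l1 l2 then 1 else 0))
      = (\<Sum>v<N. p0 w (sm A k1) v x)"
    unfolding sum_xm_delta(1)[of "p0 w (sm A k1) (sm B _)"] sum_sm(2)[of "\<lambda>v. p0 w (sm A k1) v x"] ..
  also have "\<dots> = \<mu> w * \<alpha> w (sm A k1) * Q w (sm A k1) $ x"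
    by (rule p0_sum_v[OF w sm_less])
  finally show ?thesis by (simp add: a)
qed

lemma fiber_VW:
  assumes "a \<in> (\<lambda>t. (Vv t, Wv t)) ` T"
  shows "(\<Sum>t\<in>{t\<in>T. (Vv t, Wv t) = a}. th t * xi t x)
    = (case a of ((k2, l2), w, A, B, C) \<Rightarrow> (1 / (real N * real m))\<^sup>2 * \<mu> w * \<beta> w (sm B k2))
      * (case a of ((k2, l2), w, A, B, C) \<Rightarrow> S w (sm B k2)) $ x"
proof -
  obtain k2 l2 w A B C where a: "a = ((k2, l2), (w, A, B, C))" and K: "(k2, l2) \<in> Keys" and W: "(w, A, B, C) \<in> AW"
    using assms by (elim imageE) (auto simp: T_def)
  have w: "w < k" using W by (auto simp: AW_def)
  have "{t\<in>T. (Vv t, Wv t) = a} = (\<lambda>u. (u, (k2, l2), (w, A, B, C))) ` Keys"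
    using K W by (auto simp: T_def a)
  then have "(\<Sum>t\<in>{t\<in>T. (Vv t, Wv t) = a}. th t * xi t x)
      = (\<Sum>u\<in>Keys. th (u, (k2, l2), (w, A, B, C)) * xi (u, (k2, l2), (w, A, B, C)) x)"
    by (simp add: sum.reindex inj_on_def)
  also have "\<dots> = (1 / (real N * real m))\<^sup>2 * (\<Sum>k1<N. \<Sum>l1<m. p0 w (sm A k1) (sm B k2) (xm C l1 l2) * (if x = xm C l1 l2 then 1 else 0))"
    unfolding sum_Keys sum_distrib_left
    by (intro sum.cong refl) (simp add: th_def xi_def pK_def pW_def pX_def power2_eq_square)
  also have "(\<Sum>k1<N. \<Sum>l1<m. p0 w (sm A k1) (sm B k2) (xm C l1 l2) * (if x = xm C l1 l2 then 1 else 0))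
      = (\<Sum>u<N. p0 w u (sm B k2) x)"
    unfolding sum_xm_delta(2)[of "p0 w (sm A _) (sm B k2)"] sum_sm(2)[of "\<lambda>u. p0 w u (sm B k2) x"] ..
  also have "\<dots> = \<mu> w * \<beta> w (sm B k2) * S w (sm B k2) $ x"
    by (rule p0_sum_u[OF w sm_less])
  finally show ?thesis by (simp add: a)
qed

text \<open>Without any key only \<open>q w\<close> is visible. The factor \<open>real m\<close>
  counts the pairs of key parts that unmask \<open>C\<close> to a given x: one \<open>l2\<close> for
  each \<open>l1\<close>.\<close>

lemma fiber_W:
  assumes "a \<in> Wv ` T"
  shows "(\<Sum>t\<in>{t\<in>T. Wv t = a}. th t * xi t x)
    = (case a of (w, A, B, C) \<Rightarrow> (1 / (real N * real m))\<^sup>2 * real m * \<mu> w)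
      * (case a of (w, A, B, C) \<Rightarrow> q w) $ x"
proof -
  obtain w A B C where a: "a = (w, A, B, C)" and W: "(w, A, B, C) \<in> AW"
    using assms by (elim imageE) (auto simp: T_def)
  have w: "w < k" using W by (auto simp: AW_def)
  have "{t\<in>T. Wv t = a} = (\<lambda>(u, v). (u, v, a)) ` (Keys \<times> Keys)"
    using W by (auto simp: T_def a)
  then have "(\<Sum>t\<in>{t\<in>T. Wv t = a}. th t * xi t x) = (\<Sum>u\<in>Keys. \<Sum>v\<in>Keys. th (u, v, a) * xi (u, v, a) x)"
    by (simp add: sum.reindex inj_on_def sum.cartesian_product case_prod_unfold)
  also have "\<dots> = (1 / (real N * real m))\<^sup>2 * (\<Sum>k1<N. \<Sum>l1<m. \<Sum>k2<N. \<Sum>l2<m.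
      p0 w (sm A k1) (sm B k2) (xm C l1 l2) * (if x = xm C l1 l2 then 1 else 0))"
    unfolding sum_Keys sum_distrib_left a
    by (intro sum.cong refl) (simp add: th_def xi_def pK_def pW_def pX_def power2_eq_square)
  also have "(\<Sum>k1<N. \<Sum>l1<m. \<Sum>k2<N. \<Sum>l2<m.
      p0 w (sm A k1) (sm B k2) (xm C l1 l2) * (if x = xm C l1 l2 then 1 else 0)) = real m * (\<mu> w * q w $ x)"
    unfolding sum_xm_delta(1)[of "p0 w (sm A _) (sm B _)"] sum_sm(2)[of "\<lambda>v. p0 w (sm A _) v x"]
      p0_sum_uv[OF w, symmetric] sum_sm(2)[of "\<lambda>u. \<Sum>v<N. p0 w u v x"]
    by (simp add: sum_sm(2)[of "\<lambda>u. \<Sum>v<N. p0 w u v x"] flip: sum_distrib_left)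
  finally show ?thesis by (simp add: a)
qed

definition qbar :: "real^'x" where "qbar = (\<Sum>w<k. \<mu> w *\<^sub>R q w)"

lemma qbar_nth: "qbar $ x = (\<Sum>w<k. \<mu> w * q w $ x)" by (simp add: qbar_def)

lemma qbar_simplex: "qbar \<in> prob_simplex"
  unfolding qbar_def using \<mu> q by (intro convex_sum convex_prob_simplex) auto

text \<open>The trivial variable brings the unconditional output entropies under the same scheme as
  the conditional ones.\<close>

lemma fiber_const: "(\<Sum>t\<in>{t\<in>T. () = a}. th t * xi t x) = 1 * qbar $ x"
proof -
  have "(\<Sum>t\<in>{t\<in>T. () = a}. th t * xi t x) = (\<Sum>t\<in>T. th t * (case t of ((k1, l1), (k2, l2), w, A, B, C) \<Rightarrow>
     (if x = xm C l1 l2 then 1 else 0)))"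
    by (rule sum.cong) (auto simp: xi_def pX_def)
  also have "\<dots> = qbar $ x"
    unfolding expect_T[of "\<lambda>w u v x'. if x = x' then 1 else 0"]
      sum_p0_x[of "\<lambda>w x'. if x = x' then 1 else 0"] qbar_nth sum_mult_delta by (simp add: p0_sum_uv)
  finally show ?thesis by simp
qed

text \<open>With both keys X is known, so the conditional law is a vertex of the simplex, and
  conditioning on everything gives H(Y|X) and H(Z|X).\<close>

lemma fiber_all:
  assumes "a \<in> (\<lambda>t. (Uv t, Vv t, Wv t)) ` T"
  shows "(\<Sum>t\<in>{t\<in>T. (Uv t, Vv t, Wv t) = a}. th t * xi t x)
    = th a * (case a of ((k1, l1), (k2, l2), w, A, B, C) \<Rightarrow> axis (xm C l1 l2) 1) $ x"
proof -
  have "{t\<in>T. (Uv t, Vv t, Wv t) = a} = {a}" using assms by auto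
  then show ?thesis by (auto simp: xi_def pX_def axis_def split: prod.splits)
qed

abbreviation Yv where "Yv \<omega> \<equiv> fst (snd (snd \<omega>))"
abbreviation Zv where "Zv \<omega> \<equiv> snd (snd (snd \<omega>))"

lemma cond_ent_UW:
  "ent (\<lambda>\<omega>. ((Uv (fst \<omega>), Wv (fst \<omega>)), Yv \<omega>)) - ent (\<lambda>\<omega>. (Uv (fst \<omega>), Wv (fst \<omega>)))
    = (\<Sum>w<k. \<Sum>u<N. \<mu> w * \<alpha> w u * hout (chY Ch) (Q w u))" (is ?Y)
  "ent (\<lambda>\<omega>. ((Uv (fst \<omega>), Wv (fst \<omega>)), Zv \<omega>)) - ent (\<lambda>\<omega>. (Uv (fst \<omega>), Wv (fst \<omega>)))
    = (\<Sum>w<k. \<Sum>u<N. \<mu> w * \<alpha> w u * hout (chZ Ch) (Q w u))" (is ?Z)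
proof -
  let ?q = "\<lambda>a. case a of ((k1, l1), w, A, B, C) \<Rightarrow> Q w (sm A k1)"
  have s: "?q a \<in> prob_simplex" if "a \<in> (\<lambda>t. (Uv t, Wv t)) ` T" for a
    using that by (elim imageE) (auto simp: T_def AW_def intro!: Q(1) sm_less)
  note ce = cond_ent_model[OF fiber_UW s]
  have "(\<Sum>t\<in>T. th t * f (?q (Uv t, Wv t))) = (\<Sum>w<k. \<Sum>u<N. \<mu> w * \<alpha> w u * f (Q w u))" for f
  proof -
    have "(\<Sum>t\<in>T. th t * f (?q (Uv t, Wv t))) = (\<Sum>t\<in>T. th t * (case t of ((k1, l1), (k2, l2), w, A, B, C) \<Rightarrow> f (Q w (sm A k1))))"
      by (rule sum.cong) auto
    also have "\<dots> = (\<Sum>w<k. \<Sum>u<N. \<mu> w * \<alpha> w u * f (Q w u))"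
      unfolding expect_T[of "\<lambda>w u v x. f (Q w u)"] sum_p0_u[of "\<lambda>w u x. f (Q w u)"]
      by (intro sum.cong refl) (simp add: simplexD(4) flip: sum_distrib_right)
    finally show ?thesis .
  qed
  then show ?Y ?Z using ce by simp_all
qed

lemma cond_ent_VW:
  "ent (\<lambda>\<omega>. ((Vv (fst \<omega>), Wv (fst \<omega>)), Yv \<omega>)) - ent (\<lambda>\<omega>. (Vv (fst \<omega>), Wv (fst \<omega>)))
    = (\<Sum>w<k. \<Sum>v<N. \<mu> w * \<beta> w v * hout (chY Ch) (S w v))" (is ?Y)
  "ent (\<lambda>\<omega>. ((Vv (fst \<omega>), Wv (fst \<omega>)), Zv \<omega>)) - ent (\<lambda>\<omega>. (Vv (fst \<omega>), Wv (fst \<omega>)))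
    = (\<Sum>w<k. \<Sum>v<N. \<mu> w * \<beta> w v * hout (chZ Ch) (S w v))" (is ?Z)
proof -
  let ?q = "\<lambda>a. case a of ((k2, l2), w, A, B, C) \<Rightarrow> S w (sm B k2)"
  have s: "?q a \<in> prob_simplex" if "a \<in> (\<lambda>t. (Vv t, Wv t)) ` T" for a
    using that by (elim imageE) (auto simp: T_def AW_def intro!: S(1) sm_less)
  note ce = cond_ent_model[OF fiber_VW s]
  have "(\<Sum>t\<in>T. th t * f (?q (Vv t, Wv t))) = (\<Sum>w<k. \<Sum>v<N. \<mu> w * \<beta> w v * f (S w v))" for f
  proof -
    have "(\<Sum>t\<in>T. th t * f (?q (Vv t, Wv t))) = (\<Sum>t\<in>T. th t * (case t of ((k1, l1), (k2, l2), w, A, B, C) \<Rightarrow> f (S w (sm B k2))))"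
      by (rule sum.cong) auto
    also have "\<dots> = (\<Sum>w<k. \<Sum>v<N. \<mu> w * \<beta> w v * f (S w v))"
      unfolding expect_T[of "\<lambda>w u v x. f (S w v)"] sum_p0_v[of "\<lambda>w v x. f (S w v)"]
      by (intro sum.cong refl) (simp add: simplexD(5) flip: sum_distrib_right)
    finally show ?thesis .
  qed
  then show ?Y ?Z using ce by simp_all
qed

lemma cond_ent_W:
  "ent (\<lambda>\<omega>. (Wv (fst \<omega>), Yv \<omega>)) - ent (\<lambda>\<omega>. Wv (fst \<omega>)) = (\<Sum>w<k. \<mu> w * hout (chY Ch) (q w))" (is ?Y)
  "ent (\<lambda>\<omega>. (Wv (fst \<omega>), Zv \<omega>)) - ent (\<lambda>\<omega>. Wv (fst \<omega>)) = (\<Sum>w<k. \<mu> w * hout (chZ Ch) (q w))" (is ?Z)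
proof -
  let ?q = "\<lambda>a. case a of (w, A, B, C) \<Rightarrow> q w"
  have s: "?q a \<in> prob_simplex" if "a \<in> Wv ` T" for a
    using that by (elim imageE) (auto simp: T_def AW_def intro!: q)
  note ce = cond_ent_model[OF fiber_W s]
  have "(\<Sum>t\<in>T. th t * f (?q (Wv t))) = (\<Sum>w<k. \<mu> w * f (q w))" for f
  proof -
    have "(\<Sum>t\<in>T. th t * f (?q (Wv t))) = (\<Sum>t\<in>T. th t * (case t of ((k1, l1), (k2, l2), w, A, B, C) \<Rightarrow> f (q w)))"
      by (rule sum.cong) auto
    also have "\<dots> = (\<Sum>w<k. \<mu> w * f (q w))"
      unfolding expect_T[of "\<lambda>w u v x. f (q w)"] sum_p0_x[of "\<lambda>w x. f (q w)"]
      by (intro sum.cong refl) (simp add: simplexD(6) flip: sum_distrib_right)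
    finally show ?thesis .
  qed
  then show ?Y ?Z using ce by simp_all
qed

lemma ent_output: "ent Yv = hout (chY Ch) qbar" "ent Zv = hout (chZ Ch) qbar"
proof -
  have "sum th T = 1" using \<theta> by (simp add: is_pmf_on_def)
  moreover have "ent (\<lambda>\<omega>. ((), Yv \<omega>)) = ent Yv" "ent (\<lambda>\<omega>. ((), Zv \<omega>)) = ent Zv"
    by (rule ent_kernel; simp)+
  ultimately show "ent Yv = hout (chY Ch) qbar" "ent Zv = hout (chZ Ch) qbar"
    using cond_ent_model[OF fiber_const qbar_simplex] by (simp_all flip: sum_distrib_right)
qed

lemma cond_ent_all:
  "ent (\<lambda>\<omega>. ((Uv (fst \<omega>), Vv (fst \<omega>), Wv (fst \<omega>)), Yv \<omega>)) - ent (\<lambda>\<omega>. (Uv (fst \<omega>), Vv (fst \<omega>), Wv (fst \<omega>)))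
    = (\<Sum>x\<in>UNIV. qbar $ x * hrow (chY Ch) x)" (is ?Y)
  "ent (\<lambda>\<omega>. ((Uv (fst \<omega>), Vv (fst \<omega>), Wv (fst \<omega>)), Zv \<omega>)) - ent (\<lambda>\<omega>. (Uv (fst \<omega>), Vv (fst \<omega>), Wv (fst \<omega>)))
    = (\<Sum>x\<in>UNIV. qbar $ x * hrow (chZ Ch) x)" (is ?Z)
proof -
  let ?q = "\<lambda>a. case a of ((k1, l1), (k2, l2), w, A, B, C) \<Rightarrow> axis (xm C l1 l2) (1::real)"
  have s: "?q a \<in> prob_simplex" if "a \<in> (\<lambda>t. (Uv t, Vv t, Wv t)) ` T" for a
    by (auto simp: axis_in_prob_simplex split: prod.splits)
  note ce = cond_ent_model[OF fiber_all s]
  have "(\<Sum>t\<in>T. th t * f (?q (Uv t, Vv t, Wv t))) = (\<Sum>x\<in>UNIV. qbar $ x * f (axis x 1))" for f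
  proof -
    have "(\<Sum>t\<in>T. th t * f (?q (Uv t, Vv t, Wv t))) = (\<Sum>t\<in>T. th t * (case t of ((k1, l1), (k2, l2), w, A, B, C) \<Rightarrow> f (axis (xm C l1 l2) 1)))"
      by (rule sum.cong) auto
    also have "\<dots> = (\<Sum>w<k. \<mu> w * (\<Sum>x\<in>UNIV. q w $ x * f (axis x 1)))"
      unfolding expect_T[of "\<lambda>w u v x. f (axis x 1)"] sum_p0_x[of "\<lambda>w x. f (axis x 1)"] ..
    also have "\<dots> = (\<Sum>x\<in>UNIV. qbar $ x * f (axis x 1))"
      unfolding qbar_nth sum_distrib_left sum_distrib_right
      by (subst sum.swap) (simp add: mult.assoc)
    finally show ?thesis .
  qed
  then show ?Y ?Z using ce by (simp_all add: hout_axis)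
qed

text \<open>Now I(V;Z|U,W) is H(Z|U,W) minus the entropy of Z given all three, and the latter is
  H(Z|X); likewise for Y. Hence the relaxed bounds are literally the bounds for the padded
  variables.\<close>

lemma in_outer_bound:
  assumes "relaxed_bounds (chY Ch) (chZ Ch)
     (qbar, (\<Sum>w<k. \<mu> w * hout (chY Ch) (q w)), (\<Sum>w<k. \<mu> w * hout (chZ Ch) (q w)),
      ((\<Sum>w<k. \<Sum>u<N. \<mu> w * \<alpha> w u * hout (chY Ch) (Q w u)), (\<Sum>w<k. \<Sum>u<N. \<mu> w * \<alpha> w u * hout (chZ Ch) (Q w u))),
      ((\<Sum>w<k. \<Sum>v<N. \<mu> w * \<beta> w v * hout (chY Ch) (S w v)), (\<Sum>w<k. \<Sum>v<N. \<mu> w * \<beta> w v * hout (chZ Ch) (S w v))))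
     (R0, R1, R2)"
  shows "(R0, R1, R2) \<in> outer_bound Ch"
proof -
  have \<Omega>: "(Keys \<times> Keys \<times> AW) \<times> (UNIV :: ('x \<times> 'y \<times> 'z) set) = T \<times> UNIV" by (simp add: T_def)
  have P: "(\<lambda>((u, v, w), x, y, z). pK u * pK v * pW u v w * pX u v w x * Ch x y z)
      = (\<lambda>(t, x, y, z). th t * xi t x * Ch x y z)"
    by (auto simp: fun_eq_iff th_def xi_def)
  have e1: "ent (\<lambda>\<omega>. (Zv \<omega>, Uv (fst \<omega>), Wv (fst \<omega>))) = ent (\<lambda>\<omega>. ((Uv (fst \<omega>), Wv (fst \<omega>)), Zv \<omega>))"
    "ent (\<lambda>\<omega>. (Yv \<omega>, Vv (fst \<omega>), Wv (fst \<omega>))) = ent (\<lambda>\<omega>. ((Vv (fst \<omega>), Wv (fst \<omega>)), Yv \<omega>))"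
    "ent (\<lambda>\<omega>. (Vv (fst \<omega>), Uv (fst \<omega>), Wv (fst \<omega>))) = ent (\<lambda>\<omega>. (Uv (fst \<omega>), Vv (fst \<omega>), Wv (fst \<omega>)))"
    "ent (\<lambda>\<omega>. (Vv (fst \<omega>), Zv \<omega>, Uv (fst \<omega>), Wv (fst \<omega>))) = ent (\<lambda>\<omega>. ((Uv (fst \<omega>), Vv (fst \<omega>), Wv (fst \<omega>)), Zv \<omega>))"
    "ent (\<lambda>\<omega>. (Uv (fst \<omega>), Yv \<omega>, Vv (fst \<omega>), Wv (fst \<omega>))) = ent (\<lambda>\<omega>. ((Uv (fst \<omega>), Vv (fst \<omega>), Wv (fst \<omega>)), Yv \<omega>))"
    by (rule ent_kernel; force)+
  show ?thesis
    using assms cond_ent_UW cond_ent_VW cond_ent_W cond_ent_all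
    by (intro outer_boundI[of Keys Keys AW pK pK pW pX R0 Ch R1 R2] fin_sets pmf_pK pmf_pW pmf_pX;
       unfold \<Omega> P mutual_info_ent cond_mutual_info_ent e1 ent_output relaxed_bounds_def prod.case; linarith)
qed

end

section \<open>From a point of the hull to a padded distribution\<close>

lemma choice2:
  assumes "\<And>w. A w \<Longrightarrow> \<exists>x y. R w x y"
  shows "\<exists>f g. \<forall>w. A w \<longrightarrow> R w (f w) (g w)"
  using assms by metis

theorem relaxed_region_subset_outer_bound:
  fixes Ch :: "'x::finite \<Rightarrow> 'y::finite \<Rightarrow> 'z::finite \<Rightarrow> real"
  assumes Ch: "dm_bc Ch"
  shows "relaxed_region (chY Ch) (chZ Ch) \<subseteq> outer_bound Ch"
proof
  fix R :: "real \<times> real \<times> real"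
  let ?K = "chY Ch" and ?L = "chZ Ch"
  let ?G = "\<lambda>q. (q, hout ?K q, hout ?L q)"
  assume "R \<in> relaxed_region ?K ?L"
  then obtain p where p: "p \<in> convex hull split_points ?K ?L" "relaxed_bounds ?K ?L p R"
    by (auto simp: relaxed_region_def)
  obtain J \<nu> where J: "finite J" "J \<subseteq> split_points ?K ?L" "\<forall>x\<in>J. 0 \<le> \<nu> x" "sum \<nu> J = 1"
    "(\<Sum>v\<in>J. \<nu> v *\<^sub>R v) = p"
    using p(1) unfolding convex_hull_explicit by blast
  define k where "k = card J"
  obtain h where h: "bij_betw h {..<k} J"
    using ex_bij_betw_nat_finite[OF J(1)] by (auto simp: k_def atLeast0LessThan)
  \<comment> \<open>The mixture that produces the hull point becomes the law of W; the two
    splittings inside each component will become U and V.\<close>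
  define \<mu> where "\<mu> w = \<nu> (h w)" for w
  have hJ: "h w \<in> J" if "w < k" for w using h that by (auto simp: bij_betw_def)
  have \<mu>: "0 \<le> \<mu> w" if "w < k" for w using J(3) hJ[OF that] by (simp add: \<mu>_def)
  have \<mu>1: "(\<Sum>w<k. \<mu> w) = 1"
    unfolding \<mu>_def using J(4) sum.reindex_bij_betw[OF h, of \<nu>] by simp
  have pw: "(\<Sum>w<k. \<mu> w *\<^sub>R h w) = p"
    unfolding \<mu>_def J(5)[symmetric] by (rule sum.reindex_bij_betw[OF h])
  have "\<exists>q s t. h w = (q, hout ?K q, hout ?L q, s, t) \<and> (q, s) \<in> convex hull hgraph ?K ?L \<and>
      (q, t) \<in> convex hull hgraph ?K ?L" if "w < k" for w
    using hJ[OF that] J(2) by (auto simp: split_points_def)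
  then obtain q s t where hq: "\<And>w. w < k \<Longrightarrow> h w = (q w, hout ?K (q w), hout ?L (q w), s w, t w)"
    and qs: "\<And>w. w < k \<Longrightarrow> (q w, s w) \<in> convex hull hgraph ?K ?L"
    and qt: "\<And>w. w < k \<Longrightarrow> (q w, t w) \<in> convex hull hgraph ?K ?L" by metis
  have hull: "\<exists>N0. \<forall>w<k. \<forall>N\<ge>N0. \<exists>l Q. decomposes ?K ?L N l Q (f w)"
    if f: "\<And>w. w < k \<Longrightarrow> f w \<in> convex hull hgraph ?K ?L" for f
  proof -
    obtain N0 where N0: "\<And>w N. w < k \<Longrightarrow> N0 w \<le> N \<Longrightarrow> \<exists>l Q. decomposes ?K ?L N l Q (f w)"
      using hull_hgraph_decomposes[OF f] by metis
    have "N0 w \<le> (\<Sum>w<k. N0 w)" if "w < k" for w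
      using that by (intro member_le_sum) auto
    then show ?thesis using N0 by (meson order_trans)
  qed
  obtain N1 where N1: "\<forall>w<k. \<forall>N\<ge>N1. \<exists>l Q. decomposes ?K ?L N l Q (q w, s w)"
    using hull[of "\<lambda>w. (q w, s w)", OF qs] by blast
  obtain N2 where N2: "\<forall>w<k. \<forall>N\<ge>N2. \<exists>l Q. decomposes ?K ?L N l Q (q w, t w)"
    using hull[of "\<lambda>w. (q w, t w)", OF qt] by blast
  \<comment> \<open>One alphabet size for all splittings; the extra 1 makes it positive, as residues
    modulo N require.\<close>
  define N where "N = N1 + N2 + 1"
  have N: "N1 \<le> N" "N2 \<le> N" "0 < N" by (auto simp: N_def)
  have "\<exists>\<alpha> Q. \<forall>w. w < k \<longrightarrow> decomposes ?K ?L N (\<alpha> w) (Q w) (q w, s w)"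
    by (rule choice2) (use N1 N(1) in blast)
  then obtain \<alpha> Q where "\<And>w. w < k \<Longrightarrow> decomposes ?K ?L N (\<alpha> w) (Q w) (q w, s w)" by blast
  note Q = this[unfolded decomposes_def]
  have "\<exists>\<beta> S. \<forall>w. w < k \<longrightarrow> decomposes ?K ?L N (\<beta> w) (S w) (q w, t w)"
    by (rule choice2) (use N2 N(2) in blast)
  then obtain \<beta> S where "\<And>w. w < k \<Longrightarrow> decomposes ?K ?L N (\<beta> w) (S w) (q w, t w)" by blast
  note S = this[unfolded decomposes_def]
  have sw: "(\<Sum>i<N. \<alpha> w i *\<^sub>R Q w i) = q w" "s w = (\<Sum>i<N. \<alpha> w i * hout ?K (Q w i), \<Sum>i<N. \<alpha> w i * hout ?L (Q w i))"
    if "w < k" for w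
    using arg_cong[OF Q[OF that, THEN conjunct2, THEN conjunct2], of fst]
      arg_cong[OF Q[OF that, THEN conjunct2, THEN conjunct2], of snd]
    by (simp_all add: fst_sum snd_sum sum_prod)
  have tw: "(\<Sum>i<N. \<beta> w i *\<^sub>R S w i) = q w" "t w = (\<Sum>i<N. \<beta> w i * hout ?K (S w i), \<Sum>i<N. \<beta> w i * hout ?L (S w i))"
    if "w < k" for w
    using arg_cong[OF S[OF that, THEN conjunct2, THEN conjunct2], of fst]
      arg_cong[OF S[OF that, THEN conjunct2, THEN conjunct2], of snd]
    by (simp_all add: fst_sum snd_sum sum_prod)
  have qP: "q w \<in> prob_simplex" if "w < k" for w
    unfolding sw(1)[OF that, symmetric] using Q[OF that] by (intro convex_sum convex_prob_simplex) auto
  interpret masking Ch k N \<mu> q \<alpha> \<beta> Q S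
    by unfold_locales (use Ch \<mu> \<mu>1 N qP Q S sw(1) tw(1) in auto)
  have p_eq: "p = (qbar, (\<Sum>w<k. \<mu> w * hout ?K (q w)), (\<Sum>w<k. \<mu> w * hout ?L (q w)),
      ((\<Sum>w<k. \<Sum>u<N. \<mu> w * \<alpha> w u * hout ?K (Q w u)), (\<Sum>w<k. \<Sum>u<N. \<mu> w * \<alpha> w u * hout ?L (Q w u))),
      ((\<Sum>w<k. \<Sum>v<N. \<mu> w * \<beta> w v * hout ?K (S w v)), (\<Sum>w<k. \<Sum>v<N. \<mu> w * \<beta> w v * hout ?L (S w v))))"
  proof -
    have "p = (\<Sum>w<k. \<mu> w *\<^sub>R (q w, hout ?K (q w), hout ?L (q w),
       (\<Sum>i<N. \<alpha> w i * hout ?K (Q w i), \<Sum>i<N. \<alpha> w i * hout ?L (Q w i)),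
       (\<Sum>i<N. \<beta> w i * hout ?K (S w i), \<Sum>i<N. \<beta> w i * hout ?L (S w i))))"
      unfolding pw[symmetric] by (rule sum.cong[OF refl]) (simp add: hq sw(2) tw(2))
    then show ?thesis by (simp add: sum_prod qbar_def sum_distrib_left mult.assoc)
  qed
  obtain R0 R1 R2 where R: "R = (R0, R1, R2)" by (metis surj_pair)
  show "R \<in> outer_bound Ch"
    unfolding R by (rule in_outer_bound) (use p(2) in \<open>simp only: p_eq R\<close>)
qed

section \<open>The converse\<close>

lemma eta_jensen:
  assumes I: "finite I" and u: "\<And>i. i \<in> I \<Longrightarrow> 0 \<le> u i" "(\<Sum>i\<in>I. u i) = 1"
    and r: "\<And>i. i \<in> I \<Longrightarrow> 0 \<le> r i"
  shows "(\<Sum>i\<in>I. u i * eta (r i)) \<le> eta (\<Sum>i\<in>I. u i * r i)"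
proof -
  define s where "s = (\<Sum>i\<in>I. u i * r i)"
  have s0: "0 \<le> s" unfolding s_def by (intro sum_nonneg mult_nonneg_nonneg u r)
  show ?thesis
  proof (cases "s = 0")
    case True
    have "u i * r i = 0" if "i \<in> I" for i
      by (rule sum_nonneg_0[OF I, of "\<lambda>i. u i * r i"]) (use True u r that in \<open>auto simp: s_def\<close>)
    then have "u i * eta (r i) = 0" if "i \<in> I" for i using that by (fastforce simp: eta_def)
    then have "(\<Sum>i\<in>I. u i * eta (r i)) = 0" by (intro sum.neutral) blast
    then show ?thesis using True by (simp add: s_def)
  next
    case False
    then have s: "0 < s" using s0 by simp
    \<comment> \<open>The bracket on the right is the tangent line of \<open>eta\<close> at the mean
      s, which exists because s is positive.\<close>
    have "u i * eta (r i) \<le> u i * (- (r i * log 2 s) + (s - r i) / ln 2)" if i: "i \<in> I" for i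
    proof (rule mult_left_mono[OF _ u(1)[OF i]])
      show "eta (r i) \<le> - (r i * log 2 s) + (s - r i) / ln 2"
      proof (cases "r i = 0")
        case False
        then have ri: "0 < r i" using r[OF i] by simp
        have "r i * ln (s / r i) \<le> r i * (s / r i - 1)"
          using ri s by (intro mult_left_mono ln_le_minus_one) auto
        then have "r i * (ln s - ln (r i)) \<le> s - r i"
          using ri s by (simp add: ln_div right_diff_distrib)
        then have "r i * (ln s - ln (r i)) / ln 2 \<le> (s - r i) / ln 2"
          by (rule divide_right_mono) simp
        then show ?thesis
          by (simp add: eta_def log_def diff_divide_distrib right_diff_distrib)
      qed (use s in simp)
    qed
    then have "(\<Sum>i\<in>I. u i * eta (r i)) \<le> (\<Sum>i\<in>I. u i * (- (r i * log 2 s) + (s - r i) / ln 2))"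
      by (rule sum_mono)
    also have "\<dots> = (\<Sum>i\<in>I. (u i * r i) * (- log 2 s) + (u i * s - u i * r i) / ln 2)"
      by (rule sum.cong) (auto simp: field_simps)
    also have "\<dots> = s * (- log 2 s) + (1 * s - s) / ln 2"
      unfolding sum.distrib s_def[symmetric] sum_divide_distrib[symmetric] sum_subtractf
        sum_distrib_right[symmetric] u(2) ..
    also have "\<dots> = eta s" by (simp add: eta_def)
    finally show ?thesis by (simp add: s_def)
  qed
qed

text \<open>Needed for time sharing: the average of the output entropies of the letters is at most
  the output entropy of the averaged input law.\<close>

lemma hout_jensen:
  assumes I: "finite I" and u: "\<And>i. i \<in> I \<Longrightarrow> 0 \<le> u i" "(\<Sum>i\<in>I. u i) = 1"
    and Q: "\<And>i. i \<in> I \<Longrightarrow> Q i \<in> prob_simplex" and K: "\<And>x y. 0 \<le> K x y"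
  shows "(\<Sum>i\<in>I. u i * hout K (Q i)) \<le> hout K (\<Sum>i\<in>I. u i *\<^sub>R Q i)"
proof -
  have "(\<Sum>i\<in>I. u i * hout K (Q i)) = (\<Sum>y\<in>UNIV. \<Sum>i\<in>I. u i * eta (\<Sum>x\<in>UNIV. Q i $ x * K x y))"
    unfolding hout_def sum_distrib_left by (rule sum.swap)
  also have "\<dots> \<le> (\<Sum>y\<in>UNIV. eta (\<Sum>i\<in>I. u i * (\<Sum>x\<in>UNIV. Q i $ x * K x y)))"
    by (intro sum_mono eta_jensen I u sum_nonneg mult_nonneg_nonneg K) (use Q in \<open>auto simp: prob_simplex_def\<close>)
  also have "\<dots> = hout K (\<Sum>i\<in>I. u i *\<^sub>R Q i)"
  proof -
    have "(\<Sum>i\<in>I. u i * (\<Sum>x\<in>UNIV. Q i $ x * K x y)) = (\<Sum>x\<in>UNIV. (\<Sum>i\<in>I. u i *\<^sub>R Q i) $ x * K x y)" for y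
      unfolding sum_distrib_left sum_component sum_distrib_right
      by (subst sum.swap) (simp add: mult.assoc)
    then show ?thesis by (simp add: hout_def)
  qed
  finally show ?thesis .
qed

section \<open>Splittings induced by refinements of W\<close>

context fin_pmf
begin

lemma fst_cexp: "fst (cexp A F a) = cexp A (\<lambda>\<omega>. fst (F \<omega>)) a"
  by (simp add: cexp_def fst_sum)

lemma claw_in_hull_hgraph:
  assumes "\<omega> \<in> \<Omega>" "0 < P \<omega>"
  shows "(claw A X (A \<omega>), hout K (claw A X (A \<omega>)), hout L (claw A X (A \<omega>))) \<in> convex hull hgraph K L"
  using claw_in_prob_simplex[of A "A \<omega>" X] pr_pos[OF assms, of A]
  by (intro hull_inc) (auto simp: hgraph_def)

text \<open>A and B both refine W. By the tower property, averaging the conditional laws given A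
  over a fibre of W returns the law given W, so that the averaged entropies form a splitting of it;
  the same holds for B. The outer sum over W is then a convex combination of split points.\<close>

lemma split_point_in_hull:
  fixes X :: "'o \<Rightarrow> 'x::finite" and K :: "'x \<Rightarrow> 'y::finite \<Rightarrow> real" and L :: "'x \<Rightarrow> 'z::finite \<Rightarrow> real"
  assumes A: "\<And>\<omega>. \<omega> \<in> \<Omega> \<Longrightarrow> W \<omega> = f (A \<omega>)" and B: "\<And>\<omega>. \<omega> \<in> \<Omega> \<Longrightarrow> W \<omega> = g (B \<omega>)"
  shows "((\<Sum>\<omega>\<in>\<Omega>. P \<omega> *\<^sub>R axis (X \<omega>) 1),
      (\<Sum>\<omega>\<in>\<Omega>. P \<omega> * hout K (claw W X (W \<omega>))), (\<Sum>\<omega>\<in>\<Omega>. P \<omega> * hout L (claw W X (W \<omega>))),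
      ((\<Sum>\<omega>\<in>\<Omega>. P \<omega> * hout K (claw A X (A \<omega>))), (\<Sum>\<omega>\<in>\<Omega>. P \<omega> * hout L (claw A X (A \<omega>)))),
      ((\<Sum>\<omega>\<in>\<Omega>. P \<omega> * hout K (claw B X (B \<omega>))), (\<Sum>\<omega>\<in>\<Omega>. P \<omega> * hout L (claw B X (B \<omega>)))))
    \<in> convex hull split_points K L"
proof -
  define G where "G q = (q, hout K q, hout L q)" for q
  define sA where "sA = cexp W (\<lambda>\<omega>. G (claw A X (A \<omega>)))"
  define sB where "sB = cexp W (\<lambda>\<omega>. G (claw B X (B \<omega>)))"
  define Tp where "Tp w = (claw W X w, hout K (claw W X w), hout L (claw W X w), snd (sA w), snd (sB w))" for w
  have sA: "(claw W X w, snd (sA w)) \<in> convex hull hgraph K L" if "pr W w \<noteq> 0" for w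
  proof -
    have "sA w \<in> convex hull hgraph K L"
      unfolding sA_def by (rule cexp_in_convex[OF convex_convex_hull that]) (simp only: G_def claw_in_hull_hgraph)
    moreover have "fst (sA w) = claw W X w"
      unfolding sA_def fst_cexp unfolding G_def fst_conv claw_def by (rule cexp_tower[of W f A, OF A])
    ultimately show ?thesis by (metis prod.collapse)
  qed
  have sB: "(claw W X w, snd (sB w)) \<in> convex hull hgraph K L" if "pr W w \<noteq> 0" for w
  proof -
    have "sB w \<in> convex hull hgraph K L"
      unfolding sB_def by (rule cexp_in_convex[OF convex_convex_hull that]) (simp only: G_def claw_in_hull_hgraph)
    moreover have "fst (sB w) = claw W X w"
      unfolding sB_def fst_cexp unfolding G_def fst_conv claw_def by (rule cexp_tower[of W g B, OF B])
    ultimately show ?thesis by (metis prod.collapse)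
  qed
  have "(\<Sum>\<omega>\<in>\<Omega>. P \<omega> *\<^sub>R Tp (W \<omega>)) \<in> convex hull split_points K L"
  proof (rule convex_sum_pos[OF fin convex_convex_hull total nonneg])
    fix \<omega> assume \<omega>: "\<omega> \<in> \<Omega>" "0 < P \<omega>"
    then have "pr W (W \<omega>) \<noteq> 0" using pr_pos[of \<omega> W] by simp
    then show "Tp (W \<omega>) \<in> convex hull split_points K L"
      using sA sB unfolding Tp_def split_points_def by (intro hull_inc) blast
  qed
  also have "(\<Sum>\<omega>\<in>\<Omega>. P \<omega> *\<^sub>R Tp (W \<omega>)) = ((\<Sum>\<omega>\<in>\<Omega>. P \<omega> *\<^sub>R claw W X (W \<omega>)),
      (\<Sum>\<omega>\<in>\<Omega>. P \<omega> * hout K (claw W X (W \<omega>))), (\<Sum>\<omega>\<in>\<Omega>. P \<omega> * hout L (claw W X (W \<omega>))),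
      snd (\<Sum>\<omega>\<in>\<Omega>. P \<omega> *\<^sub>R sA (W \<omega>)), snd (\<Sum>\<omega>\<in>\<Omega>. P \<omega> *\<^sub>R sB (W \<omega>)))"
    by (simp add: Tp_def sum_prod snd_sum)
  also have "(\<Sum>\<omega>\<in>\<Omega>. P \<omega> *\<^sub>R claw W X (W \<omega>)) = (\<Sum>\<omega>\<in>\<Omega>. P \<omega> *\<^sub>R axis (X \<omega>) 1)"
    unfolding claw_def by (rule expectation_cexp)
  also have "(\<Sum>\<omega>\<in>\<Omega>. P \<omega> *\<^sub>R sA (W \<omega>)) = (\<Sum>\<omega>\<in>\<Omega>. P \<omega> *\<^sub>R G (claw A X (A \<omega>)))"
    unfolding sA_def by (rule expectation_cexp)
  also have "(\<Sum>\<omega>\<in>\<Omega>. P \<omega> *\<^sub>R sB (W \<omega>)) = (\<Sum>\<omega>\<in>\<Omega>. P \<omega> *\<^sub>R G (claw B X (B \<omega>)))"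
    unfolding sB_def by (rule expectation_cexp)
  finally show ?thesis by (simp add: G_def sum_prod)
qed

end

section \<open>Memoryless outputs\<close>

definition lists_of :: "nat \<Rightarrow> 'a list set" where
  "lists_of n = {ys. length ys = n}"

lemma finite_lists_of: "finite (lists_of n :: 'a::finite list set)"
  using finite_lists_length_eq[of "UNIV :: 'a set" n] by (simp add: lists_of_def)

lemma lists_of_Suc: "lists_of (Suc n) = (\<lambda>(y, ys). y # ys) ` (UNIV \<times> lists_of n)"
  by (auto simp: lists_of_def image_iff length_Suc_conv)

lemma sum_lists_of_Suc:
  fixes F :: "'a::finite list \<Rightarrow> real"
  shows "sum F (lists_of (Suc n)) = (\<Sum>y\<in>UNIV. \<Sum>ys\<in>lists_of n. F (y # ys))"
  unfolding lists_of_Suc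
  by (subst sum.reindex) (auto simp: inj_on_def sum.cartesian_product case_prod_unfold)

lemma sum_chan_prob:
  fixes Ch :: "'x::finite \<Rightarrow> 'y::finite \<Rightarrow> 'z::finite \<Rightarrow> real"
  assumes Ch: "dm_bc Ch"
  shows "(\<Sum>ys\<in>lists_of (length xs). \<Sum>zs\<in>lists_of (length xs). chan_prob Ch xs ys zs) = 1"
proof (induction xs)
  case Nil
  then show ?case by (simp add: lists_of_def chan_prob_def)
next
  case (Cons x xs)
  let ?n = "length xs"
  have "chan_prob Ch (x # xs) (y # ys) (z # zs) = Ch x y z * chan_prob Ch xs ys zs" for y ys z zs
    by (simp add: chan_prob_def prod.lessThan_Suc_shift del: prod.lessThan_Suc)
  then have "(\<Sum>ys\<in>lists_of (length (x # xs)). \<Sum>zs\<in>lists_of (length (x # xs)). chan_prob Ch (x # xs) ys zs)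
      = (\<Sum>y\<in>UNIV. \<Sum>ys\<in>lists_of ?n. \<Sum>z\<in>UNIV. \<Sum>zs\<in>lists_of ?n. Ch x y z * chan_prob Ch xs ys zs)"
    by (simp add: sum_lists_of_Suc)
  also have "\<dots> = (\<Sum>y\<in>UNIV. \<Sum>z\<in>UNIV. \<Sum>ys\<in>lists_of ?n. \<Sum>zs\<in>lists_of ?n. Ch x y z * chan_prob Ch xs ys zs)"
    by (rule sum.cong[OF refl], rule sum.swap)
  also have "\<dots> = 1"
    by (simp add: Cons dm_bcD(2)[OF Ch] flip: sum_distrib_left)
  finally show ?case .
qed

text \<open>The i-th channel factor splits off the product. The remaining weight \<open>g\<close>
  ignores the i-th letters, so overwriting them shows that its sum is the same over every choice of
  (y, z), while the split factor sums to 1.\<close>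

lemma sum_single_letter:
  fixes Ch :: "'x::finite \<Rightarrow> 'y::finite \<Rightarrow> 'z::finite \<Rightarrow> real" and F :: "'y list \<times> 'z list \<Rightarrow> real"
  assumes Ch: "dm_bc Ch" and n: "length xs = n" and i: "i < n"
    and F: "\<And>ys zs y z. length ys = n \<Longrightarrow> length zs = n \<Longrightarrow> F (ys[i := y], zs[i := z]) = F (ys, zs)"
  shows "(\<Sum>p\<in>{p \<in> lists_of n \<times> lists_of n. fst p ! i = y \<and> snd p ! i = z}. chan_prob Ch xs (fst p) (snd p) * F p)
     = (\<Sum>p\<in>lists_of n \<times> lists_of n. chan_prob Ch xs (fst p) (snd p) * F p) * Ch (xs ! i) y z"
proof -
  define g where "g p = (\<Prod>j\<in>{..<n} - {i}. Ch (xs ! j) (fst p ! j) (snd p ! j)) * F p" for p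
  define Fib :: "'y \<times> 'z \<Rightarrow> ('y list \<times> 'z list) set"
    where "Fib c = {p \<in> lists_of n \<times> lists_of n. (fst p ! i, snd p ! i) = c}" for c
  have cg: "chan_prob Ch xs (fst p) (snd p) * F p = Ch (xs ! i) (fst p ! i) (snd p ! i) * g p" for p
    unfolding chan_prob_def g_def n using i by (subst prod.remove[of _ i]) auto
  have D: "sum g (Fib c) = sum g (Fib c')" for c c'
  proof (rule sum.reindex_bij_witness[of _ "\<lambda>p. ((fst p)[i := fst c], (snd p)[i := snd c])" "\<lambda>p. ((fst p)[i := fst c'], (snd p)[i := snd c'])"])
    fix p assume p: "p \<in> Fib c"
    show "g ((fst p)[i := fst c'], (snd p)[i := snd c']) = g p"
      using p F[of "fst p" "snd p"] by (auto simp: g_def Fib_def lists_of_def intro!: prod.cong)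
  qed (use i in \<open>auto simp: Fib_def lists_of_def\<close>)
  have S: "(\<Sum>p\<in>Fib c. chan_prob Ch xs (fst p) (snd p) * F p) = Ch (xs ! i) (fst c) (snd c) * sum g (Fib c)" for c
    unfolding sum_distrib_left by (rule sum.cong) (auto simp: cg Fib_def)
  have "(\<Sum>p\<in>lists_of n \<times> lists_of n. chan_prob Ch xs (fst p) (snd p) * F p)
      = (\<Sum>c\<in>UNIV. \<Sum>p\<in>Fib c. chan_prob Ch xs (fst p) (snd p) * F p)"
    unfolding Fib_def by (rule sum.group[symmetric]) (auto simp: finite_lists_of)
  also have "\<dots> = (\<Sum>c\<in>UNIV. Ch (xs ! i) (fst c) (snd c)) * sum g (Fib (y, z))"
    unfolding S sum_distrib_right by (rule sum.cong[OF refl]) (use D in metis)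
  also have "(\<Sum>c\<in>UNIV. Ch (xs ! i) (fst c) (snd c)) = 1"
    using dm_bcD(2)[OF Ch, of "xs ! i"] by (simp add: sum.cartesian_product case_prod_unfold)
  finally show ?thesis using S[of "(y, z)"] by (simp add: Fib_def)
qed

section \<open>The joint law of messages and outputs of a code\<close>

locale bc_code =
  fixes Ch :: "'x::finite \<Rightarrow> 'y::finite \<Rightarrow> 'z::finite \<Rightarrow> real"
    and n s0 s1 s2 :: nat and enc :: "nat \<Rightarrow> nat \<Rightarrow> nat \<Rightarrow> 'x list"
  assumes Ch: "dm_bc Ch" and s: "0 < s0" "0 < s1" "0 < s2"
    and len: "\<And>m0 m1 m2. m0 < s0 \<Longrightarrow> m1 < s1 \<Longrightarrow> m2 < s2 \<Longrightarrow> length (enc m0 m1 m2) = n"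
begin

definition Msg :: "(nat \<times> nat \<times> nat) set" where "Msg = {..<s0} \<times> {..<s1} \<times> {..<s2}"

definition Out :: "('y list \<times> 'z list) set" where "Out = lists_of n \<times> lists_of n"

definition cw :: "nat \<times> nat \<times> nat \<Rightarrow> 'x list" where "cw = (\<lambda>(m0, m1, m2). enc m0 m1 m2)"

definition Pc :: "(nat \<times> nat \<times> nat) \<times> 'y list \<times> 'z list \<Rightarrow> real" where
  "Pc \<omega> = chan_prob Ch (cw (fst \<omega>)) (fst (snd \<omega>)) (snd (snd \<omega>)) / real (s0 * s1 * s2)"

lemma len_cw: "m \<in> Msg \<Longrightarrow> length (cw m) = n" by (auto simp: Msg_def cw_def len)

lemma finite_Msg: "finite Msg" by (simp add: Msg_def)
lemma finite_Out: "finite Out" by (simp add: Out_def finite_lists_of)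
lemma card_Msg: "card Msg = s0 * s1 * s2" by (simp add: Msg_def card_cartesian_product)

lemma sum_Out: "m \<in> Msg \<Longrightarrow> (\<Sum>p\<in>Out. Pc (m, p)) = 1 / real (s0 * s1 * s2)"
proof -
  assume "m \<in> Msg"
  then have "(\<Sum>p\<in>Out. chan_prob Ch (cw m) (fst p) (snd p)) = 1"
    using sum_chan_prob[OF Ch, of "cw m"]
    by (simp add: Out_def len_cw sum.cartesian_product case_prod_unfold)
  then show ?thesis by (simp add: Pc_def flip: sum_divide_distrib)
qed

lemma sum_Msg_Out: "sum F (Msg \<times> Out) = (\<Sum>m\<in>Msg. \<Sum>p\<in>Out. F (m, p))" for F :: "_ \<Rightarrow> real"
  by (simp add: sum.cartesian_product)

sublocale fin_pmf "Msg \<times> Out" Pc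
proof
  show "finite (Msg \<times> Out)" by (simp add: finite_Msg finite_Out)
  show "0 \<le> Pc \<omega>" for \<omega>
    unfolding Pc_def chan_prob_def by (intro divide_nonneg_nonneg prod_nonneg dm_bcD(1)[OF Ch]) auto
  have "sum Pc (Msg \<times> Out) = (\<Sum>m\<in>Msg. \<Sum>p\<in>Out. Pc (m, p))"
    by (rule sum_Msg_Out)
  also have "\<dots> = 1" using s by (simp add: sum_Out card_Msg)
  finally show "sum Pc (Msg \<times> Out) = 1" .
qed

definition Xi :: "nat \<Rightarrow> (nat \<times> nat \<times> nat) \<times> 'y list \<times> 'z list \<Rightarrow> 'x" where "Xi i \<omega> = cw (fst \<omega>) ! i"
definition Yi :: "nat \<Rightarrow> (nat \<times> nat \<times> nat) \<times> 'y list \<times> 'z list \<Rightarrow> 'y" where "Yi i \<omega> = fst (snd \<omega>) ! i"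
definition Zi :: "nat \<Rightarrow> (nat \<times> nat \<times> nat) \<times> 'y list \<times> 'z list \<Rightarrow> 'z" where "Zi i \<omega> = snd (snd \<omega>) ! i"
definition Yn :: "(nat \<times> nat \<times> nat) \<times> 'y list \<times> 'z list \<Rightarrow> 'y list" where "Yn \<omega> = fst (snd \<omega>)"
definition Zn :: "(nat \<times> nat \<times> nat) \<times> 'y list \<times> 'z list \<Rightarrow> 'z list" where "Zn \<omega> = snd (snd \<omega>)"

text \<open>A does not read the i-th letter of either output word. For such A the chain from A
  through the i-th input to the i-th outputs is Markov.\<close>

definition free_at :: "nat \<Rightarrow> ((nat \<times> nat \<times> nat) \<times> 'y list \<times> 'z list \<Rightarrow> 'a) \<Rightarrow> bool" where
  "free_at i A \<longleftrightarrow> (\<forall>m ys zs y z. length ys = n \<longrightarrow> length zs = n \<longrightarrow> A (m, ys[i := y], zs[i := z]) = A (m, ys, zs))"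

lemma pr_channel:
  assumes i: "i < n" and A: "free_at i A"
  shows "pr (\<lambda>\<omega>. (A \<omega>, Xi i \<omega>, Yi i \<omega>, Zi i \<omega>)) (a, x, y, z) = pr (\<lambda>\<omega>. (A \<omega>, Xi i \<omega>)) (a, x) * Ch x y z"
proof -
  have inv: "A (m, ys[i := y], zs[i := z]) = A (m, ys, zs)" if "length ys = n" "length zs = n" for m ys zs y z
    using A that unfolding free_at_def by blast
  let ?F = "\<lambda>m p. (if A (m, p) = a \<and> cw m ! i = x then 1 else 0) / real (s0 * s1 * s2)"
  have "(\<Sum>p\<in>Out. if (A (m, p), Xi i (m, p), Yi i (m, p), Zi i (m, p)) = (a, x, y, z) then Pc (m, p) else 0)
      = (\<Sum>p\<in>Out. if (A (m, p), Xi i (m, p)) = (a, x) then Pc (m, p) else 0) * Ch x y z" if m: "m \<in> Msg" for m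
  proof -
    have "(\<Sum>p\<in>Out. if (A (m, p), Xi i (m, p), Yi i (m, p), Zi i (m, p)) = (a, x, y, z) then Pc (m, p) else 0)
      = (\<Sum>p\<in>Out. if fst p ! i = y \<and> snd p ! i = z then chan_prob Ch (cw m) (fst p) (snd p) * ?F m p else 0)"
      by (rule sum.cong) (auto simp: Xi_def Yi_def Zi_def Pc_def)
    also have "\<dots> = (\<Sum>p\<in>{p \<in> Out. fst p ! i = y \<and> snd p ! i = z}. chan_prob Ch (cw m) (fst p) (snd p) * ?F m p)"
      by (rule sum.inter_filter[OF finite_Out, symmetric])
    also have "\<dots> = (\<Sum>p\<in>Out. chan_prob Ch (cw m) (fst p) (snd p) * ?F m p) * Ch (cw m ! i) y z"
      unfolding Out_def by (rule sum_single_letter[OF Ch len_cw[OF m] i]) (simp add: inv)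
    also have "\<dots> = (\<Sum>p\<in>Out. if (A (m, p), Xi i (m, p)) = (a, x) then Pc (m, p) else 0) * Ch x y z"
      unfolding sum_distrib_right by (rule sum.cong) (auto simp: Xi_def Pc_def)
    finally show ?thesis .
  qed
  then show ?thesis
    unfolding pr_if sum_Msg_Out by (simp add: sum_distrib_right)
qed

lemma cond_ent_letter:
  assumes i: "i < n" and A: "free_at i A"
  shows "ent (\<lambda>\<omega>. (A \<omega>, Yi i \<omega>)) - ent A = (\<Sum>\<omega>\<in>Msg \<times> Out. Pc \<omega> * hout (chY Ch) (claw A (Xi i) (A \<omega>)))"
    and "ent (\<lambda>\<omega>. (A \<omega>, Zi i \<omega>)) - ent A = (\<Sum>\<omega>\<in>Msg \<times> Out. Pc \<omega> * hout (chZ Ch) (claw A (Xi i) (A \<omega>)))"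
proof -
  have "pr (\<lambda>\<omega>. (A \<omega>, Xi i \<omega>, Yi i \<omega>)) (a, x, y) = pr (\<lambda>\<omega>. (A \<omega>, Xi i \<omega>)) (a, x) * chY Ch x y" for a x y
  proof -
    have "pr (\<lambda>\<omega>. (A \<omega>, Xi i \<omega>, Yi i \<omega>)) (a, x, y)
        = (\<Sum>z\<in>UNIV. pr (\<lambda>\<omega>. (Zi i \<omega>, A \<omega>, Xi i \<omega>, Yi i \<omega>)) (z, a, x, y))"
      by (rule pr_marginal[symmetric]) auto
    also have "\<dots> = (\<Sum>z\<in>UNIV. pr (\<lambda>\<omega>. (A \<omega>, Xi i \<omega>, Yi i \<omega>, Zi i \<omega>)) (a, x, y, z))"
      by (intro sum.cong refl pr_inj) auto
    finally show ?thesis by (simp add: pr_channel[OF i A] chY_def sum_distrib_left)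
  qed
  from cond_ent_channel[OF this claw_nth]
  show "ent (\<lambda>\<omega>. (A \<omega>, Yi i \<omega>)) - ent A = (\<Sum>\<omega>\<in>Msg \<times> Out. Pc \<omega> * hout (chY Ch) (claw A (Xi i) (A \<omega>)))" .
  have "pr (\<lambda>\<omega>. (A \<omega>, Xi i \<omega>, Zi i \<omega>)) (a, x, z) = pr (\<lambda>\<omega>. (A \<omega>, Xi i \<omega>)) (a, x) * chZ Ch x z" for a x z
  proof -
    have "pr (\<lambda>\<omega>. (A \<omega>, Xi i \<omega>, Zi i \<omega>)) (a, x, z)
        = (\<Sum>y\<in>UNIV. pr (\<lambda>\<omega>. (Yi i \<omega>, A \<omega>, Xi i \<omega>, Zi i \<omega>)) (y, a, x, z))"
      by (rule pr_marginal[symmetric]) auto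
    also have "\<dots> = (\<Sum>y\<in>UNIV. pr (\<lambda>\<omega>. (A \<omega>, Xi i \<omega>, Yi i \<omega>, Zi i \<omega>)) (a, x, y, z))"
      by (intro sum.cong refl pr_inj) auto
    finally show ?thesis by (simp add: pr_channel[OF i A] chZ_def sum_distrib_left)
  qed
  from cond_ent_channel[OF this claw_nth]
  show "ent (\<lambda>\<omega>. (A \<omega>, Zi i \<omega>)) - ent A = (\<Sum>\<omega>\<in>Msg \<times> Out. Pc \<omega> * hout (chZ Ch) (claw A (Xi i) (A \<omega>)))" .
qed

lemma out_length: "\<omega> \<in> Msg \<times> Out \<Longrightarrow> length (Yn \<omega>) = n \<and> length (Zn \<omega>) = n"
  by (auto simp: Out_def lists_of_def Yn_def Zn_def)

lemma Yi_Yn: "Yi i \<omega> = Yn \<omega> ! i" and Zi_Zn: "Zi i \<omega> = Zn \<omega> ! i"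
  by (simp_all add: Yi_def Yn_def Zi_def Zn_def)

section \<open>Single-letter entropies of a code\<close>

lemma take_Suc_eq_iff:
  "i < length xs \<Longrightarrow> i < length ys \<Longrightarrow> take (Suc i) xs = take (Suc i) ys \<longleftrightarrow> take i xs = take i ys \<and> xs ! i = ys ! i"
  by (auto simp: take_Suc_conv_app_nth)

lemma drop_eq_iff:
  "i < length xs \<Longrightarrow> i < length ys \<Longrightarrow> drop i xs = drop i ys \<longleftrightarrow> drop (Suc i) xs = drop (Suc i) ys \<and> xs ! i = ys ! i"
  by (auto simp: Cons_nth_drop_Suc[symmetric])

text \<open>\<open>Aux B i\<close> is \<open>W\<^sub>i\<close>, \<open>(U, W\<^sub>i)\<close>, \<open>(V, W\<^sub>i)\<close> for \<open>B = M\<^sub>0\<close>, \<open>(M\<^sub>0, M\<^sub>1)\<close>, \<open>(M\<^sub>0, M\<^sub>2)\<close>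
  (letters are indexed from 0).\<close>

definition Aux :: "((nat \<times> nat \<times> nat) \<Rightarrow> 'b) \<Rightarrow> nat \<Rightarrow> (nat \<times> nat \<times> nat) \<times> 'y list \<times> 'z list \<Rightarrow> 'b \<times> 'y list \<times> 'z list" where
  "Aux B i \<omega> = (B (fst \<omega>), take i (Yn \<omega>), drop (Suc i) (Zn \<omega>))"

definition CY :: "((nat \<times> nat \<times> nat) \<Rightarrow> 'b) \<Rightarrow> nat \<Rightarrow> real" where
  "CY B i = ent (\<lambda>\<omega>. (Aux B i \<omega>, Yi i \<omega>)) - ent (Aux B i)"

definition CZ :: "((nat \<times> nat \<times> nat) \<Rightarrow> 'b) \<Rightarrow> nat \<Rightarrow> real" where
  "CZ B i = ent (\<lambda>\<omega>. (Aux B i \<omega>, Zi i \<omega>)) - ent (Aux B i)"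

lemma free_at_Aux: "free_at i (Aux B i)"
  by (auto simp: free_at_def Aux_def Yn_def Zn_def)

text \<open>Dropping the later letters of Z from the conditioning can only increase the entropy of
  the i-th letter of Y.\<close>

lemma CY_le:
  assumes i: "i < n"
  shows "CY B i \<le> ent (\<lambda>\<omega>. (B (fst \<omega>), take (Suc i) (Yn \<omega>))) - ent (\<lambda>\<omega>. (B (fst \<omega>), take i (Yn \<omega>)))"
proof -
  let ?C = "\<lambda>\<omega>. (B (fst \<omega>), take i (Yn \<omega>))" and ?D = "\<lambda>\<omega>. drop (Suc i) (Zn \<omega>)"
  have "ent (\<lambda>\<omega>. (Yi i \<omega>, ?D \<omega>, ?C \<omega>)) = ent (\<lambda>\<omega>. (Aux B i \<omega>, Yi i \<omega>))"
    "ent (\<lambda>\<omega>. (?D \<omega>, ?C \<omega>)) = ent (Aux B i)"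
    by (rule ent_kernel; auto simp: Aux_def)+
  moreover have "ent (\<lambda>\<omega>. (Yi i \<omega>, ?C \<omega>)) = ent (\<lambda>\<omega>. (B (fst \<omega>), take (Suc i) (Yn \<omega>)))"
    by (rule ent_kernel) (use i out_length in \<open>auto simp: take_Suc_eq_iff Yi_Yn\<close>)
  ultimately show ?thesis using ent_submodular[of "Yi i" ?D ?C] by (simp add: CY_def)
qed

lemma CZ_le:
  assumes i: "i < n"
  shows "CZ B i \<le> ent (\<lambda>\<omega>. (B (fst \<omega>), drop i (Zn \<omega>))) - ent (\<lambda>\<omega>. (B (fst \<omega>), drop (Suc i) (Zn \<omega>)))"
proof -
  let ?C = "\<lambda>\<omega>. (B (fst \<omega>), drop (Suc i) (Zn \<omega>))" and ?D = "\<lambda>\<omega>. take i (Yn \<omega>)"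
  have "ent (\<lambda>\<omega>. (Zi i \<omega>, ?D \<omega>, ?C \<omega>)) = ent (\<lambda>\<omega>. (Aux B i \<omega>, Zi i \<omega>))"
    "ent (\<lambda>\<omega>. (?D \<omega>, ?C \<omega>)) = ent (Aux B i)"
    by (rule ent_kernel; auto simp: Aux_def)+
  moreover have "ent (\<lambda>\<omega>. (Zi i \<omega>, ?C \<omega>)) = ent (\<lambda>\<omega>. (B (fst \<omega>), drop i (Zn \<omega>)))"
    by (rule ent_kernel) (use i out_length in \<open>auto simp: drop_eq_iff[of i] Zi_Zn\<close>)
  ultimately show ?thesis using ent_submodular[of "Zi i" ?D ?C] by (simp add: CZ_def)
qed

lemma ent_take_0: "ent (\<lambda>\<omega>. (B (fst \<omega>), take 0 (Yn \<omega>))) = ent (\<lambda>\<omega>. B (fst \<omega>))"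
  and ent_take_n: "ent (\<lambda>\<omega>. (B (fst \<omega>), take n (Yn \<omega>))) = ent (\<lambda>\<omega>. (B (fst \<omega>), Yn \<omega>))"
  and ent_drop_n: "ent (\<lambda>\<omega>. (B (fst \<omega>), drop n (Zn \<omega>))) = ent (\<lambda>\<omega>. B (fst \<omega>))"
  by (rule ent_kernel; use out_length in auto)+

lemma sum_CY_le: "(\<Sum>i<n. CY B i) \<le> ent (\<lambda>\<omega>. (B (fst \<omega>), Yn \<omega>)) - ent (\<lambda>\<omega>. B (fst \<omega>))"
proof -
  have "(\<Sum>i<n. CY B i) \<le> (\<Sum>i<n. ent (\<lambda>\<omega>. (B (fst \<omega>), take (Suc i) (Yn \<omega>))) - ent (\<lambda>\<omega>. (B (fst \<omega>), take i (Yn \<omega>))))"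
    by (rule sum_mono) (simp add: CY_le)
  also have "\<dots> = ent (\<lambda>\<omega>. (B (fst \<omega>), take n (Yn \<omega>))) - ent (\<lambda>\<omega>. (B (fst \<omega>), take 0 (Yn \<omega>)))"
    by (rule sum_lessThan_telescope)
  finally show ?thesis by (simp only: ent_take_0 ent_take_n)
qed

text \<open>The chain rule is run from the last letter backwards, because \<open>Aux\<close>
  contains the later letters of Z.\<close>

lemma sum_CZ_le: "(\<Sum>i<n. CZ B i) \<le> ent (\<lambda>\<omega>. (B (fst \<omega>), Zn \<omega>)) - ent (\<lambda>\<omega>. B (fst \<omega>))"
proof -
  have "(\<Sum>i<n. CZ B i) \<le> (\<Sum>i<n. ent (\<lambda>\<omega>. (B (fst \<omega>), drop i (Zn \<omega>))) - ent (\<lambda>\<omega>. (B (fst \<omega>), drop (Suc i) (Zn \<omega>))))"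
    by (rule sum_mono) (simp add: CZ_le)
  also have "\<dots> = ent (\<lambda>\<omega>. (B (fst \<omega>), drop 0 (Zn \<omega>))) - ent (\<lambda>\<omega>. (B (fst \<omega>), drop n (Zn \<omega>)))"
    by (rule sum_lessThan_telescope')
  finally show ?thesis by (simp add: ent_drop_n)
qed

text \<open>In the difference \<open>ent (Aux B i)\<close> cancels. Adjoining the i-th letter of Z
  to \<open>Aux B i\<close> extends the suffix and gives \<open>G i\<close>; adjoining the i-th
  letter of Y extends the prefix and gives \<open>G (Suc i)\<close>.\<close>

lemma csiszar_sum: "(\<Sum>i<n. CZ B i - CY B i) = ent (\<lambda>\<omega>. (B (fst \<omega>), Zn \<omega>)) - ent (\<lambda>\<omega>. (B (fst \<omega>), Yn \<omega>))"
proof -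
  define G where "G i = ent (\<lambda>\<omega>. (B (fst \<omega>), take i (Yn \<omega>), drop i (Zn \<omega>)))" for i
  have "CZ B i - CY B i = G i - G (Suc i)" if i: "i < n" for i
  proof -
    have "ent (\<lambda>\<omega>. (Aux B i \<omega>, Zi i \<omega>)) = G i" "ent (\<lambda>\<omega>. (Aux B i \<omega>, Yi i \<omega>)) = G (Suc i)"
      unfolding G_def
      by (rule ent_kernel; use i out_length in \<open>auto simp: Aux_def drop_eq_iff[of i] take_Suc_eq_iff Zi_Zn Yi_Yn\<close>)+
    then show ?thesis by (simp add: CZ_def CY_def)
  qed
  then have "(\<Sum>i<n. CZ B i - CY B i) = (\<Sum>i<n. G i - G (Suc i))" by simp
  also have "\<dots> = G 0 - G n" by (rule sum_lessThan_telescope')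
  also have "G 0 = ent (\<lambda>\<omega>. (B (fst \<omega>), Zn \<omega>))"
    unfolding G_def by (rule ent_kernel) auto
  also have "G n = ent (\<lambda>\<omega>. (B (fst \<omega>), Yn \<omega>))"
    unfolding G_def by (rule ent_kernel) (use out_length in auto)
  finally show ?thesis .
qed

lemma ent_Yn_le: "ent Yn \<le> (\<Sum>i<n. ent (Yi i))"
proof -
  define E where "E i = ent (\<lambda>\<omega>. take i (Yn \<omega>))" for i
  have "E (Suc i) - E i \<le> ent (Yi i)" if i: "i < n" for i
  proof -
    have "E (Suc i) = ent (\<lambda>\<omega>. (take i (Yn \<omega>), Yi i \<omega>))"
      unfolding E_def by (rule ent_kernel) (use i out_length in \<open>auto simp: take_Suc_eq_iff Yi_Yn\<close>)
    then show ?thesis using ent_subadditive[of "\<lambda>\<omega>. take i (Yn \<omega>)" "Yi i"] by (simp add: E_def)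
  qed
  then have "(\<Sum>i<n. E (Suc i) - E i) \<le> (\<Sum>i<n. ent (Yi i))" by (intro sum_mono) auto
  moreover have "(\<Sum>i<n. E (Suc i) - E i) = E n - E 0" by (rule sum_lessThan_telescope)
  moreover have "E n = ent Yn" unfolding E_def by (rule ent_kernel) (use out_length in auto)
  moreover have "E 0 = 0" by (simp add: E_def)
  ultimately show ?thesis by simp
qed

lemma ent_Zn_le: "ent Zn \<le> (\<Sum>i<n. ent (Zi i))"
proof -
  define E where "E i = ent (\<lambda>\<omega>. take i (Zn \<omega>))" for i
  have "E (Suc i) - E i \<le> ent (Zi i)" if i: "i < n" for i
  proof -
    have "E (Suc i) = ent (\<lambda>\<omega>. (take i (Zn \<omega>), Zi i \<omega>))"
      unfolding E_def by (rule ent_kernel) (use i out_length in \<open>auto simp: take_Suc_eq_iff Zi_Zn\<close>)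
    then show ?thesis using ent_subadditive[of "\<lambda>\<omega>. take i (Zn \<omega>)" "Zi i"] by (simp add: E_def)
  qed
  then have "(\<Sum>i<n. E (Suc i) - E i) \<le> (\<Sum>i<n. ent (Zi i))" by (intro sum_mono) auto
  moreover have "(\<Sum>i<n. E (Suc i) - E i) = E n - E 0" by (rule sum_lessThan_telescope)
  moreover have "E n = ent Zn" unfolding E_def by (rule ent_kernel) (use out_length in auto)
  moreover have "E 0 = 0" by (simp add: E_def)
  ultimately show ?thesis by simp
qed

definition qi :: "nat \<Rightarrow> real^'x" where
  "qi i = (\<Sum>\<omega>\<in>Msg \<times> Out. Pc \<omega> *\<^sub>R axis (Xi i \<omega>) 1)"

lemma qi_simplex: "qi i \<in> prob_simplex"
  unfolding qi_def by (rule convex_sum_pos[OF fin convex_prob_simplex total nonneg]) (auto simp: axis_in_prob_simplex)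

lemma ent_letter:
  assumes "i < n"
  shows "ent (Yi i) = hout (chY Ch) (qi i)" "ent (Zi i) = hout (chZ Ch) (qi i)"
proof -
  let ?c = "\<lambda>\<omega>::(nat \<times> nat \<times> nat) \<times> 'y list \<times> 'z list. ()"
  have "free_at i ?c" by (simp add: free_at_def)
  note ce = cond_ent_letter[OF assms this]
  have "pr ?c () = 1" using total by (simp add: pr_def)
  then have "claw ?c (Xi i) () = qi i" by (simp add: claw_def cexp_def qi_def)
  moreover have "ent (\<lambda>\<omega>. ((), Yi i \<omega>)) = ent (Yi i)" "ent (\<lambda>\<omega>. ((), Zi i \<omega>)) = ent (Zi i)"
    by (rule ent_kernel; simp)+
  ultimately show "ent (Yi i) = hout (chY Ch) (qi i)" "ent (Zi i) = hout (chZ Ch) (qi i)"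
    using ce total by (simp_all flip: sum_distrib_right)
qed

lemma sum_hrow: "(\<Sum>x\<in>UNIV. qi i $ x * hrow K x) = (\<Sum>\<omega>\<in>Msg \<times> Out. Pc \<omega> * hrow K (Xi i \<omega>))"
proof -
  have "(\<Sum>x\<in>UNIV. qi i $ x * hrow K x) = (\<Sum>\<omega>\<in>Msg \<times> Out. \<Sum>x\<in>UNIV. Pc \<omega> * (axis (Xi i \<omega>) 1 $ x * hrow K x))"
    unfolding qi_def sum_component sum_distrib_right by (subst sum.swap) (simp add: mult.assoc)
  also have "\<dots> = (\<Sum>\<omega>\<in>Msg \<times> Out. Pc \<omega> * hrow K (Xi i \<omega>))"
  proof (rule sum.cong[OF refl])
    fix \<omega>
    have "(\<Sum>x\<in>UNIV. axis (Xi i \<omega>) (1::real) $ x * hrow K x) = (\<Sum>x\<in>UNIV. if x = Xi i \<omega> then hrow K x else 0)"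
      by (rule sum.cong) (auto simp: axis_def)
    then show "(\<Sum>x\<in>UNIV. Pc \<omega> * (axis (Xi i \<omega>) 1 $ x * hrow K x)) = Pc \<omega> * hrow K (Xi i \<omega>)"
      by (simp flip: sum_distrib_left)
  qed
  finally show ?thesis .
qed

text \<open>The messages fix the codeword, so the i-th input is constant on the fibre.\<close>

lemma claw_full:
  assumes "\<omega> \<in> Msg \<times> Out" "0 < Pc \<omega>"
  shows "claw (Aux (\<lambda>m. m) i) (Xi i) (Aux (\<lambda>m. m) i \<omega>) = axis (Xi i \<omega>) 1"
proof -
  let ?A = "Aux (\<lambda>m. m) i"
  have "claw ?A (Xi i) (?A \<omega>) \<in> {axis (Xi i \<omega>) 1}"
    unfolding claw_def
    by (rule cexp_in_convex) (use pr_pos[OF assms, of ?A] in \<open>auto simp: Aux_def Xi_def\<close>)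
  then show ?thesis by simp
qed

lemma C_full:
  assumes i: "i < n"
  shows "CY (\<lambda>m. m) i = (\<Sum>x\<in>UNIV. qi i $ x * hrow (chY Ch) x)"
    "CZ (\<lambda>m. m) i = (\<Sum>x\<in>UNIV. qi i $ x * hrow (chZ Ch) x)"
proof -
  have "(\<Sum>\<omega>\<in>Msg \<times> Out. Pc \<omega> * hout K (claw (Aux (\<lambda>m. m) i) (Xi i) (Aux (\<lambda>m. m) i \<omega>)))
      = (\<Sum>x\<in>UNIV. qi i $ x * hrow K x)" for K :: "'x \<Rightarrow> 'k::finite \<Rightarrow> real"
    unfolding sum_hrow
  proof (rule sum.cong[OF refl])
    fix \<omega> assume \<omega>: "\<omega> \<in> Msg \<times> Out"
    show "Pc \<omega> * hout K (claw (Aux (\<lambda>m. m) i) (Xi i) (Aux (\<lambda>m. m) i \<omega>)) = Pc \<omega> * hrow K (Xi i \<omega>)"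
    proof (cases "Pc \<omega> = 0")
      case False
      then have "0 < Pc \<omega>" using nonneg[OF \<omega>] by simp
      from claw_full[OF \<omega> this] show ?thesis by (simp add: hout_axis)
    qed simp
  qed
  note h = this
  show "CY (\<lambda>m. m) i = (\<Sum>x\<in>UNIV. qi i $ x * hrow (chY Ch) x)"
    "CZ (\<lambda>m. m) i = (\<Sum>x\<in>UNIV. qi i $ x * hrow (chZ Ch) x)"
    unfolding CY_def CZ_def cond_ent_letter[OF i free_at_Aux] by (rule h)+
qed

text \<open>Messages are uniform, so a function of them with fibres of equal size \<open>c\<close>
  is uniform on \<open>t\<close> values.\<close>

lemma ent_message:
  assumes c: "\<And>m. m \<in> Msg \<Longrightarrow> card {m' \<in> Msg. B m' = B m} = c" and t: "c * t = s0 * s1 * s2"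
  shows "ent (\<lambda>\<omega>. B (fst \<omega>)) = log 2 (real t)"
proof -
  have pos: "0 < c" "0 < t" using t s by (metis mult_is_0 not_gr_zero)+
  have "pr (\<lambda>\<omega>. B (fst \<omega>)) (B (fst \<omega>)) = 1 / real t" if \<omega>: "\<omega> \<in> Msg \<times> Out" for \<omega>
  proof -
    have "pr (\<lambda>\<omega>. B (fst \<omega>)) (B (fst \<omega>)) = (\<Sum>m\<in>Msg. if B m = B (fst \<omega>) then \<Sum>p\<in>Out. Pc (m, p) else 0)"
      unfolding pr_if sum_Msg_Out by (rule sum.cong) auto
    also have "\<dots> = (\<Sum>m\<in>Msg. if B m = B (fst \<omega>) then 1 / real (s0 * s1 * s2) else 0)"
      by (rule sum.cong) (auto simp: sum_Out)
    also have "\<dots> = real (card {m' \<in> Msg. B m' = B (fst \<omega>)}) / real (s0 * s1 * s2)"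
      using finite_Msg by (simp flip: sum.inter_filter)
    also have "\<dots> = 1 / real t"
      using c[of "fst \<omega>"] \<omega> t[symmetric] pos by auto
    finally show ?thesis .
  qed
  then have "ent (\<lambda>\<omega>. B (fst \<omega>)) = - (\<Sum>\<omega>\<in>Msg \<times> Out. Pc \<omega> * log 2 (1 / real t))"
    unfolding ent_def by simp
  also have "\<dots> = - (1 * log 2 (1 / real t))" unfolding sum_distrib_right[symmetric] total ..
  also have "\<dots> = log 2 (real t)" using pos by (simp add: log_divide)
  finally show ?thesis .
qed

abbreviation M01 :: "nat \<times> nat \<times> nat \<Rightarrow> nat \<times> nat" where "M01 m \<equiv> (fst m, fst (snd m))"
abbreviation M02 :: "nat \<times> nat \<times> nat \<Rightarrow> nat \<times> nat" where "M02 m \<equiv> (fst m, snd (snd m))"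

lemma ent_messages:
  "ent (\<lambda>\<omega>. fst (fst \<omega>)) = log 2 (real s0)" "ent (\<lambda>\<omega>. M01 (fst \<omega>)) = log 2 (real (s0 * s1))"
  "ent (\<lambda>\<omega>. M02 (fst \<omega>)) = log 2 (real (s0 * s2))" "ent (\<lambda>\<omega>. fst \<omega>) = log 2 (real (s0 * s1 * s2))"
proof -
  have "{m' \<in> Msg. fst m' = fst m} = {fst m} \<times> {..<s1} \<times> {..<s2}" if "m \<in> Msg" for m
    using that by (auto simp: Msg_def)
  then show "ent (\<lambda>\<omega>. fst (fst \<omega>)) = log 2 (real s0)"
    by (intro ent_message[where c = "s1 * s2"]) (simp_all add: card_cartesian_product)
  have "{m' \<in> Msg. M01 m' = M01 m} = {fst m} \<times> {fst (snd m)} \<times> {..<s2}" if "m \<in> Msg" for m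
    using that by (auto simp: Msg_def)
  then show "ent (\<lambda>\<omega>. M01 (fst \<omega>)) = log 2 (real (s0 * s1))"
    by (intro ent_message[where c = s2]) (simp_all add: card_cartesian_product)
  have "{m' \<in> Msg. M02 m' = M02 m} = {fst m} \<times> {..<s1} \<times> {snd (snd m)}" if "m \<in> Msg" for m
    using that by (auto simp: Msg_def)
  then show "ent (\<lambda>\<omega>. M02 (fst \<omega>)) = log 2 (real (s0 * s2))"
    by (intro ent_message[where c = s1]) (simp_all add: card_cartesian_product)
  have "{m' \<in> Msg. m' = m} = {m}" if "m \<in> Msg" for m
    using that by auto
  then show "ent (\<lambda>\<omega>. fst \<omega>) = log 2 (real (s0 * s1 * s2))"
    by (intro ent_message[where c = 1 and B = "\<lambda>m. m"]) simp_all
qed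

lemma letter_point_in_hull:
  assumes i: "i < n"
  shows "(qi i, CY fst i, CZ fst i, (CY M01 i, CZ M01 i), (CY M02 i, CZ M02 i))
    \<in> convex hull split_points (chY Ch) (chZ Ch)"
  unfolding qi_def CY_def CZ_def cond_ent_letter[OF i free_at_Aux]
  by (rule split_point_in_hull[where f = "\<lambda>(b, r). (fst b, r)" and g = "\<lambda>(b, r). (fst b, r)"])
     (simp_all add: Aux_def)

text \<open>\<open>E1\<close> and \<open>E2\<close> bound the uncertainty left to the two receivers.
  Lowering only R0 by their sum relaxes every inequality at once, including those on the sum rate,
  which use both.\<close>

lemma code_relaxed_region:
  fixes R0 R1 R2 E1 E2 :: real
  assumes n: "0 < n"
    and e1: "ent (\<lambda>\<omega>. (M01 (fst \<omega>), Yn \<omega>)) - ent Yn \<le> E1"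
    and e2: "ent (\<lambda>\<omega>. (M02 (fst \<omega>), Zn \<omega>)) - ent Zn \<le> E2"
    and E: "0 \<le> E1" "0 \<le> E2"
    and R: "n * R0 \<le> log 2 s0 - (E1 + E2)" "n * R1 \<le> log 2 s1" "n * R2 \<le> log 2 s2"
  shows "(R0, R1, R2) \<in> relaxed_region (chY Ch) (chZ Ch)"
proof -
  let ?K = "chY Ch" and ?L = "chZ Ch"
  let ?av = "\<lambda>f. \<Sum>i<n. (1 / real n) * f i"
  \<comment> \<open>A uniform time-sharing index over the letters: averaging keeps the point in the
    hull, as if the index were part of W.\<close>
  define q where "q = (\<Sum>i<n. (1 / real n) *\<^sub>R qi i)"
  define p where "p = (q, ?av (CY fst), ?av (CZ fst), (?av (CY M01), ?av (CZ M01)), (?av (CY M02), ?av (CZ M02)))"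
  have av: "real n * ?av f = (\<Sum>i<n. f i)" for f using n by (simp add: sum_distrib_left)
  have "(\<Sum>i<n. (1 / real n) *\<^sub>R (qi i, CY fst i, CZ fst i, (CY M01 i, CZ M01 i), (CY M02 i, CZ M02 i)))
      \<in> convex hull split_points ?K ?L"
    using n by (intro convex_sum convex_convex_hull letter_point_in_hull) auto
  then have p: "p \<in> convex hull split_points ?K ?L" by (simp add: p_def q_def sum_prod)
  have K: "0 \<le> ?K x y" "0 \<le> ?L x z" for x y z
    unfolding chY_def chZ_def by (auto intro!: sum_nonneg dm_bcD(1)[OF Ch])
  have "?av (\<lambda>i. hout ?K (qi i)) \<le> hout ?K q"
    unfolding q_def using n by (intro hout_jensen K qi_simplex) auto
  then have hY: "ent Yn \<le> n * hout ?K q"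
    using ent_Yn_le av[of "\<lambda>i. hout ?K (qi i)"] mult_left_mono[of "?av (\<lambda>i. hout ?K (qi i))" "hout ?K q" "real n"]
    by (simp add: ent_letter)
  have "?av (\<lambda>i. hout ?L (qi i)) \<le> hout ?L q"
    unfolding q_def using n by (intro hout_jensen K qi_simplex) auto
  then have hZ: "ent Zn \<le> n * hout ?L q"
    using ent_Zn_le av[of "\<lambda>i. hout ?L (qi i)"] mult_left_mono[of "?av (\<lambda>i. hout ?L (qi i))" "hout ?L q" "real n"]
    by (simp add: ent_letter)
  have row: "real n * (\<Sum>x\<in>UNIV. q $ x * hrow J x) = (\<Sum>i<n. \<Sum>x\<in>UNIV. qi i $ x * hrow J x)"
    for J :: "'x \<Rightarrow> 'j::finite \<Rightarrow> real"
  proof -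
    have "(\<Sum>x\<in>UNIV. q $ x * hrow J x) = ?av (\<lambda>i. \<Sum>x\<in>UNIV. qi i $ x * hrow J x)"
      unfolding q_def sum_component sum_distrib_left sum_distrib_right
      by (subst sum.swap) simp
    then show ?thesis by (simp only: av)
  qed
  \<comment> \<open>With all messages known, \<open>CY\<close> is H(Y|X) letter by letter, and these
    entropies sum to at most the entropy of the output word given the messages.\<close>
  have rK: "real n * (\<Sum>x\<in>UNIV. q $ x * hrow ?K x) \<le> ent (\<lambda>\<omega>. (fst \<omega>, Yn \<omega>)) - ent (\<lambda>\<omega>. fst \<omega>)"
    unfolding row using sum_CY_le[of "\<lambda>m. m"] by (simp add: C_full)
  have rL: "real n * (\<Sum>x\<in>UNIV. q $ x * hrow ?L x) \<le> ent (\<lambda>\<omega>. (fst \<omega>, Zn \<omega>)) - ent (\<lambda>\<omega>. fst \<omega>)"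
    unfolding row using sum_CZ_le[of "\<lambda>m. m"] by (simp add: C_full)
  have m0: "ent (\<lambda>\<omega>. (fst (fst \<omega>), Yn \<omega>)) \<le> ent (\<lambda>\<omega>. (M01 (fst \<omega>), Yn \<omega>))"
    "ent (\<lambda>\<omega>. (fst (fst \<omega>), Zn \<omega>)) \<le> ent (\<lambda>\<omega>. (M02 (fst \<omega>), Zn \<omega>))"
    by (rule ent_mono; auto)+
  \<comment> \<open>The second private message given (M0, M1) and the word of Z is no more uncertain
    than (M0, M2) given that word alone.\<close>
  have f2: "ent (\<lambda>\<omega>. (fst \<omega>, Zn \<omega>)) - ent (\<lambda>\<omega>. (M01 (fst \<omega>), Zn \<omega>)) \<le> E2"
  proof -
    have "ent (\<lambda>\<omega>. (snd (snd (fst \<omega>)), M01 (fst \<omega>), Zn \<omega>)) = ent (\<lambda>\<omega>. (fst \<omega>, Zn \<omega>))"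
      by (rule ent_kernel) auto
    moreover have "ent (\<lambda>\<omega>. (snd (snd (fst \<omega>)), Zn \<omega>)) \<le> ent (\<lambda>\<omega>. (M02 (fst \<omega>), Zn \<omega>))"
      by (rule ent_mono) auto
    ultimately show ?thesis
      using ent_submodular[of "\<lambda>\<omega>. snd (snd (fst \<omega>))" "\<lambda>\<omega>. M01 (fst \<omega>)" Zn] e2 by simp
  qed
  have f1: "ent (\<lambda>\<omega>. (fst \<omega>, Yn \<omega>)) - ent (\<lambda>\<omega>. (M02 (fst \<omega>), Yn \<omega>)) \<le> E1"
  proof -
    have "ent (\<lambda>\<omega>. (fst (snd (fst \<omega>)), M02 (fst \<omega>), Yn \<omega>)) = ent (\<lambda>\<omega>. (fst \<omega>, Yn \<omega>))"
      by (rule ent_kernel) auto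
    moreover have "ent (\<lambda>\<omega>. (fst (snd (fst \<omega>)), Yn \<omega>)) \<le> ent (\<lambda>\<omega>. (M01 (fst \<omega>), Yn \<omega>))"
      by (rule ent_mono) auto
    ultimately show ?thesis
      using ent_submodular[of "\<lambda>\<omega>. fst (snd (fst \<omega>))" "\<lambda>\<omega>. M02 (fst \<omega>)" Yn] e1 by simp
  qed
  have cs: "real n * ?av (CZ B) - real n * ?av (CY B) = ent (\<lambda>\<omega>. (B (fst \<omega>), Zn \<omega>)) - ent (\<lambda>\<omega>. (B (fst \<omega>), Yn \<omega>))"
    for B :: "nat \<times> nat \<times> nat \<Rightarrow> nat \<times> nat"
    unfolding av csiszar_sum[symmetric] by (simp add: sum_subtractf)
  have sY: "real n * ?av (CY B) \<le> ent (\<lambda>\<omega>. (B (fst \<omega>), Yn \<omega>)) - ent (\<lambda>\<omega>. B (fst \<omega>))"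
    "real n * ?av (CZ B) \<le> ent (\<lambda>\<omega>. (B (fst \<omega>), Zn \<omega>)) - ent (\<lambda>\<omega>. B (fst \<omega>))"
    for B :: "nat \<times> nat \<times> nat \<Rightarrow> 'b"
    unfolding av by (rule sum_CY_le sum_CZ_le)+
  have lg: "log 2 (real (s0 * s1)) = log 2 s0 + log 2 s1" "log 2 (real (s0 * s2)) = log 2 s0 + log 2 s2"
    "log 2 (real (s0 * s1 * s2)) = log 2 s0 + log 2 s1 + log 2 s2"
    using s by (simp_all add: log_mult)
  have le: "a \<le> b - c" if "real n * a \<le> real n * b - real n * c" for a b c
    using that n by (simp flip: right_diff_distrib)
  have le': "a \<le> b - c + d - f" if "real n * a \<le> real n * b - real n * c + real n * d - real n * f" for a b c d f
    using that n by (simp flip: right_diff_distrib distrib_left)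
  have nR: "real n * (R0 + R1) = real n * R0 + real n * R1" "real n * (R0 + R2) = real n * R0 + real n * R2"
    "real n * (R0 + R1 + R2) = real n * R0 + real n * R1 + real n * R2"
    by (simp_all add: distrib_left)
  note EM = ent_messages[unfolded lg]
  have "R0 \<le> hout ?K q - ?av (CY fst)"
    by (rule le) (use R hY m0(1) sY(1)[of fst] e1 E EM in linarith)
  moreover have "R0 \<le> hout ?L q - ?av (CZ fst)"
    by (rule le) (use R hZ m0(2) sY(2)[of fst] e2 E EM in linarith)
  moreover have "R0 + R1 \<le> hout ?K q - ?av (CY M01)"
    by (rule le, unfold nR) (use R hY sY(1)[of M01] e1 E EM in linarith)
  moreover have "R0 + R2 \<le> hout ?L q - ?av (CZ M02)"
    by (rule le, unfold nR) (use R hZ sY(2)[of M02] e2 E EM in linarith)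
  \<comment> \<open>\<open>cs\<close> trades the averaged entropies for those of (M0, M1) with whole
    output words. Then \<open>e1\<close> pays for decoding (M0, M1) from Y, \<open>f2\<close> for
    adding M2 from Z, and the entropy of all messages remains.\<close>
  moreover have "R0 + R1 + R2 \<le> hout ?K q - ?av (CY M01) + ?av (CZ M01) - (\<Sum>x\<in>UNIV. q $ x * hrow ?L x)"
    by (rule le', unfold nR) (use R hY rL cs[of M01] f2 e1 E EM in linarith)
  moreover have "R0 + R1 + R2 \<le> hout ?L q - ?av (CZ M02) + ?av (CY M02) - (\<Sum>x\<in>UNIV. q $ x * hrow ?K x)"
    by (rule le', unfold nR) (use R hZ rK cs[of M02] f1 e2 E EM in linarith)
  ultimately have "relaxed_bounds ?K ?L p (R0, R1, R2)"
    by (simp add: relaxed_bounds_def p_def)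
  with p show ?thesis unfolding relaxed_region_def by blast
qed

lemma sum_over_Msg: "sum F Msg = (\<Sum>m0<s0. \<Sum>m1<s1. \<Sum>m2<s2. F (m0, m1, m2))" for F :: "_ \<Rightarrow> real"
  by (simp add: Msg_def sum.cartesian_product)

lemma sum_over_Out: "sum F Out = (\<Sum>ys\<in>{ys. length ys = n}. \<Sum>zs\<in>{zs. length zs = n}. F (ys, zs))"
  for F :: "_ \<Rightarrow> real"
  by (simp add: Out_def lists_of_def sum.cartesian_product)

text \<open>The joint error event contains the error event of each receiver; \<open>e\<close> is the
  error probability with the message counts left abstract.\<close>

lemma err_prob_ge:
  fixes d1 :: "'y list \<Rightarrow> nat \<times> nat" and d2 :: "'z list \<Rightarrow> nat \<times> nat"
  defines "e \<equiv> (\<Sum>m0<s0. \<Sum>m1<s1. \<Sum>m2<s2. \<Sum>ys\<in>{ys. length ys = n}. \<Sum>zs\<in>{zs. length zs = n}.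
          chan_prob Ch (enc m0 m1 m2) ys zs * (if d1 ys = (m0, m1) \<and> d2 zs = (m0, m2) then 0 else 1))
     / (real s0 * real s1 * real s2)"
  shows "(\<Sum>\<omega>\<in>{\<omega> \<in> Msg \<times> Out. d1 (Yn \<omega>) \<noteq> M01 (fst \<omega>)}. Pc \<omega>) \<le> e"
    "(\<Sum>\<omega>\<in>{\<omega> \<in> Msg \<times> Out. d2 (Zn \<omega>) \<noteq> M02 (fst \<omega>)}. Pc \<omega>) \<le> e"
proof -
  have "e = (\<Sum>\<omega>\<in>Msg \<times> Out. Pc \<omega> * (if d1 (Yn \<omega>) = M01 (fst \<omega>) \<and> d2 (Zn \<omega>) = M02 (fst \<omega>) then 0 else 1))"
    unfolding e_def sum_Msg_Out sum_over_Msg sum_over_Out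
    by (simp add: Pc_def Yn_def Zn_def cw_def sum_divide_distrib)
  moreover have "(\<Sum>\<omega>\<in>{\<omega> \<in> Msg \<times> Out. d1 (Yn \<omega>) \<noteq> M01 (fst \<omega>)}. Pc \<omega>)
      \<le> (\<Sum>\<omega>\<in>Msg \<times> Out. Pc \<omega> * (if d1 (Yn \<omega>) = M01 (fst \<omega>) \<and> d2 (Zn \<omega>) = M02 (fst \<omega>) then 0 else 1))"
    unfolding sum.inter_filter[OF fin] by (rule sum_mono) (use nonneg in auto)
  moreover have "(\<Sum>\<omega>\<in>{\<omega> \<in> Msg \<times> Out. d2 (Zn \<omega>) \<noteq> M02 (fst \<omega>)}. Pc \<omega>)
      \<le> (\<Sum>\<omega>\<in>Msg \<times> Out. Pc \<omega> * (if d1 (Yn \<omega>) = M01 (fst \<omega>) \<and> d2 (Zn \<omega>) = M02 (fst \<omega>) then 0 else 1))"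
    unfolding sum.inter_filter[OF fin] by (rule sum_mono) (use nonneg in auto)
  ultimately show "(\<Sum>\<omega>\<in>{\<omega> \<in> Msg \<times> Out. d1 (Yn \<omega>) \<noteq> M01 (fst \<omega>)}. Pc \<omega>) \<le> e"
    "(\<Sum>\<omega>\<in>{\<omega> \<in> Msg \<times> Out. d2 (Zn \<omega>) \<noteq> M02 (fst \<omega>)}. Pc \<omega>) \<le> e" by simp_all
qed

end

section \<open>Passage to large block lengths\<close>

lemma msg_size_bounds:
  assumes "0 \<le> R"
  shows "0 < msg_size n R" "real n * R \<le> log 2 (msg_size n R)" "log 2 (msg_size n R) \<le> real n * R + 1"
proof -
  define t where "t = 2 powr (real n * R)"
  have t: "1 \<le> t" unfolding t_def using assms by (intro ge_one_powr_ge_zero) auto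
  have m: "real (msg_size n R) = of_int \<lceil>t\<rceil>" unfolding msg_size_def t_def[symmetric] using t by simp
  have lo: "t \<le> real (msg_size n R)" unfolding m by simp
  \<comment> \<open>Rounding up at most doubles a number that is at least 1, hence costs at most one
    bit.\<close>
  have hi: "real (msg_size n R) \<le> 2 * t" unfolding m using t by linarith
  show "0 < msg_size n R" using lo t by (cases "msg_size n R") auto
  have lt: "log 2 t = real n * R" by (simp add: t_def)
  have "log 2 t \<le> log 2 (msg_size n R)" using lo t by (intro log_mono) auto
  then show "real n * R \<le> log 2 (msg_size n R)" by (simp add: lt)
  have "log 2 (msg_size n R) \<le> log 2 (2 * t)" using hi lo t by (intro log_mono) auto
  also have "\<dots> = 1 + log 2 t" using t by (subst log_mult) auto
  finally show "log 2 (msg_size n R) \<le> real n * R + 1" by (simp add: lt)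
qed

lemma achievable_relaxed_region:
  fixes Ch :: "'x::finite \<Rightarrow> 'y::finite \<Rightarrow> 'z::finite \<Rightarrow> real"
  assumes Ch: "dm_bc Ch" and ach: "achievable Ch R"
  shows "R \<in> relaxed_region (chY Ch) (chZ Ch)"
proof -
  obtain R0 R1 R2 where R: "R = (R0, R1, R2)" by (metis surj_pair)
  obtain enc d1 d2 where nn: "0 \<le> R0" "0 \<le> R1" "0 \<le> R2"
    and len: "\<And>n m0 m1 m2. m0 < msg_size n R0 \<Longrightarrow> m1 < msg_size n R1 \<Longrightarrow> m2 < msg_size n R2
             \<Longrightarrow> length (enc n m0 m1 m2) = n"
    and lim: "(\<lambda>n. err_prob Ch n R0 R1 R2 (enc n) (d1 n) (d2 n)) \<longlonglongrightarrow> 0"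
    using ach unfolding achievable_def R prod.case by blast
  define e where "e n = err_prob Ch n R0 R1 R2 (enc n) (d1 n) (d2 n)" for n
  \<comment> \<open>The normalised sum of both Fano bounds: 2 from their two constants, and 4 from
    rounding, with the common message counted twice and each private one once.\<close>
  define \<delta> where "\<delta> n = 2 * inverse (real n) + e n * (2 * R0 + R1 + R2 + 4 * inverse (real n))" for n
  have "\<delta> \<longlonglongrightarrow> 2 * 0 + 0 * (2 * R0 + R1 + R2 + 4 * 0)"
    unfolding \<delta>_def e_def by (intro tendsto_intros lim lim_inverse_n)
  \<comment> \<open>The shifted index keeps the block length positive. The lowered rate may be
    negative, which \<open>relaxed_region\<close> permits.\<close>
  then have "(\<lambda>n. (R0 - \<delta> (Suc n), R1, R2)) \<longlonglongrightarrow> (R0 - 0, R1, R2)"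
    by (intro tendsto_intros LIMSEQ_Suc) simp
  moreover have "(R0 - \<delta> (Suc n), R1, R2) \<in> relaxed_region (chY Ch) (chZ Ch)" for n
  proof -
    let ?n = "Suc n"
    interpret bc_code Ch ?n "msg_size ?n R0" "msg_size ?n R1" "msg_size ?n R2" "enc ?n"
      by unfold_locales (use Ch msg_size_bounds(1) nn len in auto)
    note b0 = msg_size_bounds[OF nn(1), of ?n] and b1 = msg_size_bounds[OF nn(2), of ?n]
      and b2 = msg_size_bounds[OF nn(3), of ?n]
    let ?l0 = "log 2 (msg_size ?n R0)" and ?l1 = "log 2 (msg_size ?n R1)" and ?l2 = "log 2 (msg_size ?n R2)"
    have err: "(\<Sum>\<omega>\<in>{\<omega> \<in> Msg \<times> Out. d1 ?n (Yn \<omega>) \<noteq> M01 (fst \<omega>)}. Pc \<omega>) \<le> e ?n"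
      "(\<Sum>\<omega>\<in>{\<omega> \<in> Msg \<times> Out. d2 ?n (Zn \<omega>) \<noteq> M02 (fst \<omega>)}. Pc \<omega>) \<le> e ?n"
      unfolding e_def err_prob_def by (rule err_prob_ge)+
    have e0: "0 \<le> e ?n" by (rule order_trans[OF _ err(1)]) (auto intro!: sum_nonneg nonneg)
    have l: "0 \<le> ?l0" "0 \<le> ?l1" "0 \<le> ?l2" using b0 b1 b2 nn by (auto intro: order_trans[rotated])
    define E1 where "E1 = 1 + e ?n * (?l0 + ?l1)"
    define E2 where "E2 = 1 + e ?n * (?l0 + ?l2)"
    have E: "0 \<le> E1" "0 \<le> E2" using e0 l by (auto simp: E1_def E2_def)
    have "ent (\<lambda>\<omega>. (M01 (fst \<omega>), Yn \<omega>)) - ent Yn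
        \<le> 1 + (\<Sum>\<omega>\<in>{\<omega> \<in> Msg \<times> Out. d1 ?n (Yn \<omega>) \<noteq> M01 (fst \<omega>)}. Pc \<omega>)
            * log 2 (card ({..<msg_size ?n R0} \<times> {..<msg_size ?n R1}))"
      by (rule fano) (auto simp: Msg_def)
    also have "log 2 (card ({..<msg_size ?n R0} \<times> {..<msg_size ?n R1})) = ?l0 + ?l1"
      using b0 b1 by (simp add: card_cartesian_product log_mult)
    also have "1 + (\<Sum>\<omega>\<in>{\<omega> \<in> Msg \<times> Out. d1 ?n (Yn \<omega>) \<noteq> M01 (fst \<omega>)}. Pc \<omega>) * (?l0 + ?l1) \<le> E1"
      unfolding E1_def by (intro add_left_mono mult_right_mono err) (use l in auto)
    finally have e1: "ent (\<lambda>\<omega>. (M01 (fst \<omega>), Yn \<omega>)) - ent Yn \<le> E1" .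
    have "ent (\<lambda>\<omega>. (M02 (fst \<omega>), Zn \<omega>)) - ent Zn
        \<le> 1 + (\<Sum>\<omega>\<in>{\<omega> \<in> Msg \<times> Out. d2 ?n (Zn \<omega>) \<noteq> M02 (fst \<omega>)}. Pc \<omega>)
            * log 2 (card ({..<msg_size ?n R0} \<times> {..<msg_size ?n R2}))"
      by (rule fano) (auto simp: Msg_def)
    also have "log 2 (card ({..<msg_size ?n R0} \<times> {..<msg_size ?n R2})) = ?l0 + ?l2"
      using b0 b2 by (simp add: card_cartesian_product log_mult)
    also have "1 + (\<Sum>\<omega>\<in>{\<omega> \<in> Msg \<times> Out. d2 ?n (Zn \<omega>) \<noteq> M02 (fst \<omega>)}. Pc \<omega>) * (?l0 + ?l2) \<le> E2"
      unfolding E2_def by (intro add_left_mono mult_right_mono err) (use l in auto)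
    finally have e2: "ent (\<lambda>\<omega>. (M02 (fst \<omega>), Zn \<omega>)) - ent Zn \<le> E2" .
    have "E1 + E2 = 2 + e ?n * (2 * ?l0 + ?l1 + ?l2)" by (simp add: E1_def E2_def algebra_simps)
    also have "\<dots> \<le> 2 + e ?n * (2 * (?n * R0 + 1) + (?n * R1 + 1) + (?n * R2 + 1))"
      by (intro add_left_mono mult_left_mono add_mono b0 b1 b2 e0) auto
    also have "\<dots> = ?n * \<delta> ?n"
    proof -
      have "2 + c * (2 * (r * R0 + 1) + (r * R1 + 1) + (r * R2 + 1))
          = r * (2 * inverse r + c * (2 * R0 + R1 + R2 + 4 * inverse r))" if "r \<noteq> 0" for r c :: real
        using that by (simp add: field_simps)
      then show ?thesis unfolding \<delta>_def by simp
    qed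
    finally have "?n * (R0 - \<delta> ?n) \<le> ?l0 - (E1 + E2)"
      using b0(2) unfolding right_diff_distrib by linarith
    then show ?thesis
      by (intro code_relaxed_region[OF _ e1 e2 E] b1 b2) simp_all
  qed
  ultimately show ?thesis
    unfolding R using closed_sequentially[OF closed_relaxed_region] by fastforce
qed

theorem theorem2p1:
  fixes Ch :: "'x::finite \<Rightarrow> 'y::finite \<Rightarrow> 'z::finite \<Rightarrow> real"
    and R0 R1 R2 :: real
  assumes "dm_bc Ch"
    and "(R0, R1, R2) \<in> capacity_region Ch"
  shows "(R0, R1, R2) \<in> outer_bound Ch"
proof -
  have "capacity_region Ch \<subseteq> relaxed_region (chY Ch) (chZ Ch)"
    unfolding capacity_region_def
    by (rule closure_minimal) (auto intro: achievable_relaxed_region[OF assms(1)] closed_relaxed_region)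
  then show ?thesis using assms(2) relaxed_region_subset_outer_bound[OF assms(1)] by blast
qed

end
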